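(* (In ZF.) Let $X$ be an infinite Cohen-finite set. Then every compact operator on $\ell^2(X)$ has finite rank.
   Context: Work in ZF with no form of the Axiom of Choice. A set is Dedekind-finite if there is no injection from $\mathbb{N}$ into it. A set $X$ is Cohen-finite if the set of all finite subsets of $X$ is Dedekind-finite. $\ell^2(X)=\{\eta:X\to\mathbb{C} : \sum_{x\in X}|\eta(x)|^2<\infty\}$ (sums being suprema over finite subsets) with the usual inner product. A linear operator $T:\mathcal{H}\to\mathcal{H}$ on a Hilbert space is compact if $T(A)$ is totally bounded for every bounded $A\subseteq\mathcal{H}$. *)

theory Defs
  imports Main
begin

text \<open>
  HOL proves the axiom of choice, so a theorem of ZF about Cohen-finite sets cannot be stated about
  HOL sets: there every infinite set is Dedekind-infinite. ``ZF proves \<open>\<phi>\<close>'' is rendered as ``\<open>\<phi>\<close>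
  holds in every structure that satisfies the axioms of ZF''. The separation and replacement
  schemes range over first-order formulas with parameters only. (Schemes over arbitrary HOL
  predicates would transfer the choice axiom of HOL into the structure.)
\<close>

datatype fm = Mem nat nat | Eq nat nat | Neg fm | Conj fm fm | All nat fm

primrec sat :: "('a \<Rightarrow> 'a \<Rightarrow> bool) \<Rightarrow> (nat \<Rightarrow> 'a) \<Rightarrow> fm \<Rightarrow> bool" where
  "sat mem s (Mem i j) \<longleftrightarrow> mem (s i) (s j)"
| "sat mem s (Eq i j) \<longleftrightarrow> s i = s j"
| "sat mem s (Neg p) \<longleftrightarrow> \<not> sat mem s p"
| "sat mem s (Conj p q) \<longleftrightarrow> sat mem s p \<and> sat mem s q"
| "sat mem s (All i p) \<longleftrightarrow> (\<forall>a. sat mem (s(i := a)) p)"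

text \<open>
  In the following locale everything is interpreted inside the structure: individuals are elements
  of \<^typ>\<open>'a\<close>, all quantifiers range over \<^typ>\<open>'a\<close>, and a HOL set over \<^typ>\<open>'a\<close> occurs only as a class
  given by a first-order condition. \<open>elts a\<close> is the class of members of \<open>a\<close>.
\<close>

locale membership =
  fixes mem :: "'a \<Rightarrow> 'a \<Rightarrow> bool"
begin

definition elts :: "'a \<Rightarrow> 'a set" where
  "elts a = {x. mem x a}"

end

locale ZF_model = membership mem for mem :: "'a \<Rightarrow> 'a \<Rightarrow> bool" +
  assumes extensionality: "elts a = elts b \<Longrightarrow> a = b"
    and foundation: "elts a \<noteq> {} \<Longrightarrow> \<exists>b\<in>elts a. elts a \<inter> elts b = {}"
    and pairing: "\<exists>c. elts c = {a, b}"
    and union: "\<exists>c. elts c = (\<Union>b\<in>elts a. elts b)"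
    and powerset: "\<exists>c. elts c = {b. elts b \<subseteq> elts a}"
    and infinity: "\<exists>w. (\<exists>e\<in>elts w. elts e = {}) \<and>
                       (\<forall>x\<in>elts w. \<exists>y\<in>elts w. elts y = insert x (elts x))"
    and separation: "\<exists>c. elts c = {x \<in> elts a. sat mem (s(0 := x)) p}"
    and replacement:
      "(\<And>x y z. x \<in> elts a \<Longrightarrow> sat mem (s(0 := x, 1 := y)) p \<Longrightarrow>
                 sat mem (s(0 := x, 1 := z)) p \<Longrightarrow> y = z)
       \<Longrightarrow> \<exists>c. elts c = {y. \<exists>x\<in>elts a. sat mem (s(0 := x, 1 := y)) p}"

text \<open>
  Six elements of the structure: an internal set, two internal binary operations on it, an
  internal binary relation, and two constants. They serve as the real numbers.
\<close>

record 'a reals =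
  Rset :: 'a
  Radd :: 'a
  Rmul :: 'a
  Rle :: 'a
  Rzero :: 'a
  Rone :: 'a

context membership
begin

text \<open>
  Definite descriptions are used only where ZF proves unique existence. In particular
  \<open>the_set A\<close> is only used for classes \<open>A\<close> that are sets by the axioms of ZF.
\<close>

definition the_set :: "'a set \<Rightarrow> 'a" where
  "the_set A = (THE c. elts c = A)"

definition opair :: "'a \<Rightarrow> 'a \<Rightarrow> 'a" where
  "opair a b = the_set {the_set {a}, the_set {a, b}}"

definition cart :: "'a \<Rightarrow> 'a \<Rightarrow> 'a" where
  "cart A B = the_set {opair a b |a b. a \<in> elts A \<and> b \<in> elts B}"

definition func :: "'a \<Rightarrow> 'a \<Rightarrow> 'a \<Rightarrow> bool" where
  "func f A B \<longleftrightarrow> elts f \<subseteq> elts (cart A B) \<and> (\<forall>a\<in>elts A. \<exists>!b. opair a b \<in> elts f)"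

definition app :: "'a \<Rightarrow> 'a \<Rightarrow> 'a" where
  "app f a = (THE b. opair a b \<in> elts f)"

definition lam :: "'a \<Rightarrow> ('a \<Rightarrow> 'a) \<Rightarrow> 'a" where
  "lam A t = the_set {opair a (t a) |a. a \<in> elts A}"

definition image :: "'a \<Rightarrow> 'a \<Rightarrow> 'a" where
  "image f A = the_set {app f a |a. a \<in> elts A}"

definition injection :: "'a \<Rightarrow> 'a \<Rightarrow> 'a \<Rightarrow> bool" where
  "injection f A B \<longleftrightarrow> func f A B \<and>
     (\<forall>a\<in>elts A. \<forall>b\<in>elts A. app f a = app f b \<longrightarrow> a = b)"

definition bijection :: "'a \<Rightarrow> 'a \<Rightarrow> 'a \<Rightarrow> bool" where
  "bijection f A B \<longleftrightarrow> injection f A B \<and> (\<forall>b\<in>elts B. \<exists>a\<in>elts A. app f a = b)"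

definition empty :: 'a where
  "empty = the_set {}"

definition adjoin :: "'a \<Rightarrow> 'a \<Rightarrow> 'a" where
  "adjoin x A = the_set (insert x (elts A))"

text \<open>The natural numbers of the structure (von Neumann); they may be non-standard.\<close>

definition omega :: 'a where
  "omega = the_set {n. \<forall>w. empty \<in> elts w \<and> (\<forall>x\<in>elts w. adjoin x x \<in> elts w) \<longrightarrow> n \<in> elts w}"

definition finite_set :: "'a \<Rightarrow> bool" where
  "finite_set A \<longleftrightarrow> (\<exists>n\<in>elts omega. \<exists>f. bijection f n A)"

definition Dedekind_finite :: "'a \<Rightarrow> bool" where
  "Dedekind_finite A \<longleftrightarrow> \<not> (\<exists>f. injection f omega A)"

definition Fin :: "'a \<Rightarrow> 'a" where
  "Fin X = the_set {F. elts F \<subseteq> elts X \<and> finite_set F}"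

definition Cohen_finite :: "'a \<Rightarrow> bool" where
  "Cohen_finite X \<longleftrightarrow> Dedekind_finite (Fin X)"


subsection \<open>Real and complex numbers\<close>

definition radd :: "'a reals \<Rightarrow> 'a \<Rightarrow> 'a \<Rightarrow> 'a" where
  "radd S a b = app (Radd S) (opair a b)"

definition rmul :: "'a reals \<Rightarrow> 'a \<Rightarrow> 'a \<Rightarrow> 'a" where
  "rmul S a b = app (Rmul S) (opair a b)"

definition rle :: "'a reals \<Rightarrow> 'a \<Rightarrow> 'a \<Rightarrow> bool" where
  "rle S a b \<longleftrightarrow> opair a b \<in> elts (Rle S)"

definition rless :: "'a reals \<Rightarrow> 'a \<Rightarrow> 'a \<Rightarrow> bool" where
  "rless S a b \<longleftrightarrow> rle S a b \<and> a \<noteq> b"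

definition rneg :: "'a reals \<Rightarrow> 'a \<Rightarrow> 'a" where
  "rneg S a = (THE b. b \<in> elts (Rset S) \<and> radd S a b = Rzero S)"

definition is_lub :: "'a reals \<Rightarrow> 'a \<Rightarrow> 'a \<Rightarrow> bool" where
  "is_lub S A s \<longleftrightarrow> s \<in> elts (Rset S) \<and> (\<forall>a\<in>elts A. rle S a s) \<and>
     (\<forall>b\<in>elts (Rset S). (\<forall>a\<in>elts A. rle S a b) \<longrightarrow> rle S s b)"

definition ordered_field :: "'a reals \<Rightarrow> bool" where
  "ordered_field S \<longleftrightarrow> (let R = elts (Rset S) in
     func (Radd S) (cart (Rset S) (Rset S)) (Rset S) \<and>
     func (Rmul S) (cart (Rset S) (Rset S)) (Rset S) \<and>
     elts (Rle S) \<subseteq> elts (cart (Rset S) (Rset S)) \<and>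
     Rzero S \<in> R \<and> Rone S \<in> R \<and> Rzero S \<noteq> Rone S \<and>
     (\<forall>a\<in>R. \<forall>b\<in>R. \<forall>c\<in>R. radd S (radd S a b) c = radd S a (radd S b c)) \<and>
     (\<forall>a\<in>R. \<forall>b\<in>R. radd S a b = radd S b a) \<and>
     (\<forall>a\<in>R. radd S (Rzero S) a = a) \<and>
     (\<forall>a\<in>R. \<exists>b\<in>R. radd S a b = Rzero S) \<and>
     (\<forall>a\<in>R. \<forall>b\<in>R. \<forall>c\<in>R. rmul S (rmul S a b) c = rmul S a (rmul S b c)) \<and>
     (\<forall>a\<in>R. \<forall>b\<in>R. rmul S a b = rmul S b a) \<and>
     (\<forall>a\<in>R. rmul S (Rone S) a = a) \<and>
     (\<forall>a\<in>R. a \<noteq> Rzero S \<longrightarrow> (\<exists>b\<in>R. rmul S a b = Rone S)) \<and>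
     (\<forall>a\<in>R. \<forall>b\<in>R. \<forall>c\<in>R. rmul S a (radd S b c) = radd S (rmul S a b) (rmul S a c)) \<and>
     (\<forall>a\<in>R. \<forall>b\<in>R. rle S a b \<or> rle S b a) \<and>
     (\<forall>a\<in>R. \<forall>b\<in>R. rle S a b \<and> rle S b a \<longrightarrow> a = b) \<and>
     (\<forall>a\<in>R. \<forall>b\<in>R. \<forall>c\<in>R. rle S a b \<and> rle S b c \<longrightarrow> rle S a c) \<and>
     (\<forall>a\<in>R. \<forall>b\<in>R. \<forall>c\<in>R. rle S a b \<longrightarrow> rle S (radd S a c) (radd S b c)) \<and>
     (\<forall>a\<in>R. \<forall>b\<in>R. rle S (Rzero S) a \<and> rle S (Rzero S) b \<longrightarrow> rle S (Rzero S) (rmul S a b)))"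

text \<open>
  ZF proves that a complete ordered field exists and that it is unique up to isomorphism, so
  quantifying over all of them does not depend on a construction of the reals.
\<close>

definition complete_ordered_field :: "'a reals \<Rightarrow> bool" where
  "complete_ordered_field S \<longleftrightarrow> ordered_field S \<and>
     (\<forall>A. elts A \<subseteq> elts (Rset S) \<and> elts A \<noteq> {} \<and>
          (\<exists>b\<in>elts (Rset S). \<forall>a\<in>elts A. rle S a b) \<longrightarrow> (\<exists>s. is_lub S A s))"

definition Cset :: "'a reals \<Rightarrow> 'a" where
  "Cset S = cart (Rset S) (Rset S)"

definition re :: "'a \<Rightarrow> 'a" where
  "re c = (THE a. \<exists>b. c = opair a b)"

definition im :: "'a \<Rightarrow> 'a" where
  "im c = (THE b. \<exists>a. c = opair a b)"

definition czero :: "'a reals \<Rightarrow> 'a" where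
  "czero S = opair (Rzero S) (Rzero S)"

definition cadd :: "'a reals \<Rightarrow> 'a \<Rightarrow> 'a \<Rightarrow> 'a" where
  "cadd S c d = opair (radd S (re c) (re d)) (radd S (im c) (im d))"

definition cneg :: "'a reals \<Rightarrow> 'a \<Rightarrow> 'a" where
  "cneg S c = opair (rneg S (re c)) (rneg S (im c))"

definition cmul :: "'a reals \<Rightarrow> 'a \<Rightarrow> 'a \<Rightarrow> 'a" where
  "cmul S c d =
     opair (radd S (rmul S (re c) (re d)) (rneg S (rmul S (im c) (im d))))
           (radd S (rmul S (re c) (im d)) (rmul S (im c) (re d)))"

text \<open>\<open>cmod2 S c\<close> is the real number \<open>|c|\<close> squared.\<close>

definition cmod2 :: "'a reals \<Rightarrow> 'a \<Rightarrow> 'a" where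
  "cmod2 S c = radd S (rmul S (re c) (re c)) (rmul S (im c) (im c))"


subsection \<open>The Hilbert space of square-summable functions\<close>

text \<open>
  The internal function that maps each finite subset \<open>F\<close> of \<open>X\<close> to the sum of \<open>g x\<close> over
  \<open>x\<close> in \<open>F\<close>, determined by recursion on \<open>F\<close>.
\<close>

definition finsums :: "'a reals \<Rightarrow> 'a \<Rightarrow> ('a \<Rightarrow> 'a) \<Rightarrow> 'a" where
  "finsums S X g = (THE h. func h (Fin X) (Rset S) \<and>
     app h empty = Rzero S \<and>
     (\<forall>F\<in>elts (Fin X). \<forall>x\<in>elts X - elts F. app h (adjoin x F) = radd S (app h F) (g x)))"

definition partial_sums :: "'a reals \<Rightarrow> 'a \<Rightarrow> 'a \<Rightarrow> 'a" where
  "partial_sums S X \<eta> = image (finsums S X (\<lambda>x. cmod2 S (app \<eta> x))) (Fin X)"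

definition l2 :: "'a reals \<Rightarrow> 'a \<Rightarrow> 'a" where
  "l2 S X = the_set {\<eta>. func \<eta> X (Cset S) \<and>
     (\<exists>b\<in>elts (Rset S). \<forall>a\<in>elts (partial_sums S X \<eta>). rle S a b)}"

definition vzero :: "'a reals \<Rightarrow> 'a \<Rightarrow> 'a" where
  "vzero S X = lam X (\<lambda>x. czero S)"

definition vadd :: "'a reals \<Rightarrow> 'a \<Rightarrow> 'a \<Rightarrow> 'a \<Rightarrow> 'a" where
  "vadd S X \<eta> \<zeta> = lam X (\<lambda>x. cadd S (app \<eta> x) (app \<zeta> x))"

definition vscale :: "'a reals \<Rightarrow> 'a \<Rightarrow> 'a \<Rightarrow> 'a \<Rightarrow> 'a" where
  "vscale S X c \<eta> = lam X (\<lambda>x. cmul S c (app \<eta> x))"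

definition vdiff :: "'a reals \<Rightarrow> 'a \<Rightarrow> 'a \<Rightarrow> 'a \<Rightarrow> 'a" where
  "vdiff S X \<eta> \<zeta> = lam X (\<lambda>x. cadd S (app \<eta> x) (cneg S (app \<zeta> x)))"

text \<open>
  \<open>normsq S X \<eta>\<close> is the inner product of \<open>\<eta>\<close> with itself. The inner product is needed only
  through the norm.
\<close>

definition normsq :: "'a reals \<Rightarrow> 'a \<Rightarrow> 'a \<Rightarrow> 'a" where
  "normsq S X \<eta> = (THE s. is_lub S (partial_sums S X \<eta>) s)"

definition l2norm :: "'a reals \<Rightarrow> 'a \<Rightarrow> 'a \<Rightarrow> 'a" where
  "l2norm S X \<eta> = (THE r. r \<in> elts (Rset S) \<and> rle S (Rzero S) r \<and> rmul S r r = normsq S X \<eta>)"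

definition bounded :: "'a reals \<Rightarrow> 'a \<Rightarrow> 'a \<Rightarrow> bool" where
  "bounded S X A \<longleftrightarrow> (\<exists>K\<in>elts (Rset S). \<forall>\<eta>\<in>elts A. rle S (l2norm S X \<eta>) K)"

definition totally_bounded :: "'a reals \<Rightarrow> 'a \<Rightarrow> 'a \<Rightarrow> bool" where
  "totally_bounded S X A \<longleftrightarrow> (\<forall>e\<in>elts (Rset S). rless S (Rzero S) e \<longrightarrow>
     (\<exists>N. finite_set N \<and> elts N \<subseteq> elts (l2 S X) \<and>
        (\<forall>\<eta>\<in>elts A. \<exists>\<zeta>\<in>elts N. rless S (l2norm S X (vdiff S X \<eta> \<zeta>)) e)))"


subsection \<open>Operators\<close>

definition linear_operator :: "'a reals \<Rightarrow> 'a \<Rightarrow> 'a \<Rightarrow> bool" where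
  "linear_operator S X T \<longleftrightarrow> func T (l2 S X) (l2 S X) \<and>
     (\<forall>\<eta>\<in>elts (l2 S X). \<forall>\<zeta>\<in>elts (l2 S X).
        app T (vadd S X \<eta> \<zeta>) = vadd S X (app T \<eta>) (app T \<zeta>)) \<and>
     (\<forall>c\<in>elts (Cset S). \<forall>\<eta>\<in>elts (l2 S X).
        app T (vscale S X c \<eta>) = vscale S X c (app T \<eta>))"

definition compact_operator :: "'a reals \<Rightarrow> 'a \<Rightarrow> 'a \<Rightarrow> bool" where
  "compact_operator S X T \<longleftrightarrow> linear_operator S X T \<and>
     (\<forall>A. elts A \<subseteq> elts (l2 S X) \<and> bounded S X A \<longrightarrow> totally_bounded S X (image T A))"

definition subspace :: "'a reals \<Rightarrow> 'a \<Rightarrow> 'a \<Rightarrow> bool" where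
  "subspace S X W \<longleftrightarrow> elts W \<subseteq> elts (l2 S X) \<and> vzero S X \<in> elts W \<and>
     (\<forall>\<eta>\<in>elts W. \<forall>\<zeta>\<in>elts W. vadd S X \<eta> \<zeta> \<in> elts W) \<and>
     (\<forall>c\<in>elts (Cset S). \<forall>\<eta>\<in>elts W. vscale S X c \<eta> \<in> elts W)"

definition span :: "'a reals \<Rightarrow> 'a \<Rightarrow> 'a \<Rightarrow> 'a" where
  "span S X B = the_set {\<eta>. \<forall>W. subspace S X W \<and> elts B \<subseteq> elts W \<longrightarrow> \<eta> \<in> elts W}"

text \<open>The range is finite-dimensional, that is, spanned by a finite set.\<close>

definition finite_rank :: "'a reals \<Rightarrow> 'a \<Rightarrow> 'a \<Rightarrow> bool" where
  "finite_rank S X T \<longleftrightarrow>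
     (\<exists>B. finite_set B \<and> elts B \<subseteq> elts (l2 S X) \<and> image T (l2 S X) = span S X B)"

end

end

theory Submission
  imports Defs "HOL-Algebra.Ring"
begin

text \<open>
  The range of a compact operator \<open>T\<close> on \<open>l\<^sup>2(X)\<close> consists of functions supported in one fixed finite
  set; a subspace of such functions is spanned by finitely many of its elements.

  For a real \<open>t \<ge> 0\<close> let \<open>G\<^sub>t\<close> be the set of all \<open>z\<close> such that \<open>1 \<le> t |(T \<eta>)(z)|\<^sup>2\<close> for some \<open>\<eta>\<close> with
  \<open>\<parallel>\<eta>\<parallel>\<^sup>2 \<le> t\<close>. Compactness makes \<open>G\<^sub>t\<close> finite: the image of that ball has a finite net, each member of
  the net is small off a finite set, and so every \<open>T \<eta>\<close> is small off the union of these finite sets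
  (\<open>large_finite\<close>). The sets \<open>G\<^sub>t\<close> grow with \<open>t\<close>, hence they form a chain of finite subsets of \<open>X\<close>. An
  infinite chain of finite sets without a largest element carries the map that sends each member to
  the next one. It is injective and misses the least member, so the chain, and with it the set of
  finite subsets of \<open>X\<close>, is Dedekind-infinite. As \<open>X\<close> is Cohen-finite, the union \<open>G\<close> of all \<open>G\<^sub>t\<close> is
  finite (\<open>chain_union_finite\<close>). Every \<open>T \<eta>\<close> vanishes off \<open>G\<close>, because any \<open>\<eta>\<close> and any nonzero value
  \<open>(T \<eta>)(z)\<close> are caught by a large enough \<open>t\<close> (\<open>range_finite_support\<close>). No choice is used: the net is
  chosen for one \<open>t\<close> at a time, while \<open>G\<^sub>t\<close> itself is defined without it. Finally, a subspace of
  functions supported in a finite set is finitely generated by elimination of one coordinate at a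
  time (\<open>finitely_generated\<close>).

  All this takes place inside a model of ZF, where a class of elements may be treated as a set only if
  it is cut out of a set by a first-order formula with parameters. The predicate \<open>definable\<close> records
  that a predicate on variable assignments is given by such a formula. Its closure properties are
  introduction rules that follow the syntax of a HOL formula, so definability of each predicate that
  occurs below is proved by repeated introduction. Every induction over \<open>omega\<close> or over finite sets has
  a definability premise for the same reason.
\<close>

section \<open>Ordered fields on a carrier set\<close>

text \<open>
  The reals of the model are a subset of a HOL type, not a type of their own, so the type classes
  for ordered fields do not apply to them.
\<close>

locale ordered_field_carrier = field R for R :: "('r, 'm) ring_scheme" (structure) +
  fixes le :: "'r \<Rightarrow> 'r \<Rightarrow> bool" (infix "\<preceq>" 50)
  assumes le_total: "a \<in> carrier R \<Longrightarrow> b \<in> carrier R \<Longrightarrow> a \<preceq> b \<or> b \<preceq> a"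
    and le_antisym: "a \<in> carrier R \<Longrightarrow> b \<in> carrier R \<Longrightarrow> a \<preceq> b \<Longrightarrow> b \<preceq> a \<Longrightarrow> a = b"
    and le_trans: "a \<in> carrier R \<Longrightarrow> b \<in> carrier R \<Longrightarrow> c \<in> carrier R \<Longrightarrow>
                     a \<preceq> b \<Longrightarrow> b \<preceq> c \<Longrightarrow> a \<preceq> c"
    and le_add: "a \<in> carrier R \<Longrightarrow> b \<in> carrier R \<Longrightarrow> c \<in> carrier R \<Longrightarrow>
                     a \<preceq> b \<Longrightarrow> a \<oplus> c \<preceq> b \<oplus> c"
    and nonneg_mult: "a \<in> carrier R \<Longrightarrow> b \<in> carrier R \<Longrightarrow> \<zero> \<preceq> a \<Longrightarrow> \<zero> \<preceq> b \<Longrightarrow> \<zero> \<preceq> a \<otimes> b"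
begin

lemma le_refl: "a \<in> carrier R \<Longrightarrow> a \<preceq> a"
  using le_total by blast

lemma le_iff_diff:
  assumes "a \<in> carrier R" "b \<in> carrier R"
  shows "a \<preceq> b \<longleftrightarrow> \<zero> \<preceq> b \<ominus> a"
proof
  assume "a \<preceq> b"
  then have "a \<oplus> \<ominus> a \<preceq> b \<oplus> \<ominus> a" using assms by (intro le_add) auto
  then show "\<zero> \<preceq> b \<ominus> a" using assms by (simp add: r_neg minus_eq)
next
  assume "\<zero> \<preceq> b \<ominus> a"
  then have "\<zero> \<oplus> a \<preceq> (b \<ominus> a) \<oplus> a" using assms by (intro le_add) auto
  moreover have "(b \<ominus> a) \<oplus> a = b" using assms by algebra
  ultimately show "a \<preceq> b" using assms by simp
qed

lemma nonneg_add:
  assumes "a \<in> carrier R" "b \<in> carrier R" "\<zero> \<preceq> a" "\<zero> \<preceq> b"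
  shows "\<zero> \<preceq> a \<oplus> b"
proof -
  have "\<zero> \<oplus> b \<preceq> a \<oplus> b" using assms by (intro le_add) auto
  then show ?thesis using assms le_trans[of \<zero> b "a \<oplus> b"] by simp
qed

lemma add_mono:
  assumes "a \<in> carrier R" "b \<in> carrier R" "c \<in> carrier R" "d \<in> carrier R" "a \<preceq> b" "c \<preceq> d"
  shows "a \<oplus> c \<preceq> b \<oplus> d"
proof -
  have "a \<oplus> c \<preceq> b \<oplus> c" using assms by (intro le_add) auto
  moreover have "c \<oplus> b \<preceq> d \<oplus> b" using assms by (intro le_add) auto
  ultimately show ?thesis using assms le_trans[of "a \<oplus> c" "b \<oplus> c" "b \<oplus> d"] by (simp add: a_comm)
qed

lemma mult_mono_left:
  assumes "a \<in> carrier R" "b \<in> carrier R" "c \<in> carrier R" "\<zero> \<preceq> c" "a \<preceq> b"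
  shows "c \<otimes> a \<preceq> c \<otimes> b"
proof -
  have "\<zero> \<preceq> c \<otimes> (b \<ominus> a)" using assms le_iff_diff by (intro nonneg_mult) auto
  moreover have "c \<otimes> (b \<ominus> a) = c \<otimes> b \<ominus> c \<otimes> a" using assms by algebra
  ultimately show ?thesis using assms le_iff_diff by simp
qed

lemma nonneg_neg:
  assumes "a \<in> carrier R" "a \<preceq> \<zero>"
  shows "\<zero> \<preceq> \<ominus> a"
proof -
  have "\<zero> \<ominus> a = \<ominus> a" using assms by algebra
  then show ?thesis using le_iff_diff[of a \<zero>] assms by simp
qed

lemma nonneg_sq:
  assumes "a \<in> carrier R"
  shows "\<zero> \<preceq> a \<otimes> a"
proof (cases "\<zero> \<preceq> a")
  case True
  then show ?thesis using assms nonneg_mult by blast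
next
  case False
  then have "\<zero> \<preceq> \<ominus> a" using le_total[of a \<zero>] nonneg_neg[of a] assms by auto
  then have "\<zero> \<preceq> \<ominus> a \<otimes> \<ominus> a" using assms by (intro nonneg_mult) auto
  moreover have "\<ominus> a \<otimes> \<ominus> a = a \<otimes> a" using assms by algebra
  ultimately show ?thesis by simp
qed

lemma nonneg_one: "\<zero> \<preceq> \<one>"
  using nonneg_sq[of \<one>] by simp

lemma nonneg_sumsq:
  "a \<in> carrier R \<Longrightarrow> b \<in> carrier R \<Longrightarrow> \<zero> \<preceq> a \<otimes> a \<oplus> b \<otimes> b"
  by (intro nonneg_add nonneg_sq) auto

lemma le_add_nonneg:
  assumes "a \<in> carrier R" "b \<in> carrier R" "\<zero> \<preceq> b"
  shows "a \<preceq> a \<oplus> b"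
  using add_mono[of a a \<zero> b] assms le_refl by simp

lemma sumsq_eq_zero:
  assumes "a \<in> carrier R" "b \<in> carrier R" "a \<otimes> a \<oplus> b \<otimes> b = \<zero>"
  shows "a = \<zero>" "b = \<zero>"
proof -
  have "a \<otimes> a \<preceq> \<zero>" using le_add_nonneg[of "a \<otimes> a" "b \<otimes> b"] nonneg_sq assms by simp
  then have a2: "a \<otimes> a = \<zero>" using nonneg_sq le_antisym assms by simp
  then show "a = \<zero>" using integral assms by blast
  have "b \<otimes> b = \<zero>" using a2 assms by simp
  then show "b = \<zero>" using integral assms by blast
qed

lemma inverse_pos:
  assumes "a \<in> carrier R" "\<zero> \<preceq> a" "a \<noteq> \<zero>"
  obtains i where "i \<in> carrier R" "\<zero> \<preceq> i" "i \<noteq> \<zero>" "a \<otimes> i = \<one>"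
proof
  have u: "a \<in> Units R" using assms field_Units by auto
  show i: "inv a \<in> carrier R" "a \<otimes> inv a = \<one>" using u by auto
  show "inv a \<noteq> \<zero>" using i assms by auto
  have "a \<otimes> (inv a \<otimes> inv a) = a \<otimes> inv a \<otimes> inv a" using i(1) assms(1) by algebra
  then have "a \<otimes> (inv a \<otimes> inv a) = inv a" using i by simp
  moreover have "\<zero> \<preceq> a \<otimes> (inv a \<otimes> inv a)" using i assms nonneg_mult nonneg_sq by simp
  ultimately show "\<zero> \<preceq> inv a" by simp
qed

lemma one_add_pos:
  assumes "a \<in> carrier R" "\<zero> \<preceq> a"
  shows "\<zero> \<preceq> \<one> \<oplus> a" "\<one> \<oplus> a \<noteq> \<zero>"
proof -
  show "\<zero> \<preceq> \<one> \<oplus> a" using assms nonneg_one by (intro nonneg_add) auto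
  have "\<one> \<preceq> \<one> \<oplus> a" using assms by (intro le_add_nonneg) auto
  then show "\<one> \<oplus> a \<noteq> \<zero>" using nonneg_one le_antisym[of \<zero> \<one>] by auto
qed

lemma le_one_add_square:
  assumes "a \<in> carrier R" "\<zero> \<preceq> a"
  shows "a \<preceq> (\<one> \<oplus> a) \<otimes> (\<one> \<oplus> a)"
proof -
  have "(\<one> \<oplus> a) \<otimes> (\<one> \<oplus> a) = a \<oplus> (\<one> \<oplus> a \<oplus> a \<otimes> a)" using assms(1) by algebra
  moreover have "\<zero> \<preceq> \<one> \<oplus> a \<oplus> a \<otimes> a"
    using assms nonneg_one by (intro nonneg_add nonneg_sq) auto
  ultimately show ?thesis using le_add_nonneg[of a] assms by simp
qed

text \<open>
  If \<open>a\<close> were larger than \<open>b\<close>, then \<open>(a - b)(a + b) \<ge> 0\<close> would force \<open>a\<^sup>2 = b\<^sup>2\<close>, so one of the two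
  factors would vanish.
\<close>

lemma sq_le_imp_le:
  assumes "a \<in> carrier R" "b \<in> carrier R" "\<zero> \<preceq> a" "\<zero> \<preceq> b" "a \<otimes> a \<preceq> b \<otimes> b"
  shows "a \<preceq> b"
proof (rule ccontr)
  assume n: "\<not> a \<preceq> b"
  then have ba: "b \<preceq> a" using assms le_total by blast
  then have d: "\<zero> \<preceq> a \<ominus> b" using assms le_iff_diff by simp
  have s: "\<zero> \<preceq> a \<oplus> b" using assms nonneg_add by simp
  have "\<zero> \<preceq> (a \<ominus> b) \<otimes> (a \<oplus> b)" using d s assms nonneg_mult by simp
  moreover have "\<ominus> ((a \<ominus> b) \<otimes> (a \<oplus> b)) = b \<otimes> b \<ominus> a \<otimes> a" using assms by algebra
  moreover have "(a \<ominus> b) \<otimes> (a \<oplus> b) = a \<otimes> a \<ominus> b \<otimes> b" using assms by algebra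
  ultimately have "b \<otimes> b \<preceq> a \<otimes> a" using assms le_iff_diff[of "b \<otimes> b" "a \<otimes> a"] by simp
  then have "a \<otimes> a = b \<otimes> b" using assms le_antisym by simp
  then have "(a \<ominus> b) \<otimes> (a \<oplus> b) = \<zero>" using \<open>(a \<ominus> b) \<otimes> (a \<oplus> b) = a \<otimes> a \<ominus> b \<otimes> b\<close> assms by (simp add: r_neg minus_eq)
  then have "a \<ominus> b = \<zero> \<or> a \<oplus> b = \<zero>" using integral assms by simp
  then show False
  proof
    assume "a \<ominus> b = \<zero>"
    moreover have "(a \<ominus> b) \<oplus> b = a" using assms(1,2) by algebra
    ultimately show False using n le_refl assms by auto
  next
    assume "a \<oplus> b = \<zero>"
    then have "a \<preceq> \<zero>" using le_add_nonneg[of a b] assms by simp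
    then have "a \<preceq> b" using le_trans[of a \<zero> b] assms by simp
    then show False using n by simp
  qed
qed

lemma sqrt_unique:
  assumes "a \<in> carrier R" "b \<in> carrier R" "\<zero> \<preceq> a" "\<zero> \<preceq> b" "a \<otimes> a = b \<otimes> b"
  shows "a = b"
  using assms sq_le_imp_le[of a b] sq_le_imp_le[of b a] le_refl[of "a \<otimes> a"] le_antisym by simp

lemma parallelogram_bound:
  assumes "a \<in> carrier R" "b \<in> carrier R"
  shows "(a \<oplus> b) \<otimes> (a \<oplus> b) \<preceq> (\<one> \<oplus> \<one>) \<otimes> (a \<otimes> a \<oplus> b \<otimes> b)"
proof -
  have "(\<one> \<oplus> \<one>) \<otimes> (a \<otimes> a \<oplus> b \<otimes> b) \<ominus> (a \<oplus> b) \<otimes> (a \<oplus> b) = (a \<ominus> b) \<otimes> (a \<ominus> b)"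
    using assms by algebra
  then show ?thesis using assms nonneg_sq[of "a \<ominus> b"] le_iff_diff[of "(a \<oplus> b) \<otimes> (a \<oplus> b)"] by simp
qed

text \<open>
  The complex inequality \<open>|w + u|\<^sup>2 \<le> 2 (|w|\<^sup>2 + |u|\<^sup>2)\<close> in coordinates.
\<close>

lemma modulus_bound:
  assumes "a \<in> carrier R" "b \<in> carrier R" "c \<in> carrier R" "d \<in> carrier R"
  shows "(a \<oplus> c) \<otimes> (a \<oplus> c) \<oplus> (b \<oplus> d) \<otimes> (b \<oplus> d)
    \<preceq> (\<one> \<oplus> \<one>) \<otimes> ((a \<otimes> a \<oplus> b \<otimes> b) \<oplus> (c \<otimes> c \<oplus> d \<otimes> d))"
proof -
  have "(\<one> \<oplus> \<one>) \<otimes> (a \<otimes> a \<oplus> c \<otimes> c) \<oplus> (\<one> \<oplus> \<one>) \<otimes> (b \<otimes> b \<oplus> d \<otimes> d)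
     = (\<one> \<oplus> \<one>) \<otimes> ((a \<otimes> a \<oplus> b \<otimes> b) \<oplus> (c \<otimes> c \<oplus> d \<otimes> d))"
    using assms by algebra
  then show ?thesis
    using assms add_mono[OF _ _ _ _ parallelogram_bound[of a c] parallelogram_bound[of b d]] by simp
qed

text \<open>
  The supremum of the nonnegative numbers with square at most \<open>a\<close> is the square root of \<open>a\<close>: if its
  square is smaller, there is room for a larger element of this set, and if its square is larger,
  there is a smaller upper bound.
\<close>

lemma square_root_supremum:
  assumes a: "a \<in> carrier R" "\<zero> \<preceq> a" and s: "s \<in> carrier R"
    and ub: "\<And>r. r \<in> carrier R \<Longrightarrow> \<zero> \<preceq> r \<Longrightarrow> r \<otimes> r \<preceq> a \<Longrightarrow> r \<preceq> s"
    and least: "\<And>u. u \<in> carrier R \<Longrightarrow>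
      (\<And>r. r \<in> carrier R \<Longrightarrow> \<zero> \<preceq> r \<Longrightarrow> r \<otimes> r \<preceq> a \<Longrightarrow> r \<preceq> u) \<Longrightarrow> s \<preceq> u"
  shows "\<zero> \<preceq> s" "s \<otimes> s = a"
proof -
  show s0: "\<zero> \<preceq> s" using ub[of \<zero>] a le_refl by simp
  have "a \<preceq> s \<otimes> s"
  proof (rule ccontr)
    assume n: "\<not> a \<preceq> s \<otimes> s"
    define d where "d = a \<ominus> s \<otimes> s"
    have d: "d \<in> carrier R" "\<zero> \<preceq> d" "d \<noteq> \<zero>"
      unfolding d_def using a s n le_total[of a "s \<otimes> s"] le_iff_diff[of "s \<otimes> s" a] le_refl
      by (auto simp: minus_eq) (metis add.inv_closed l_neg m_closed minus_equality minus_minus)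
    have q: "\<one> \<oplus> (s \<oplus> s \<oplus> d) \<in> carrier R" "\<zero> \<preceq> \<one> \<oplus> (s \<oplus> s \<oplus> d)" "\<one> \<oplus> (s \<oplus> s \<oplus> d) \<noteq> \<zero>"
      using one_add_pos[of "s \<oplus> s \<oplus> d"] s s0 d nonneg_add by auto
    obtain i where i: "i \<in> carrier R" "\<zero> \<preceq> i" "i \<noteq> \<zero>" "(\<one> \<oplus> (s \<oplus> s \<oplus> d)) \<otimes> i = \<one>"
      using inverse_pos[OF q] by blast
    \<comment> \<open>The increment \<open>e = d / (1 + 2s + d)\<close> satisfies \<open>a - (s + e)\<^sup>2 = e (1 + e (2s + d))\<close>.\<close>
    define e where "e = d \<otimes> i"
    have e: "e \<in> carrier R" "\<zero> \<preceq> e" "e \<noteq> \<zero>"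
      unfolding e_def using d i nonneg_mult integral by auto
    have eq: "e \<otimes> (\<one> \<oplus> (s \<oplus> s \<oplus> d)) = d"
    proof -
      have "e \<otimes> (\<one> \<oplus> (s \<oplus> s \<oplus> d)) = d \<otimes> ((\<one> \<oplus> (s \<oplus> s \<oplus> d)) \<otimes> i)"
        unfolding e_def using d i s q by (simp only: m_assoc m_comm)
      then show ?thesis using i d by simp
    qed
    have "a \<ominus> (s \<oplus> e) \<otimes> (s \<oplus> e) = d \<ominus> e \<otimes> s \<ominus> e \<otimes> s \<ominus> e \<otimes> e"
      unfolding d_def using a s e by algebra
    also have "\<dots> = e \<otimes> (\<one> \<oplus> (s \<oplus> s \<oplus> d)) \<ominus> e \<otimes> s \<ominus> e \<otimes> s \<ominus> e \<otimes> e"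
      by (simp add: eq)
    also have "\<dots> = e \<otimes> (\<one> \<oplus> (d \<ominus> e))" using d s e by algebra
    also have "d \<ominus> e = e \<otimes> (\<one> \<oplus> (s \<oplus> s \<oplus> d)) \<ominus> e" by (simp add: eq)
    also have "\<dots> = e \<otimes> (s \<oplus> s \<oplus> d)" using d s e by algebra
    finally have *: "a \<ominus> (s \<oplus> e) \<otimes> (s \<oplus> e) = e \<otimes> (\<one> \<oplus> e \<otimes> (s \<oplus> s \<oplus> d))" .
    have "\<zero> \<preceq> e \<otimes> (\<one> \<oplus> e \<otimes> (s \<oplus> s \<oplus> d))"
      using d s s0 e nonneg_one by (intro nonneg_mult nonneg_add) auto
    then have "(s \<oplus> e) \<otimes> (s \<oplus> e) \<preceq> a" using * a s e le_iff_diff by simp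
    then have "s \<oplus> e \<preceq> s" using ub[of "s \<oplus> e"] s s0 e nonneg_add by simp
    then have "s \<oplus> e \<ominus> s \<preceq> s \<ominus> s" unfolding minus_eq using s e by (intro le_add) auto
    moreover have "s \<oplus> e \<ominus> s = e" "s \<ominus> s = \<zero>" using s e by algebra+
    ultimately have "e \<preceq> \<zero>" by simp
    then show False using e le_antisym by simp
  qed
  moreover have "s \<otimes> s \<preceq> a"
  proof (rule ccontr)
    assume n: "\<not> s \<otimes> s \<preceq> a"
    have s1: "s \<noteq> \<zero>" using n a by auto
    have ss: "s \<oplus> s \<in> carrier R" "\<zero> \<preceq> s \<oplus> s" "s \<oplus> s \<noteq> \<zero>"
    proof -
      show "s \<oplus> s \<in> carrier R" "\<zero> \<preceq> s \<oplus> s" using s s0 nonneg_add by auto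
      show "s \<oplus> s \<noteq> \<zero>"
        using le_add_nonneg[of s s] s s0 s1 le_antisym[of s \<zero>] by auto
    qed
    obtain i where i: "i \<in> carrier R" "\<zero> \<preceq> i" "i \<noteq> \<zero>" "(s \<oplus> s) \<otimes> i = \<one>"
      using inverse_pos[OF ss] by blast
    \<comment> \<open>One Newton step \<open>u = (s\<^sup>2 + a) / 2s\<close> from \<open>s\<close>.
      Its square exceeds \<open>a\<close> by the square of \<open>e = s - u\<close>.\<close>
    define u where "u = (s \<otimes> s \<oplus> a) \<otimes> i"
    define e where "e = (s \<otimes> s \<ominus> a) \<otimes> i"
    have c: "u \<in> carrier R" "e \<in> carrier R" unfolding u_def e_def using s a i by auto
    have u0: "\<zero> \<preceq> u"
      unfolding u_def using s s0 a i by (intro nonneg_mult nonneg_add) auto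
    have sue: "s = u \<oplus> e"
    proof -
      have "u \<oplus> e = s \<otimes> ((s \<oplus> s) \<otimes> i)" unfolding u_def e_def using s a(1) i(1) by algebra
      then show ?thesis using i s by simp
    qed
    have ue: "u \<otimes> u \<ominus> a = e \<otimes> e"
    proof -
      have "u \<otimes> u \<ominus> e \<otimes> e = a \<otimes> ((s \<oplus> s) \<otimes> i) \<otimes> ((s \<oplus> s) \<otimes> i)"
        unfolding u_def e_def using s a(1) i(1) by algebra
      then have "u \<otimes> u \<ominus> e \<otimes> e = a" using i a by simp
      moreover have "u \<otimes> u \<ominus> (u \<otimes> u \<ominus> e \<otimes> e) = e \<otimes> e" using c by algebra
      ultimately show ?thesis by simp
    qed
    then have au: "a \<preceq> u \<otimes> u" using le_iff_diff[of a "u \<otimes> u"] a c nonneg_sq by simp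
    have "s \<preceq> u"
    proof (rule least)
      fix r assume r: "r \<in> carrier R" "\<zero> \<preceq> r" "r \<otimes> r \<preceq> a"
      then have "r \<otimes> r \<preceq> u \<otimes> u" using au le_trans[of "r \<otimes> r" a "u \<otimes> u"] a c by simp
      then show "r \<preceq> u" using sq_le_imp_le r c u0 by simp
    qed (use c in simp)
    then have "\<zero> \<preceq> u \<ominus> s" using s c le_iff_diff by simp
    moreover have "u \<ominus> s = \<ominus> e" unfolding sue using c by algebra
    moreover have "\<ominus> e = (a \<ominus> s \<otimes> s) \<otimes> i" unfolding e_def using s a i by algebra
    ultimately have "\<zero> \<preceq> (s \<oplus> s) \<otimes> ((a \<ominus> s \<otimes> s) \<otimes> i)"
      using nonneg_mult[of "s \<oplus> s" "(a \<ominus> s \<otimes> s) \<otimes> i"] s a i ss by simp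
    also have "(s \<oplus> s) \<otimes> ((a \<ominus> s \<otimes> s) \<otimes> i) = (a \<ominus> s \<otimes> s) \<otimes> ((s \<oplus> s) \<otimes> i)"
      using s a(1) i(1) by algebra
    also have "\<dots> = a \<ominus> s \<otimes> s" using i s a by simp
    finally show False using n le_iff_diff[of "s \<otimes> s" a] s a by simp
  qed
  ultimately show "s \<otimes> s = a" using s a le_antisym by simp
qed

text \<open>
  The radius of the net in the compactness argument: if a value differs from a value of squared
  modulus at most \<open>e\<close> by less than \<open>e\<close>, then its squared modulus is less than \<open>1/t\<close>. The number
  \<open>e = 1 / (1 + 4t)\<close> works because \<open>e\<^sup>2 \<le> e\<close>.
\<close>

lemma small_radius:
  assumes t: "t \<in> carrier R" "\<zero> \<preceq> t"
  obtains e where "e \<in> carrier R" "\<zero> \<preceq> e" "e \<noteq> \<zero>"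
    "\<And>c d. c \<in> carrier R \<Longrightarrow> d \<in> carrier R \<Longrightarrow> c \<preceq> e \<otimes> e \<Longrightarrow> d \<preceq> e \<Longrightarrow>
       \<not> \<one> \<preceq> t \<otimes> ((\<one> \<oplus> \<one>) \<otimes> (c \<oplus> d))"
proof -
  define q where "q = (\<one> \<oplus> \<one>) \<otimes> (t \<oplus> t)"
  have q: "q \<in> carrier R" "\<zero> \<preceq> q"
    unfolding q_def using t nonneg_one by (auto intro!: nonneg_mult nonneg_add)
  obtain e where e: "e \<in> carrier R" "\<zero> \<preceq> e" "e \<noteq> \<zero>" "(\<one> \<oplus> q) \<otimes> e = \<one>"
    using inverse_pos[of "\<one> \<oplus> q"] one_add_pos[OF q] q by auto
  have eq1: "e \<oplus> q \<otimes> e = \<one>" using e(4) e(1) q by (simp add: l_distr)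
  have "e \<preceq> \<one>" using le_add_nonneg[of e "q \<otimes> e"] eq1 e q nonneg_mult by simp
  then have ee: "e \<otimes> e \<preceq> e" using mult_mono_left[of e \<one> e] e by simp
  show ?thesis
  proof (rule that[OF e(1-3)], rule notI)
    fix c d assume c: "c \<in> carrier R" "d \<in> carrier R" "c \<preceq> e \<otimes> e" "d \<preceq> e"
      and one: "\<one> \<preceq> t \<otimes> ((\<one> \<oplus> \<one>) \<otimes> (c \<oplus> d))"
    have "c \<preceq> e" using c ee le_trans[of c "e \<otimes> e" e] e by simp
    then have "c \<oplus> d \<preceq> e \<oplus> e" using c e add_mono by simp
    then have "t \<otimes> ((\<one> \<oplus> \<one>) \<otimes> (c \<oplus> d)) \<preceq> t \<otimes> ((\<one> \<oplus> \<one>) \<otimes> (e \<oplus> e))"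
      using c e t nonneg_one nonneg_add by (intro mult_mono_left) auto
    moreover have "t \<otimes> ((\<one> \<oplus> \<one>) \<otimes> (e \<oplus> e)) = q \<otimes> e" unfolding q_def using t e by algebra
    ultimately have "\<one> \<preceq> q \<otimes> e"
      using one le_trans[of \<one> "t \<otimes> ((\<one> \<oplus> \<one>) \<otimes> (c \<oplus> d))" "q \<otimes> e"] c t e q by simp
    then have "e \<oplus> q \<otimes> e \<preceq> q \<otimes> e" using eq1 by simp
    then have "\<zero> \<preceq> q \<otimes> e \<ominus> (e \<oplus> q \<otimes> e)" using le_iff_diff e q by simp
    moreover have "q \<otimes> e \<ominus> (e \<oplus> q \<otimes> e) = \<ominus> e" using e(1) q(1) by algebra
    moreover have "\<ominus> (\<ominus> e) = e" "\<zero> \<ominus> e = \<ominus> e" using e by algebra+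
    ultimately have "e \<preceq> \<zero>" using le_iff_diff[of e \<zero>] e by simp
    then show False using e le_antisym by simp
  qed
qed

end

section \<open>Definability with parameters\<close>

primrec rename_fm :: "(nat \<Rightarrow> nat) \<Rightarrow> fm \<Rightarrow> fm" where
  "rename_fm f (Mem i j) = Mem (f i) (f j)"
| "rename_fm f (Eq i j) = Eq (f i) (f j)"
| "rename_fm f (Neg p) = Neg (rename_fm f p)"
| "rename_fm f (Conj p q) = Conj (rename_fm f p) (rename_fm f q)"
| "rename_fm f (All i p) = All (f i) (rename_fm f p)"

lemma sat_rename_fm: "inj f \<Longrightarrow> sat mem s (rename_fm f p) \<longleftrightarrow> sat mem (s \<circ> f) p"
proof (induction p arbitrary: s)
  case (All i p)
  have "(s(f i := a)) \<circ> f = (s \<circ> f)(i := a)" for a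
    using All.prems by (auto simp: inj_def fun_eq_iff)
  then show ?case by (simp only: rename_fm.simps sat.simps All.IH[OF All.prems])
qed auto

text \<open>
  Formulas see a single assignment of values to variables. Its even positions hold the variables
  proper, the odd ones the parameters, so both are available in unlimited supply.
\<close>

definition interleave :: "(nat \<Rightarrow> 'a) \<Rightarrow> (nat \<Rightarrow> 'a) \<Rightarrow> nat \<Rightarrow> 'a" where
  "interleave e r i = (if even i then e (i div 2) else r (i div 2))"

context membership
begin

text \<open>
  A quantifier binds position \<open>0\<close> and shifts the other variables by one, in the manner of de Bruijn. In
  the rules below \<open>\<lambda>i. e (Suc i)\<close> is therefore the assignment outside of the quantifier and \<open>e 0\<close> is
  the bound variable; after beta reduction the premise of such a rule has again the form to which
  the rules apply.
\<close>

definition definable :: "((nat \<Rightarrow> 'a) \<Rightarrow> bool) \<Rightarrow> bool" where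
  "definable P \<longleftrightarrow> (\<exists>p r. \<forall>e. P e \<longleftrightarrow> sat mem (interleave e r) p)"

definition definable_term :: "((nat \<Rightarrow> 'a) \<Rightarrow> 'a) \<Rightarrow> bool" where
  "definable_term t \<longleftrightarrow> definable (\<lambda>e. e 0 = t (\<lambda>i. e (Suc i)))"

lemma definable_rename:
  assumes "inj f" "definable P"
  shows "definable (\<lambda>e. P (\<lambda>i. e (f i)))"
proof -
  obtain p r where p: "\<And>e. P e \<longleftrightarrow> sat mem (interleave e r) p"
    using assms(2) unfolding definable_def by blast
  define g where "g j = (if even j then 2 * f (j div 2) else j)" for j
  have "inj g"
    unfolding inj_def g_def using injD[OF assms(1)]
    by (metis dvd_triv_left even_two_times_div_two mult_cancel_left zero_neq_numeral)
  moreover have "interleave e r \<circ> g = interleave (\<lambda>i. e (f i)) r" for e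
    by (auto simp: interleave_def g_def fun_eq_iff)
  ultimately have "P (\<lambda>i. e (f i)) \<longleftrightarrow> sat mem (interleave e r) (rename_fm g p)" for e
    by (simp add: sat_rename_fm p)
  then show ?thesis unfolding definable_def by (intro exI allI)
qed

lemma definable_neg: "definable P \<Longrightarrow> definable (\<lambda>e. \<not> P e)"
  unfolding definable_def by (metis sat.simps(3))

text \<open>
  The parameters of both formulas are merged into one sequence, and both formulas are renamed
  accordingly.
\<close>

lemma definable_conj:
  assumes "definable P" "definable Q"
  shows "definable (\<lambda>e. P e \<and> Q e)"
proof -
  obtain p r where p: "\<And>e. P e \<longleftrightarrow> sat mem (interleave e r) p"
    using assms(1) unfolding definable_def by blast
  obtain q s where q: "\<And>e. Q e \<longleftrightarrow> sat mem (interleave e s) q"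
    using assms(2) unfolding definable_def by blast
  define f where "f i = (if even i then i else 4 * (i div 2) + 1)" for i :: nat
  define g where "g i = (if even i then i else 4 * (i div 2) + 3)" for i :: nat
  have inj: "inj f" "inj g"
    unfolding inj_def f_def g_def by (auto split: if_splits elim!: oddE evenE; presburger)+
  have "interleave e (interleave r s) \<circ> f = interleave e r" "interleave e (interleave r s) \<circ> g = interleave e s" for e
  proof -
    have "(4 * k + 1) div 2 = 2 * k" "(4 * k + 3) div 2 = 2 * k + 1" for k :: nat
      by presburger+
    then show "interleave e (interleave r s) \<circ> f = interleave e r" "interleave e (interleave r s) \<circ> g = interleave e s"
      by (auto simp: interleave_def f_def g_def fun_eq_iff elim!: oddE)
  qed
  then have "P e \<and> Q e \<longleftrightarrow> sat mem (interleave e (interleave r s)) (Conj (rename_fm f p) (rename_fm g q))" for e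
    by (simp add: sat_rename_fm inj p q)
  then show ?thesis unfolding definable_def by (intro exI allI)
qed

text \<open>
  The parameter sequence is shifted to free the variable \<open>1\<close>, its first position, which then serves as
  the bound variable of the formula.
\<close>

lemma definable_all:
  assumes "definable (\<lambda>e. P (\<lambda>i. e (Suc i)) (e 0))"
  shows "definable (\<lambda>e. \<forall>a. P e a)"
proof -
  obtain p r where p: "\<And>e. P (\<lambda>i. e (Suc i)) (e 0) \<longleftrightarrow> sat mem (interleave e r) p"
    using assms unfolding definable_def by blast
  define f where "f i = (if i = 0 then 1 else if even i then i - 2 else i + 2)" for i :: nat
  have inj: "inj f"
    unfolding inj_def f_def by (auto split: if_splits elim!: oddE evenE; presburger)
  have eq: "((interleave e (case_nat a r))(1 := a)) \<circ> f = interleave (case_nat a e) r" for e a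
  proof
    fix j show "(((interleave e (case_nat a r))(1 := a)) \<circ> f) j = interleave (case_nat a e) r j"
    proof (cases "j = 0")
      case False
      show ?thesis
      proof (cases "even j")
        case True
        then obtain k where "j = 2 * Suc k" using False by (metis evenE mult_0_right not0_implies_Suc)
        then show ?thesis by (simp add: interleave_def f_def)
      next
        case odd: False
        then obtain k where "j = 2 * k + 1" by (metis oddE)
        then show ?thesis by (simp add: interleave_def f_def)
      qed
    qed (simp add: interleave_def f_def)
  qed
  have eq': "(interleave e (case_nat c r))(1 := a) = (interleave e (case_nat a r))(1 := a)" for e c a
  proof
    fix j show "((interleave e (case_nat c r))(1 := a)) j = ((interleave e (case_nat a r))(1 := a)) j"
      by (cases "j = 1") (auto simp: interleave_def elim!: oddE split: nat.splits)
  qed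
  have "\<forall>e. (\<forall>a. P e a) \<longleftrightarrow> sat mem (interleave e (case_nat undefined r)) (All 1 (rename_fm f p))"
  proof
    fix e
    have "P e a \<longleftrightarrow> sat mem ((interleave e (case_nat undefined r))(1 := a)) (rename_fm f p)" for a
    proof -
      have "((interleave e (case_nat undefined r))(1 := a)) \<circ> f = interleave (case_nat a e) r"
        unfolding eq'[of e undefined a] by (rule eq)
      then show ?thesis using p[of "case_nat a e"] 
        by (simp only: sat_rename_fm[OF inj]) simp
    qed
    then show "(\<forall>a. P e a) \<longleftrightarrow> sat mem (interleave e (case_nat undefined r)) (All 1 (rename_fm f p))"
      by simp
  qed
  then show ?thesis unfolding definable_def by (intro exI)
qed

lemma definable_vars: "definable (\<lambda>e. mem (e i) (e j))" "definable (\<lambda>e. e i = e j)"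
  unfolding definable_def
  by (rule exI[of _ "Mem (2 * i) (2 * j)"], simp add: interleave_def)
     (rule exI[of _ "Eq (2 * i) (2 * j)"], simp add: interleave_def)

lemma definable_term_const: "definable_term (\<lambda>e. c)"
proof -
  have "\<forall>e. e 0 = c \<longleftrightarrow> sat mem (interleave e (\<lambda>_. c)) (Eq 0 1)"
    by (simp add: interleave_def)
  then show ?thesis unfolding definable_term_def definable_def by (intro exI)
qed

lemma definable_term_var: "definable_term (\<lambda>e. e i)"
  unfolding definable_term_def by (rule definable_vars)

lemma definable_disj:
  assumes "definable P" "definable Q"
  shows "definable (\<lambda>e. P e \<or> Q e)"
proof -
  have "definable (\<lambda>e. \<not> (\<not> P e \<and> \<not> Q e))" by (intro definable_neg definable_conj assms)
  then show ?thesis by simp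
qed

lemma definable_imp:
  assumes "definable P" "definable Q"
  shows "definable (\<lambda>e. P e \<longrightarrow> Q e)"
proof -
  have "definable (\<lambda>e. \<not> (P e \<and> \<not> Q e))" by (intro definable_neg definable_conj assms)
  then show ?thesis by simp
qed

lemma definable_iff:
  assumes "definable P" "definable Q"
  shows "definable (\<lambda>e. P e \<longleftrightarrow> Q e)"
  unfolding iff_conv_conj_imp by (intro definable_conj definable_imp assms)

lemma definable_ex:
  assumes "definable (\<lambda>e. P (\<lambda>i. e (Suc i)) (e 0))"
  shows "definable (\<lambda>e. \<exists>a. P e a)"
proof -
  have "definable (\<lambda>e. \<not> (\<forall>a. \<not> P e a))"
    by (intro definable_neg definable_all) (rule assms)
  then show ?thesis by simp
qed

text \<open>
  Terms are substituted by means of their graphs: \<open>K t u v\<close> holds if and only if \<open>K a b c\<close> holds for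
  some \<open>a = t\<close>, \<open>b = u\<close> and \<open>c = v\<close>. Hence a new notion has to be shown definable for variables only.
\<close>

lemma definable_subst3:
  assumes K: "definable (\<lambda>e. K (e 0) (e (Suc 0)) (e (Suc (Suc 0))))"
    and t: "definable_term t" "definable_term u" "definable_term v"
  shows "definable (\<lambda>e. K (t e) (u e) (v e))"
proof -
  have i: "inj (case_nat k (\<lambda>i. Suc (Suc (Suc i))))" if "k < 3" for k :: nat
    using that by (auto simp: inj_def split: nat.splits)
  have *: "definable (\<lambda>e. e k = w (\<lambda>i. e (Suc (Suc (Suc i)))))" if "k < 3" "definable_term w" for k w
    using definable_rename[OF i[OF that(1)] that(2)[unfolded definable_term_def]] by simp
  have "definable (\<lambda>e. \<exists>c b a. K a b c \<and> a = t e \<and> b = u e \<and> c = v e)"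
    by (intro definable_ex definable_conj K *[of 0] *[of "Suc 0"] *[of "Suc (Suc 0)"] t; simp)
  then show ?thesis by simp
qed

lemma definable_subst2:
  assumes "definable (\<lambda>e. K (e 0) (e (Suc 0)))" "definable_term t" "definable_term u"
  shows "definable (\<lambda>e. K (t e) (u e))"
  using definable_subst3[of "\<lambda>a b c. K a b" t u "\<lambda>e. e 0"] assms definable_term_var by simp

lemma definable_subst1:
  assumes "definable (\<lambda>e. K (e 0))" "definable_term t"
  shows "definable (\<lambda>e. K (t e))"
  using definable_subst3[of "\<lambda>a b c. K a" t "\<lambda>e. e 0" "\<lambda>e. e 0"] assms definable_term_var by simp

lemma definable_term_lift: "definable_term t \<Longrightarrow> definable_term (\<lambda>e. t (\<lambda>i. e (Suc i)))"
  unfolding definable_term_def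
  using definable_rename[of "case_nat 0 (\<lambda>i. Suc (Suc i))" "\<lambda>e. e 0 = t (\<lambda>i. e (Suc i))"]
  by (simp add: inj_def split: nat.splits)

lemma definable_term_subst2:
  assumes "definable_term (\<lambda>e. f (e 0) (e (Suc 0)))" "definable_term t" "definable_term u"
  shows "definable_term (\<lambda>e. f (t e) (u e))"
  unfolding definable_term_def
  using definable_subst3[of "\<lambda>y a b. y = f a b" "\<lambda>e. e 0"] assms definable_term_lift definable_term_var
  by (simp add: definable_term_def)

lemma definable_term_subst1:
  assumes "definable_term (\<lambda>e. f (e 0))" "definable_term t"
  shows "definable_term (\<lambda>e. f (t e))"
  using definable_term_subst2[of "\<lambda>a b. f a" t "\<lambda>e. e 0"] assms definable_term_var by simp

lemma definable_mem: "definable_term t \<Longrightarrow> definable_term u \<Longrightarrow> definable (\<lambda>e. mem (t e) (u e))"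
  by (rule definable_subst2[where K = mem]) (rule definable_vars)

lemma definable_elts: "definable_term t \<Longrightarrow> definable_term u \<Longrightarrow> definable (\<lambda>e. t e \<in> elts (u e))"
  using definable_mem by (simp add: elts_def)

lemma definable_eq: "definable_term t \<Longrightarrow> definable_term u \<Longrightarrow> definable (\<lambda>e. t e = u e)"
  by (rule definable_subst2[where K = "(=)"]) (rule definable_vars)

lemma definable_True: "definable (\<lambda>e. True)"
  using definable_vars(2)[of 0 0] by simp

lemma definable_elts_lift:
  assumes "definable_term t"
  shows "definable (\<lambda>e. e 0 \<in> elts (t (\<lambda>i. e (Suc i))))"
  by (intro definable_elts definable_term_var definable_term_lift assms)

lemma definable_ball:
  "definable_term t \<Longrightarrow> definable (\<lambda>e. P (\<lambda>i. e (Suc i)) (e 0)) \<Longrightarrow> definable (\<lambda>e. \<forall>a\<in>elts (t e). P e a)"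
  unfolding Ball_def by (intro definable_all definable_imp definable_elts_lift)

lemma definable_bex:
  "definable_term t \<Longrightarrow> definable (\<lambda>e. P (\<lambda>i. e (Suc i)) (e 0)) \<Longrightarrow> definable (\<lambda>e. \<exists>a\<in>elts (t e). P e a)"
  unfolding Bex_def by (intro definable_ex definable_conj definable_elts_lift)

lemma definable_subset:
  "definable_term t \<Longrightarrow> definable_term u \<Longrightarrow> definable (\<lambda>e. elts (t e) \<subseteq> elts (u e))"
  unfolding subset_iff by (intro definable_all definable_imp definable_elts_lift)

lemmas definable_logic = definable_neg definable_conj definable_disj definable_imp definable_iff
  definable_all definable_ex definable_ball definable_bex definable_subset
  definable_mem definable_elts definable_eq definable_True definable_term_var definable_term_const

end

section \<open>Sets, functions and natural numbers of the model\<close>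

context ZF_model
begin

lemma definable_separation:
  assumes "definable (\<lambda>e. P (e 0))"
  shows "\<exists>c. elts c = {x \<in> elts a. P x}"
proof -
  obtain p r where p: "\<And>e. P (e 0) \<longleftrightarrow> sat mem (interleave e r) p"
    using assms unfolding definable_def by blast
  have "(interleave (\<lambda>_. a) r)(0 := x) = interleave ((\<lambda>_. a)(0 := x)) r" for x
    by (auto simp: interleave_def fun_eq_iff elim!: evenE)
  then have "P x \<longleftrightarrow> sat mem ((interleave (\<lambda>_. a) r)(0 := x)) p" for x
    using p[of "(\<lambda>_. a)(0 := x)"] by simp
  then show ?thesis using separation[of a "interleave (\<lambda>_. a) r" p] by simp
qed

text \<open>
  By extensionality the graph of an operation is definable once membership in its values is. So all
  operations used in terms are made total and are described through their elements.
\<close>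

lemma definable_term_ext:
  assumes t: "\<And>e z. z \<in> elts (t e) \<longleftrightarrow> Q e z" and Q: "definable (\<lambda>e. Q (\<lambda>i. e (Suc i)) (e 0))"
  shows "definable_term t"
proof -
  have i: "inj (case_nat 0 (\<lambda>i. Suc (Suc i)))"
    by (auto simp: inj_def split: nat.splits)
  have "e 0 = t (\<lambda>i. e (Suc i)) \<longleftrightarrow> (\<forall>z. z \<in> elts (e 0) \<longleftrightarrow> Q (\<lambda>i. e (Suc i)) z)" for e
    using extensionality[of "e 0" "t (\<lambda>i. e (Suc i))"] t by auto
  moreover have "definable (\<lambda>e. \<forall>z. z \<in> elts (e 0) \<longleftrightarrow> Q (\<lambda>i. e (Suc i)) z)"
    by (intro definable_logic) (use definable_rename[OF i Q] in simp)
  ultimately show ?thesis unfolding definable_term_def by simp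
qed

lemma elts_the_set: "elts c = A \<Longrightarrow> elts (the_set A) = A"
  unfolding the_set_def by (rule theI2[of _ c]) (auto intro: extensionality)

lemma the_set_elts [simp]: "the_set (elts c) = c"
  by (rule extensionality) (rule elts_the_set[OF refl])

lemma elts_Collect:
  assumes "definable (\<lambda>e. P (e 0))" "\<And>x. P x \<Longrightarrow> x \<in> elts a"
  shows "elts (the_set {x. P x}) = {x. P x}"
proof -
  obtain c where "elts c = {x \<in> elts a. P x}" using definable_separation[OF assms(1)] by blast
  then have "elts c = {x. P x}" using assms(2) by auto
  then show ?thesis by (rule elts_the_set)
qed

lemma extI: "(\<And>x. x \<in> elts a \<longleftrightarrow> x \<in> elts b) \<Longrightarrow> a = b"
  by (rule extensionality) auto

lemma elts_upair [simp]: "elts (the_set {a, b}) = {a, b}"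
  using pairing[of a b] by (elim exE) (rule elts_the_set)

lemma elts_sing [simp]: "elts (the_set {a}) = {a}"
  using elts_upair[of a a] by simp

lemma opair_eq_iff [simp]: "opair a b = opair c d \<longleftrightarrow> a = c \<and> b = d"
proof
  assume "opair a b = opair c d"
  then have "{the_set {a}, the_set {a, b}} = {the_set {c}, the_set {c, d}}"
    unfolding opair_def by (metis elts_upair)
  then have "{{a}, {a, b}} = {{c}, {c, d}}"
    by (metis (no_types, lifting) elts_sing elts_upair image_empty image_insert)
  then show "a = c \<and> b = d" by (auto simp: doubleton_eq_iff)
qed simp

definition big_union :: "'a \<Rightarrow> 'a" where
  "big_union a = the_set (\<Union>b\<in>elts a. elts b)"

definition power_set :: "'a \<Rightarrow> 'a" where
  "power_set a = the_set {b. elts b \<subseteq> elts a}"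

definition pair_union :: "'a \<Rightarrow> 'a \<Rightarrow> 'a" where
  "pair_union a b = big_union (the_set {a, b})"

lemma elts_big_union [simp]: "elts (big_union a) = (\<Union>b\<in>elts a. elts b)"
  unfolding big_union_def using union[of a] by (elim exE) (rule elts_the_set)

lemma elts_power_set [simp]: "elts (power_set a) = {b. elts b \<subseteq> elts a}"
  unfolding power_set_def using powerset[of a] by (elim exE) (rule elts_the_set)

lemma elts_pair_union [simp]: "elts (pair_union a b) = elts a \<union> elts b"
  unfolding pair_union_def by simp

lemma elts_empty [simp]: "elts empty = {}"
proof -
  obtain c where "elts c = {}" using infinity by blast
  then show ?thesis unfolding empty_def by (rule elts_the_set)
qed

lemma elts_empty_iff: "elts a = {} \<longleftrightarrow> a = empty"
  by (metis elts_empty extensionality)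

lemma elts_adjoin [simp]: "elts (adjoin x a) = insert x (elts a)"
proof -
  have "elts (pair_union (the_set {x}) a) = insert x (elts a)" by simp
  then show ?thesis unfolding adjoin_def by (rule elts_the_set)
qed

lemma definable_term_upair:
  "definable_term t \<Longrightarrow> definable_term u \<Longrightarrow> definable_term (\<lambda>e. the_set {t e, u e})"
  by (rule definable_term_subst2[where f = "\<lambda>a b. the_set {a, b}"],
      rule definable_term_ext[where Q = "\<lambda>e z. z = e 0 \<or> z = e (Suc 0)"])
     (simp, intro definable_logic, assumption+)

lemma definable_term_opair:
  "definable_term t \<Longrightarrow> definable_term u \<Longrightarrow> definable_term (\<lambda>e. opair (t e) (u e))"
  unfolding opair_def using definable_term_upair[of t t] by (intro definable_term_upair) simp_all

lemma definable_term_adjoin: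
  "definable_term t \<Longrightarrow> definable_term u \<Longrightarrow> definable_term (\<lambda>e. adjoin (t e) (u e))"
  by (rule definable_term_subst2[where f = "adjoin"],
      rule definable_term_ext[where Q = "\<lambda>e z. z = e 0 \<or> z \<in> elts (e (Suc 0))"])
     (simp, intro definable_logic, assumption+)

lemma definable_term_pair_union:
  "definable_term t \<Longrightarrow> definable_term u \<Longrightarrow> definable_term (\<lambda>e. pair_union (t e) (u e))"
  by (rule definable_term_subst2[where f = "pair_union"],
      rule definable_term_ext[where Q = "\<lambda>e z. z \<in> elts (e 0) \<or> z \<in> elts (e (Suc 0))"])
     (simp, intro definable_logic, assumption+)

lemma definable_term_power_set: "definable_term t \<Longrightarrow> definable_term (\<lambda>e. power_set (t e))"
  by (rule definable_term_subst1[where f = "power_set"],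
      rule definable_term_ext[where Q = "\<lambda>e z. elts z \<subseteq> elts (e 0)"])
     (simp, intro definable_logic, assumption+)

lemmas definable_basic = definable_logic definable_term_opair definable_term_adjoin
  definable_term_pair_union definable_term_power_set

lemma elts_cart: "elts (cart A B) = {opair a b |a b. a \<in> elts A \<and> b \<in> elts B}"
  unfolding cart_def
proof (rule elts_Collect)
  show "definable (\<lambda>e. \<exists>a b. e 0 = opair a b \<and> a \<in> elts A \<and> b \<in> elts B)"
    by (intro definable_basic)
  fix x assume "\<exists>a b. x = opair a b \<and> a \<in> elts A \<and> b \<in> elts B"
  then show "x \<in> elts (power_set (power_set (pair_union A B)))" by (auto simp: opair_def)
qed

lemma opair_in_cart [simp]: "opair a b \<in> elts (cart A B) \<longleftrightarrow> a \<in> elts A \<and> b \<in> elts B"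
  by (auto simp: elts_cart)

lemma in_cartE:
  assumes "x \<in> elts (cart A B)"
  obtains a b where "x = opair a b" "a \<in> elts A" "b \<in> elts B"
  using assms by (auto simp: elts_cart)

lemma definable_term_cart:
  "definable_term t \<Longrightarrow> definable_term u \<Longrightarrow> definable_term (\<lambda>e. cart (t e) (u e))"
  by (rule definable_term_subst2[where f = "cart"],
      rule definable_term_ext[where Q = "\<lambda>e z. \<exists>a b. z = opair a b \<and> a \<in> elts (e 0) \<and> b \<in> elts (e (Suc 0))"])
     (simp add: elts_cart, intro definable_basic, assumption+)

text \<open>
  Definite descriptions are unspecified outside of their intended domain, so \<open>app\<close>, \<open>re\<close> and \<open>im\<close> are not
  definable as they stand. The following variants are total: the union of all values that are
  related to the argument is the value itself if that is unique, and is a set in any case. They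
  agree with the original operations wherever those are meaningful (\<open>app_eq_ap\<close>).
\<close>

definition ap :: "'a \<Rightarrow> 'a \<Rightarrow> 'a" where
  "ap f a = the_set {z. \<exists>b. opair a b \<in> elts f \<and> z \<in> elts b}"

definition pfst :: "'a \<Rightarrow> 'a" where
  "pfst c = the_set {z. \<exists>a b. c = opair a b \<and> z \<in> elts a}"

definition psnd :: "'a \<Rightarrow> 'a" where
  "psnd c = the_set {z. \<exists>a b. c = opair a b \<and> z \<in> elts b}"

lemma opair_big_union: "a \<in> elts (big_union (opair a b))" "b \<in> elts (big_union (opair a b))"
  by (auto simp: opair_def)

lemma elts_ap: "elts (ap f a) = {z. \<exists>b. opair a b \<in> elts f \<and> z \<in> elts b}"
  unfolding ap_def
proof (rule elts_Collect)
  show "definable (\<lambda>e. \<exists>b. opair a b \<in> elts f \<and> e 0 \<in> elts b)" by (intro definable_basic)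
  fix z assume "\<exists>b. opair a b \<in> elts f \<and> z \<in> elts b"
  then obtain b where "opair a b \<in> elts f" "z \<in> elts b" by blast
  then show "z \<in> elts (big_union (big_union (big_union f)))" using opair_big_union(2)[of b a] by (auto 0 3)
qed

lemma pfst_opair [simp]: "pfst (opair a b) = a"
  unfolding pfst_def by (simp add: ex_simps Collect_mem_eq)

lemma psnd_opair [simp]: "psnd (opair a b) = b"
  unfolding psnd_def by (simp add: ex_simps Collect_mem_eq)

lemma elts_pfst: "elts (pfst c) = {z. \<exists>a b. c = opair a b \<and> z \<in> elts a}"
  unfolding pfst_def
proof (rule elts_Collect)
  show "definable (\<lambda>e. \<exists>a b. c = opair a b \<and> e 0 \<in> elts a)" by (intro definable_basic)
  fix z assume "\<exists>a b. c = opair a b \<and> z \<in> elts a"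
  then obtain a b where "c = opair a b" "z \<in> elts a" by blast
  then show "z \<in> elts (big_union (big_union c))" using opair_big_union(1)[of a b] unfolding elts_big_union[of "big_union c"] by blast
qed

lemma elts_psnd: "elts (psnd c) = {z. \<exists>a b. c = opair a b \<and> z \<in> elts b}"
  unfolding psnd_def
proof (rule elts_Collect)
  show "definable (\<lambda>e. \<exists>a b. c = opair a b \<and> e 0 \<in> elts b)" by (intro definable_basic)
  fix z assume "\<exists>a b. c = opair a b \<and> z \<in> elts b"
  then obtain a b where "c = opair a b" "z \<in> elts b" by blast
  then show "z \<in> elts (big_union (big_union c))" using opair_big_union(2)[of b a] unfolding elts_big_union[of "big_union c"] by blast
qed

lemma re_opair [simp]: "re (opair a b) = a" and im_opair [simp]: "im (opair a b) = b"
  unfolding re_def im_def by auto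

lemma definable_term_ap:
  "definable_term t \<Longrightarrow> definable_term u \<Longrightarrow> definable_term (\<lambda>e. ap (t e) (u e))"
  by (rule definable_term_subst2[where f = "ap"],
      rule definable_term_ext[where Q = "\<lambda>e z. \<exists>b. opair (e (Suc 0)) b \<in> elts (e 0) \<and> z \<in> elts b"])
     (simp add: elts_ap, intro definable_basic, assumption+)

lemma definable_term_pfst: "definable_term t \<Longrightarrow> definable_term (\<lambda>e. pfst (t e))"
  by (rule definable_term_subst1[where f = "pfst"],
      rule definable_term_ext[where Q = "\<lambda>e z. \<exists>a b. e 0 = opair a b \<and> z \<in> elts a"])
     (simp add: elts_pfst, intro definable_basic, assumption+)

lemma definable_term_psnd: "definable_term t \<Longrightarrow> definable_term (\<lambda>e. psnd (t e))"
  by (rule definable_term_subst1[where f = "psnd"],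
      rule definable_term_ext[where Q = "\<lambda>e z. \<exists>a b. e 0 = opair a b \<and> z \<in> elts b"])
     (simp add: elts_psnd, intro definable_basic, assumption+)

lemma func_pair_unique:
  "func f A B \<Longrightarrow> opair a b \<in> elts f \<Longrightarrow> opair a c \<in> elts f \<Longrightarrow> b = c"
  unfolding func_def by (metis in_mono opair_in_cart)

lemma func_dom: "func f A B \<Longrightarrow> opair a b \<in> elts f \<Longrightarrow> a \<in> elts A"
  unfolding func_def by (metis in_mono opair_in_cart)

lemma ap_eqI:
  assumes "func f A B" "opair a b \<in> elts f"
  shows "ap f a = b"
proof -
  have "elts (ap f a) = elts b"
    using assms func_pair_unique[OF assms(1)] by (auto simp: elts_ap)
  then show ?thesis by (rule extensionality)
qed

lemma func_pair: "func f A B \<Longrightarrow> a \<in> elts A \<Longrightarrow> opair a (ap f a) \<in> elts f"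
  using ap_eqI unfolding func_def by metis

lemma func_ran: "func f A B \<Longrightarrow> opair a b \<in> elts f \<Longrightarrow> b \<in> elts B"
  unfolding func_def by (metis in_mono opair_in_cart)

lemma ap_type: "func f A B \<Longrightarrow> a \<in> elts A \<Longrightarrow> ap f a \<in> elts B"
  by (rule func_ran[OF _ func_pair])

lemma app_eq_ap:
  assumes "func f A B" "a \<in> elts A"
  shows "app f a = ap f a"
  unfolding app_def
  by (rule the_equality) (use func_pair[OF assms] func_pair_unique[OF assms(1)] in auto)

lemma ap_unique: "func f A B \<Longrightarrow> opair a b \<in> elts f \<longleftrightarrow> a \<in> elts A \<and> ap f a = b"
  using func_pair[of f A B a] ap_eqI[of f A B a b] func_dom[of f A B a b] by auto

lemma func_elts:
  assumes f: "func f A B"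
  shows "elts f = {opair a (ap f a) |a. a \<in> elts A}"
proof (rule Set.set_eqI, rule iffI)
  fix x assume "x \<in> elts f"
  moreover from this obtain a b where "x = opair a b"
    using f unfolding func_def by (meson in_cartE subsetD)
  ultimately show "x \<in> {opair a (ap f a) |a. a \<in> elts A}" using ap_unique[OF f] by auto
qed (use func_pair[OF f] in auto)

lemma func_ext:
  "func f A B \<Longrightarrow> func g A C \<Longrightarrow> (\<And>a. a \<in> elts A \<Longrightarrow> ap f a = ap g a) \<Longrightarrow> f = g"
  by (rule extensionality) (simp add: func_elts, metis)

lemma func_cod:
  assumes f: "func f A B" and C: "\<And>a. a \<in> elts A \<Longrightarrow> ap f a \<in> elts C"
  shows "func f A C"
proof -
  have "elts f \<subseteq> elts (cart A C)" using func_elts[OF f] C by auto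
  then show ?thesis using f unfolding func_def by simp
qed

lemma func_exists:
  assumes "definable (\<lambda>e. Q (e 0) (e (Suc 0)))"
    and ex: "\<And>a. a \<in> elts A \<Longrightarrow> \<exists>!b. b \<in> elts B \<and> Q a b"
  obtains f where "func f A B" "\<And>a. a \<in> elts A \<Longrightarrow> Q a (ap f a)"
proof -
  have "definable (\<lambda>e. \<exists>a b. e 0 = opair a b \<and> Q a b)"
    by (intro definable_basic definable_subst2[OF assms(1)])
  then obtain f where f: "elts f = {p \<in> elts (cart A B). \<exists>a b. p = opair a b \<and> Q a b}"
    using definable_separation[of "\<lambda>p. \<exists>a b. p = opair a b \<and> Q a b"] by blast
  have fn: "func f A B"
    unfolding func_def
  proof (intro conjI ballI)
    fix a assume "a \<in> elts A"
    then show "\<exists>!b. opair a b \<in> elts f" using ex[of a] by (simp add: f)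
  qed (auto simp: f)
  have "Q a (ap f a)" if "a \<in> elts A" for a
    using func_pair[OF fn that] by (simp add: f)
  then show ?thesis using that[OF fn] by blast
qed

lemma func_exists_term:
  assumes "definable_term (\<lambda>e. t (e 0))" "\<And>a. a \<in> elts A \<Longrightarrow> t a \<in> elts B"
  obtains f where "func f A B" "\<And>a. a \<in> elts A \<Longrightarrow> ap f a = t a"
proof -
  have "definable (\<lambda>e. e (Suc 0) = t (e 0))" by (intro definable_basic definable_term_subst1[OF assms(1)])
  then show ?thesis
    by (rule func_exists[where A = A and B = B]) (use assms(2) that in auto)
qed

lemma lam_eq:
  assumes "func f A B" "\<And>a. a \<in> elts A \<Longrightarrow> ap f a = t a"
  shows "lam A t = f"
proof -
  have "{opair a (t a) |a. a \<in> elts A} = elts f"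
    using func_elts[OF assms(1)] assms(2) by auto
  then show ?thesis unfolding lam_def by simp
qed

lemma elts_image:
  assumes f: "func f A B" and sub: "elts A' \<subseteq> elts A"
  shows "elts (image f A') = {ap f a |a. a \<in> elts A'}"
proof -
  have "{app f a |a. a \<in> elts A'} = {ap f a |a. a \<in> elts A'}"
    using app_eq_ap[OF f subsetD[OF sub]] by force
  moreover have "elts (the_set {ap f a |a. a \<in> elts A'}) = {ap f a |a. a \<in> elts A'}"
  proof (rule elts_Collect)
    show "definable (\<lambda>e. \<exists>a. e 0 = ap f a \<and> a \<in> elts A')" by (intro definable_basic definable_term_ap)
  qed (use ap_type[OF f] sub in auto)
  ultimately show ?thesis unfolding image_def by simp
qed

lemma definable_func:
  "definable_term t \<Longrightarrow> definable_term u \<Longrightarrow> definable_term v \<Longrightarrow> definable (\<lambda>e. func (t e) (u e) (v e))"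
proof (rule definable_subst3[where K = func])
  show "definable (\<lambda>e. func (e 0) (e (Suc 0)) (e (Suc (Suc 0))))"
    unfolding func_def Ex1_def by (intro definable_basic definable_term_cart)
qed

lemma injection_ap: "injection f A B \<longleftrightarrow> func f A B \<and>
     (\<forall>a\<in>elts A. \<forall>b\<in>elts A. ap f a = ap f b \<longrightarrow> a = b)"
  by (cases "func f A B") (simp_all add: injection_def app_eq_ap)

lemma bijection_ap: "bijection f A B \<longleftrightarrow> func f A B \<and>
     (\<forall>a\<in>elts A. \<forall>b\<in>elts A. ap f a = ap f b \<longrightarrow> a = b) \<and>
     (\<forall>b\<in>elts B. \<exists>a\<in>elts A. ap f a = b)"
  by (cases "func f A B") (simp_all add: bijection_def injection_ap app_eq_ap)

lemma definable_bijection: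
  "definable_term t \<Longrightarrow> definable_term u \<Longrightarrow> definable_term v \<Longrightarrow> definable (\<lambda>e. bijection (t e) (u e) (v e))"
proof (rule definable_subst3[where K = bijection])
  show "definable (\<lambda>e. bijection (e 0) (e (Suc 0)) (e (Suc (Suc 0))))"
    unfolding bijection_ap by (intro definable_basic definable_term_ap definable_func)
qed

lemma elts_omega:
  "elts omega = {n. \<forall>w. empty \<in> elts w \<and> (\<forall>x\<in>elts w. adjoin x x \<in> elts w) \<longrightarrow> n \<in> elts w}"
proof -
  obtain w where w: "\<exists>e\<in>elts w. elts e = {}" "\<And>x. x \<in> elts w \<Longrightarrow> \<exists>y\<in>elts w. elts y = insert x (elts x)"
    using infinity by blast
  have "empty \<in> elts w" using w(1) elts_empty_iff by auto
  moreover have "\<forall>x\<in>elts w. adjoin x x \<in> elts w"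
    using w(2) by (metis elts_adjoin extensionality)
  ultimately have w0: "\<forall>w. empty \<in> elts w \<and> (\<forall>x\<in>elts w. adjoin x x \<in> elts w) \<longrightarrow> n \<in> elts w
    \<Longrightarrow> n \<in> elts w" for n
    by blast
  show ?thesis
    unfolding omega_def
  proof (rule elts_Collect)
    show "definable (\<lambda>e. \<forall>w. empty \<in> elts w \<and> (\<forall>x\<in>elts w. adjoin x x \<in> elts w) \<longrightarrow> e 0 \<in> elts w)"
      by (intro definable_basic)
  qed (rule w0)
qed

lemma omega_empty: "empty \<in> elts omega"
  and omega_succ: "n \<in> elts omega \<Longrightarrow> adjoin n n \<in> elts omega"
  by (auto simp: elts_omega)

text \<open>
  A subset of \<open>omega\<close> that is closed under successor is all of \<open>omega\<close>. The model may be nonstandard, so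
  this holds for sets of the model only, whence the definability premise.
\<close>

lemma omega_induct [consumes 1, case_names definable zero succ]:
  assumes "n \<in> elts omega" "definable (\<lambda>e. P (e 0))" "P empty"
    "\<And>n. n \<in> elts omega \<Longrightarrow> P n \<Longrightarrow> P (adjoin n n)"
  shows "P n"
proof -
  obtain w where w: "elts w = {n \<in> elts omega. P n}" using definable_separation[OF assms(2)] by blast
  have "empty \<in> elts w \<and> (\<forall>x\<in>elts w. adjoin x x \<in> elts w)"
    using w omega_empty omega_succ assms by auto
  then have "n \<in> elts w" using assms(1) by (simp add: elts_omega)
  then show ?thesis using w by auto
qed

lemma not_mem_self: "a \<notin> elts a"
  using foundation[of "the_set {a}"] by auto

lemma not_mem_cycle: "a \<in> elts b \<Longrightarrow> b \<notin> elts a"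
  using foundation[of "the_set {a, b}"] by auto

lemma succ_inject: "adjoin m m = adjoin n n \<Longrightarrow> m = n"
  by (metis elts_adjoin insertE insertI1 not_mem_cycle)

lemma succ_nonempty: "adjoin n n \<noteq> empty"
  by (metis elts_adjoin elts_empty insert_not_empty)

lemma definable_finite_set: "definable_term t \<Longrightarrow> definable (\<lambda>e. finite_set (t e))"
proof (rule definable_subst1[where K = finite_set])
  show "definable (\<lambda>e. finite_set (e 0))"
    unfolding finite_set_def by (intro definable_basic definable_bijection)
qed

lemmas definable_sets = definable_basic definable_term_cart definable_term_ap definable_term_pfst
  definable_term_psnd definable_func definable_finite_set

section \<open>Finite sets and chains of finite sets\<close>

definition remove :: "'a \<Rightarrow> 'a \<Rightarrow> 'a" where
  "remove x a = the_set {y. y \<in> elts a \<and> y \<noteq> x}"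

lemma elts_remove [simp]: "elts (remove x a) = elts a - {x}"
proof -
  have "elts (remove x a) = {y. y \<in> elts a \<and> y \<noteq> x}"
    unfolding remove_def by (rule elts_Collect[where a = a]) (intro definable_sets, simp)
  then show ?thesis by auto
qed

lemma definable_term_remove:
  "definable_term t \<Longrightarrow> definable_term u \<Longrightarrow> definable_term (\<lambda>e. remove (t e) (u e))"
  by (rule definable_term_subst2[where f = remove],
      rule definable_term_ext[where Q = "\<lambda>e z. z \<in> elts (e (Suc 0)) \<and> z \<noteq> e 0"])
     (simp, intro definable_sets, assumption+)

lemma adjoin_remove: "x \<in> elts a \<Longrightarrow> adjoin x (remove x a) = a"
  by (rule extI) auto

lemma adjoin_absorb: "x \<in> elts a \<Longrightarrow> adjoin x a = a"
  by (rule extI) auto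

lemma finite_empty: "finite_set empty"
proof -
  have "bijection empty empty empty" by (simp add: bijection_ap func_def)
  then show ?thesis unfolding finite_set_def using omega_empty by blast
qed

lemma finite_adjoin:
  assumes "finite_set F"
  shows "finite_set (adjoin x F)"
proof (cases "x \<in> elts F")
  case True
  then show ?thesis using assms adjoin_absorb by simp
next
  case False
  obtain n f where n: "n \<in> elts omega" and f: "bijection f n F"
    using assms unfolding finite_set_def by blast
  have fn: "func f n F" using f by (simp add: bijection_ap)
  obtain g where g: "func g (adjoin n n) (adjoin x F)"
    and gv: "\<And>a. a \<in> elts (adjoin n n) \<Longrightarrow>
      (a = n \<and> ap g a = x) \<or> (a \<noteq> n \<and> ap g a = ap f a)"
  proof (rule func_exists[where A = "adjoin n n" and B = "adjoin x F"
        and Q = "\<lambda>a b. (a = n \<and> b = x) \<or> (a \<noteq> n \<and> b = ap f a)"])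
    show "definable (\<lambda>e. (e 0 = n \<and> e (Suc 0) = x) \<or> (e 0 \<noteq> n \<and> e (Suc 0) = ap f (e 0)))"
      by (intro definable_sets)
  qed (use ap_type[OF fn] in auto)
  have gn: "ap g n = x" "\<And>a. a \<in> elts n \<Longrightarrow> ap g a = ap f a"
    using gv not_mem_self by fastforce+
  have finj: "a = b" if "a \<in> elts n" "b \<in> elts n" "ap f a = ap f b" for a b
    using f that unfolding bijection_ap by blast
  have fne: "ap f a \<noteq> x" if "a \<in> elts n" for a
    using ap_type[OF fn that] False by auto
  have "bijection g (adjoin n n) (adjoin x F)"
    unfolding bijection_ap
  proof (intro conjI ballI impI)
    fix a b assume ab: "a \<in> elts (adjoin n n)" "b \<in> elts (adjoin n n)" "ap g a = ap g b"
    have "a = n \<or> a \<in> elts n" "b = n \<or> b \<in> elts n" using ab by auto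
    then show "a = b" using ab(3) gn fne finj by (elim disjE) (simp_all, metis+)
  next
    fix b assume b: "b \<in> elts (adjoin x F)"
    show "\<exists>a\<in>elts (adjoin n n). ap g a = b"
    proof (cases "b = x")
      case False
      then obtain a where "a \<in> elts n" "ap f a = b" using b f unfolding bijection_ap by auto
      then show ?thesis using gn(2)[of a] by auto
    qed (use gn in auto)
  qed (rule g)
  then show ?thesis unfolding finite_set_def using n omega_succ by blast
qed

lemma bijection_remove:
  assumes "bijection f (adjoin n n) G"
  obtains g where "bijection g n (remove (ap f n) G)" "ap f n \<in> elts G"
proof -
  have f: "func f (adjoin n n) G"
    and inj: "\<And>a b. a \<in> elts (adjoin n n) \<Longrightarrow> b \<in> elts (adjoin n n) \<Longrightarrow> ap f a = ap f b \<Longrightarrow> a = b"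
    and surj: "\<And>b. b \<in> elts G \<Longrightarrow> \<exists>a\<in>elts (adjoin n n). ap f a = b"
    using assms unfolding bijection_ap by blast+
  obtain g where g: "func g n (remove (ap f n) G)" "\<And>a. a \<in> elts n \<Longrightarrow> ap g a = ap f a"
  proof (rule func_exists_term[where A = n and B = "remove (ap f n) G" and t = "ap f"])
    show "definable_term (\<lambda>e. ap f (e 0))" by (intro definable_sets)
    fix a assume a: "a \<in> elts n"
    then have "ap f a \<noteq> ap f n" using inj[of a n] not_mem_self by auto
    then show "ap f a \<in> elts (remove (ap f n) G)" using ap_type[OF f] a by auto
  qed (rule that)
  have "bijection g n (remove (ap f n) G)"
    unfolding bijection_ap
  proof (intro conjI ballI impI)
    fix a b assume "a \<in> elts n" "b \<in> elts n" "ap g a = ap g b"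
    then show "a = b" using g(2) inj by simp
  next
    fix b assume b: "b \<in> elts (remove (ap f n) G)"
    then obtain a where "a \<in> elts (adjoin n n)" "ap f a = b" using surj by auto
    then show "\<exists>a\<in>elts n. ap g a = b" using b g(2) by auto
  qed (rule g)
  moreover have "ap f n \<in> elts G" using ap_type[OF f] by simp
  ultimately show ?thesis by (rule that)
qed

lemma finite_set_induct [consumes 1, case_names definable empty adjoin]:
  assumes F: "finite_set F" and def: "definable (\<lambda>e. P (e 0))" and P0: "P empty"
    and step: "\<And>F x. finite_set F \<Longrightarrow> x \<notin> elts F \<Longrightarrow> P F \<Longrightarrow> P (adjoin x F)"
  shows "P F"
proof -
  have "\<forall>G f. bijection f n G \<longrightarrow> P G" if "n \<in> elts omega" for n
    using that
  proof (induction rule: omega_induct)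
    case definable
    show ?case by (intro definable_sets definable_bijection definable_subst1[OF def])
  next
    case zero
    show ?case
    proof (intro allI impI)
      fix G f assume "bijection f empty G"
      then have "elts G = {}" unfolding bijection_ap by auto
      then show "P G" using P0 elts_empty_iff by metis
    qed
  next
    case (succ n)
    show ?case
    proof (intro allI impI)
      fix G f assume "bijection f (adjoin n n) G"
      then obtain g where g: "bijection g n (remove (ap f n) G)" "ap f n \<in> elts G"
        by (rule bijection_remove)
      have "P (adjoin (ap f n) (remove (ap f n) G))"
      proof (rule step)
        show "finite_set (remove (ap f n) G)" unfolding finite_set_def using succ(1) g by blast
        show "P (remove (ap f n) G)" using succ g by blast
      qed simp
      then show "P G" using adjoin_remove[OF g(2)] by simp
    qed
  qed
  then show ?thesis using F unfolding finite_set_def by blast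
qed

lemma finite_subset:
  assumes "finite_set F" "elts H \<subseteq> elts F"
  shows "finite_set H"
proof -
  have "\<forall>H. elts H \<subseteq> elts F \<longrightarrow> finite_set H"
    using assms(1)
  proof (induction rule: finite_set_induct)
    case definable
    show ?case by (intro definable_sets)
  next
    case empty
    show ?case using finite_empty elts_empty_iff by auto
  next
    case (adjoin F x)
    show ?case
    proof (intro allI impI)
      fix H assume H: "elts H \<subseteq> elts (adjoin x F)"
      then have "elts (remove x H) \<subseteq> elts F" by auto
      then have "finite_set (remove x H)" using adjoin by blast
      then show "finite_set H"
        using finite_adjoin[of "remove x H" x] adjoin_remove[of x H] H adjoin(3)
        by (cases "x \<in> elts H") auto
    qed
  qed
  then show ?thesis using assms(2) by blast
qed

lemma finite_pair_union:
  assumes "finite_set F" "finite_set G"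
  shows "finite_set (pair_union F G)"
  using assms(1)
proof (induction rule: finite_set_induct)
  case definable
  show ?case by (intro definable_sets)
next
  case empty
  have "pair_union empty G = G" by (rule extI) simp
  then show ?case using assms(2) by simp
next
  case (adjoin F x)
  have "pair_union (adjoin x F) G = adjoin x (pair_union F G)" by (rule extI) simp
  then show ?case using adjoin(3) finite_adjoin by simp
qed

lemma elts_Fin [simp]: "elts (Fin X) = {F. elts F \<subseteq> elts X \<and> finite_set F}"
  unfolding Fin_def by (rule elts_Collect[where a = "power_set X"]) (intro definable_sets, simp)

lemma Fin_induct [consumes 1, case_names definable empty adjoin]:
  assumes F: "F \<in> elts (Fin X)" and def: "definable (\<lambda>e. P (e 0))" and P0: "P empty"
    and step: "\<And>F x. F \<in> elts (Fin X) \<Longrightarrow> x \<in> elts X \<Longrightarrow> x \<notin> elts F \<Longrightarrow> P F \<Longrightarrow> P (adjoin x F)"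
  shows "P F"
proof -
  have "finite_set F" using F by simp
  then have "elts F \<subseteq> elts X \<longrightarrow> P F"
  proof (induction rule: finite_set_induct)
    case definable
    show ?case by (intro definable_sets definable_subst1[OF def])
  next
    case (adjoin F x)
    then show ?case using step[of F x] by simp
  qed (use P0 in simp)
  then show ?thesis using F by simp
qed

text \<open>
  Induction on \<open>F\<close>, for all families \<open>Z\<close> at once. If every member of \<open>Z\<close> below \<open>adjoin x F\<close> contains \<open>x\<close>,
  the induction hypothesis is applied to the family of these members with \<open>x\<close> removed.
\<close>

lemma finite_minimal:
  assumes "finite_set F" "F \<in> elts Z"
  obtains M where "M \<in> elts Z" "\<And>H. H \<in> elts Z \<Longrightarrow> elts H \<subseteq> elts M \<Longrightarrow> H = M"
proof -
  have "\<forall>Z. (\<exists>H\<in>elts Z. elts H \<subseteq> elts F) \<longrightarrow>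
      (\<exists>M\<in>elts Z. \<forall>H\<in>elts Z. elts H \<subseteq> elts M \<longrightarrow> H = M)"
    using assms(1)
  proof (induction rule: finite_set_induct)
    case definable
    show ?case by (intro definable_sets)
  next
    case empty
    show ?case
    proof (intro allI impI)
      fix Z assume "\<exists>H\<in>elts Z. elts H \<subseteq> elts empty"
      then have "empty \<in> elts Z" using elts_empty_iff by auto
      then show "\<exists>M\<in>elts Z. \<forall>H\<in>elts Z. elts H \<subseteq> elts M \<longrightarrow> H = M"
        by (rule bexI[rotated]) (simp add: elts_empty_iff)
    qed
  next
    case (adjoin F x)
    show ?case
    proof (intro allI impI)
      fix Z assume "\<exists>H\<in>elts Z. elts H \<subseteq> elts (adjoin x F)"
      then obtain H where H: "H \<in> elts Z" "elts H \<subseteq> elts (adjoin x F)" by blast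
      show "\<exists>M\<in>elts Z. \<forall>H\<in>elts Z. elts H \<subseteq> elts M \<longrightarrow> H = M"
      proof (cases "\<exists>H\<in>elts Z. elts H \<subseteq> elts F")
        case True
        then show ?thesis using adjoin(3) by blast
      next
        case False
        have x: "x \<in> elts W" if "W \<in> elts Z" "elts W \<subseteq> elts (adjoin x F)" for W
          using False that by auto
        have "definable (\<lambda>e. adjoin x (e 0) \<in> elts Z)" by (intro definable_sets)
        then obtain Z' where Z': "elts Z' = {K \<in> elts (power_set F). adjoin x K \<in> elts Z}"
          using definable_separation[of "\<lambda>K. adjoin x K \<in> elts Z"] by blast
        have in': "remove x W \<in> elts Z'" if "W \<in> elts Z" "elts W \<subseteq> elts (adjoin x F)" for W
          using that adjoin_remove[OF x[OF that]] by (auto simp: Z')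
        have "remove x H \<in> elts Z'" "elts (remove x H) \<subseteq> elts F" using in'[OF H] H by auto
        then obtain M where M: "M \<in> elts Z'" "\<And>K. K \<in> elts Z' \<Longrightarrow> elts K \<subseteq> elts M \<Longrightarrow> K = M"
          using adjoin(3) by blast
        have MF: "elts M \<subseteq> elts F" "adjoin x M \<in> elts Z" using M(1) by (auto simp: Z')
        have "W = adjoin x M" if W: "W \<in> elts Z" "elts W \<subseteq> elts (adjoin x M)" for W
        proof -
          have WF: "elts W \<subseteq> elts (adjoin x F)" using W MF by auto
          have "remove x W = M" using M(2)[OF in'[OF W(1) WF]] W(2) by auto
          then show ?thesis using adjoin_remove[OF x[OF W(1) WF]] by simp
        qed
        then show ?thesis using MF by blast
      qed
    qed
  qed
  then show ?thesis using assms(2) that by blast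
qed

text \<open>
  The injection is the sequence \<open>a0\<close>, \<open>s a0\<close>, \<open>s (s a0)\<close> and so on, obtained as the intersection of all
  relations that contain the pair \<open>(0, a0)\<close> and are closed under \<open>(n, a) \<mapsto> (n + 1, s a)\<close>.
\<close>

lemma Dedekind_infiniteI:
  assumes s: "func s A A"
    and inj: "\<And>a b. a \<in> elts A \<Longrightarrow> b \<in> elts A \<Longrightarrow> ap s a = ap s b \<Longrightarrow> a = b"
    and a0: "a0 \<in> elts A" "\<And>a. a \<in> elts A \<Longrightarrow> ap s a \<noteq> a0"
  obtains f where "injection f omega A"
proof -
  define cl where "cl Z \<longleftrightarrow> opair empty a0 \<in> elts Z \<and>
    (\<forall>n\<in>elts omega. \<forall>a\<in>elts A. opair n a \<in> elts Z \<longrightarrow> opair (adjoin n n) (ap s a) \<in> elts Z)" for Z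
  have "definable (\<lambda>e. \<forall>Z. cl Z \<longrightarrow> e 0 \<in> elts Z)"
    unfolding cl_def by (intro definable_sets)
  then obtain f where f: "elts f = {p \<in> elts (cart omega A). \<forall>Z. cl Z \<longrightarrow> p \<in> elts Z}"
    using definable_separation[of "\<lambda>p. \<forall>Z. cl Z \<longrightarrow> p \<in> elts Z"] by blast
  have f_sub: "p \<in> elts Z" if "p \<in> elts f" "cl Z" for p Z
    using that f by auto
  have f0: "opair empty a0 \<in> elts f"
    using omega_empty a0 by (auto simp: f cl_def)
  have fS: "opair (adjoin n n) (ap s a) \<in> elts f" if "opair n a \<in> elts f" for n a
    using that omega_succ ap_type[OF s] by (auto simp: f cl_def)
  have fdom: "n \<in> elts omega" "a \<in> elts A" if "opair n a \<in> elts f" for n a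
    using that by (auto simp: f)
  \<comment> \<open>A pair that is not forced into \<open>f\<close> can be removed without destroying closedness.\<close>
  have z: "a = a0" if "opair empty a \<in> elts f" for a
  proof (rule ccontr)
    assume "a \<noteq> a0"
    then have "cl (remove (opair empty a) f)"
      using f0 fS succ_nonempty unfolding cl_def by auto
    then show False using f_sub[OF that] by fastforce
  qed
  have "\<exists>!a. opair n a \<in> elts f" if "n \<in> elts omega" for n
    using that
  proof (induction rule: omega_induct)
    case definable
    show ?case unfolding Ex1_def by (intro definable_sets)
  next
    case zero
    show ?case using f0 z by blast
  next
    case (succ n)
    then obtain a where a: "opair n a \<in> elts f" "\<And>b. opair n b \<in> elts f \<Longrightarrow> b = a" by blast
    have "b = ap s a" if b: "opair (adjoin n n) b \<in> elts f" for b
    proof (rule ccontr)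
      assume nb: "b \<noteq> ap s a"
      have "cl (remove (opair (adjoin n n) b) f)"
        unfolding cl_def
      proof (intro conjI ballI impI)
        show "opair empty a0 \<in> elts (remove (opair (adjoin n n) b) f)"
          using f0 succ_nonempty[of n] by (auto dest: sym)
        fix m c assume "opair m c \<in> elts (remove (opair (adjoin n n) b) f)"
        then show "opair (adjoin m m) (ap s c) \<in> elts (remove (opair (adjoin n n) b) f)"
          using fS a(2)[of c] nb succ_inject[of m n] by auto
      qed
      then show False using f_sub[OF b] by fastforce
    qed
    then show ?case using fS[OF a(1)] by blast
  qed
  then have fn: "func f omega A" unfolding func_def by (auto simp: f)
  have v0: "ap f empty = a0" by (rule ap_eqI[OF fn f0])
  have vS: "ap f (adjoin n n) = ap s (ap f n)" if "n \<in> elts omega" for n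
    by (rule ap_eqI[OF fn fS[OF func_pair[OF fn that]]])
  have cases: "m = empty \<or> (\<exists>k\<in>elts omega. m = adjoin k k)" if "m \<in> elts omega" for m
    using that
  proof (induction rule: omega_induct)
    case definable
    show ?case by (intro definable_sets)
  qed blast+
  have "\<forall>m\<in>elts omega. ap f m = ap f n \<longrightarrow> m = n" if "n \<in> elts omega" for n
    using that
  proof (induction rule: omega_induct)
    case definable
    show ?case by (intro definable_sets)
  next
    case zero
    show ?case
    proof (intro ballI impI)
      fix m assume m: "m \<in> elts omega" "ap f m = ap f empty"
      have "m \<noteq> adjoin k k" if k: "k \<in> elts omega" for k
        using m(2) v0 vS[OF k] a0(2)[OF ap_type[OF fn k]] by auto
      then show "m = empty" using cases[OF m(1)] by blast
    qed
  next
    case (succ n)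
    show ?case
    proof (intro ballI impI)
      fix m assume m: "m \<in> elts omega" "ap f m = ap f (adjoin n n)"
      then have eq: "ap f m = ap s (ap f n)" using vS succ by simp
      then have "m \<noteq> empty" using v0 a0(2)[OF ap_type[OF fn succ(1)]] by auto
      then obtain k where k: "k \<in> elts omega" "m = adjoin k k" using cases[OF m(1)] by blast
      then have "ap f k = ap f n"
        using eq vS[of k] inj ap_type[OF fn] succ(1) by simp
      then show "m = adjoin n n" using succ(2) k by blast
    qed
  qed
  then have "injection f omega A" unfolding injection_ap using fn by blast
  then show ?thesis by (rule that)
qed

text \<open>
  Otherwise the chain has no largest member, so each member has a next larger one, which exists and
  is unique because nonempty families of finite sets have minimal members. The map to the next
  member contradicts Cohen-finiteness through \<open>Dedekind_infiniteI\<close>.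
\<close>

lemma chain_union_finite:
  assumes X: "Cohen_finite X" and G: "elts G \<subseteq> elts (Fin X)"
    and chain: "\<And>A B. A \<in> elts G \<Longrightarrow> B \<in> elts G \<Longrightarrow> elts A \<subseteq> elts B \<or> elts B \<subseteq> elts A"
  shows "finite_set (big_union G)"
proof (rule ccontr)
  assume inf: "\<not> finite_set (big_union G)"
  have big: "\<exists>B\<in>elts G. \<not> elts B \<subseteq> elts A" if "A \<in> elts G" for A
  proof (rule ccontr)
    assume "\<not> (\<exists>B\<in>elts G. \<not> elts B \<subseteq> elts A)"
    then have "elts (big_union G) \<subseteq> elts A" by auto
    then show False using inf finite_subset[of A "big_union G"] that G by auto
  qed
  have ne: "elts G \<noteq> {}"
    using inf finite_empty finite_subset[of empty "big_union G"] by auto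
  have least: "\<exists>M\<in>elts G. K M \<and> (\<forall>C\<in>elts G. K C \<longrightarrow> elts M \<subseteq> elts C)"
    if K: "definable (\<lambda>e. K (e 0))" and A: "A \<in> elts G" "K A" for K A
  proof -
    obtain Z where Z: "elts Z = {B \<in> elts G. K B}" using definable_separation[OF K] by blast
    have "finite_set A" "A \<in> elts Z" using A G Z by auto
    then obtain M where M: "M \<in> elts Z" "\<And>H. H \<in> elts Z \<Longrightarrow> elts H \<subseteq> elts M \<Longrightarrow> H = M"
      using finite_minimal by blast
    have "elts M \<subseteq> elts C" if "C \<in> elts G" "K C" for C
      using chain[of M C] M that Z by auto
    then show ?thesis using M(1) Z by auto
  qed
  define nxt where "nxt A B \<longleftrightarrow> \<not> elts B \<subseteq> elts A \<and>
      (\<forall>C\<in>elts G. \<not> elts C \<subseteq> elts A \<longrightarrow> elts B \<subseteq> elts C)" for A B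
  obtain s where s: "func s G G" and sv: "\<And>A. A \<in> elts G \<Longrightarrow> nxt A (ap s A)"
  proof (rule func_exists[where A = G and B = G and Q = nxt])
    show "definable (\<lambda>e. nxt (e 0) (e (Suc 0)))" unfolding nxt_def by (intro definable_sets)
    fix A assume A: "A \<in> elts G"
    have d: "definable (\<lambda>e. \<not> elts (e 0) \<subseteq> elts A)" by (intro definable_sets)
    obtain B where "B \<in> elts G" "\<not> elts B \<subseteq> elts A" using big[OF A] by blast
    then obtain B where B: "B \<in> elts G" "nxt A B"
      using least[of "\<lambda>B. \<not> elts B \<subseteq> elts A", OF d] unfolding nxt_def by blast
    show "\<exists>!B. B \<in> elts G \<and> nxt A B"
    proof (rule ex1I[of _ B])
      fix C assume "C \<in> elts G \<and> nxt A C"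
      then have "elts C = elts B" using B unfolding nxt_def by (intro equalityI) blast+
      then show "C = B" by (rule extensionality)
    qed (use B in blast)
  qed (rule that)
  have lt: False if "A \<in> elts G" "B \<in> elts G" "ap s A = ap s B" "\<not> elts B \<subseteq> elts A" for A B
    using sv[OF that(1)] sv[OF that(2)] that unfolding nxt_def by auto
  have inj: "A = B" if "A \<in> elts G" "B \<in> elts G" "ap s A = ap s B" for A B
  proof (rule extensionality, rule equalityI)
    show "elts A \<subseteq> elts B" using lt[of B A] that by auto
    show "elts B \<subseteq> elts A" using lt[of A B] that by auto
  qed
  obtain M where M: "M \<in> elts G" "\<And>C. C \<in> elts G \<Longrightarrow> elts M \<subseteq> elts C"
    using least[of "\<lambda>_. True", OF definable_True] ne by blast
  have "ap s A \<noteq> M" if "A \<in> elts G" for A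
    using sv[OF that] M(2)[OF that] unfolding nxt_def by auto
  then obtain f where f: "injection f omega G"
    using Dedekind_infiniteI[OF s inj M(1)] by blast
  then have "func f omega (Fin X)"
    using func_cod[of f omega G "Fin X"] ap_type[of f omega G] G unfolding injection_ap by blast
  then have "injection f omega (Fin X)" using f unfolding injection_ap by blast
  then show False using X unfolding Cohen_finite_def Dedekind_finite_def by blast
qed

end

section \<open>Real and complex numbers of the model\<close>

locale ZF_l2 = ZF_model mem for mem :: "'a \<Rightarrow> 'a \<Rightarrow> bool" +
  fixes S :: "'a reals" and X :: 'a
  assumes complete: "complete_ordered_field S"
begin

text \<open>
  The operations are taken through \<open>ap\<close>, so that terms in them are definable for all arguments. From
  here on \<open>FR\<close> replaces \<open>S\<close>: the simplifier rewrites \<open>S\<close> to \<open>FR\<close> wherever the arguments are real numbers.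
\<close>

definition FR :: "'a ring" where
  "FR = \<lparr>carrier = elts (Rset S), mult = (\<lambda>a b. ap (Rmul S) (opair a b)), one = Rone S,
         zero = Rzero S, add = (\<lambda>a b. ap (Radd S) (opair a b))\<rparr>"

lemma FR_add: "a \<oplus>\<^bsub>FR\<^esub> b = ap (Radd S) (opair a b)"
  and FR_mult: "a \<otimes>\<^bsub>FR\<^esub> b = ap (Rmul S) (opair a b)"
  and Rset_carrier [simp]: "elts (Rset S) = carrier FR"
  and Rzero_zero [simp]: "Rzero S = \<zero>\<^bsub>FR\<^esub>"
  and Rone_one [simp]: "Rone S = \<one>\<^bsub>FR\<^esub>"
  by (simp_all add: FR_def)

lemma ordered: "ordered_field S"
  using complete unfolding complete_ordered_field_def by blast

lemma Radd_func: "func (Radd S) (cart (Rset S) (Rset S)) (Rset S)"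
  and Rmul_func: "func (Rmul S) (cart (Rset S) (Rset S)) (Rset S)"
  using ordered unfolding ordered_field_def Let_def by blast+

lemma radd_eq [simp]: "a \<in> carrier FR \<Longrightarrow> b \<in> carrier FR \<Longrightarrow> radd S a b = a \<oplus>\<^bsub>FR\<^esub> b"
  unfolding radd_def FR_add by (rule app_eq_ap[OF Radd_func]) simp

lemma rmul_eq [simp]: "a \<in> carrier FR \<Longrightarrow> b \<in> carrier FR \<Longrightarrow> rmul S a b = a \<otimes>\<^bsub>FR\<^esub> b"
  unfolding rmul_def FR_mult by (rule app_eq_ap[OF Rmul_func]) simp

lemma FR_closed:
  assumes "a \<in> carrier FR" "b \<in> carrier FR"
  shows "a \<oplus>\<^bsub>FR\<^esub> b \<in> carrier FR" "a \<otimes>\<^bsub>FR\<^esub> b \<in> carrier FR"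
  unfolding FR_add FR_mult
  using ap_type[OF Radd_func, of "opair a b"] ap_type[OF Rmul_func, of "opair a b"] assms
  by simp_all

lemma ordered_field_axioms:
  "\<zero>\<^bsub>FR\<^esub> \<in> carrier FR"
  "\<one>\<^bsub>FR\<^esub> \<in> carrier FR"
  "\<zero>\<^bsub>FR\<^esub> \<noteq> \<one>\<^bsub>FR\<^esub>"
  "\<forall>a\<in>carrier FR. \<forall>b\<in>carrier FR. \<forall>c\<in>carrier FR. radd S (radd S a b) c = radd S a (radd S b c)"
  "\<forall>a\<in>carrier FR. \<forall>b\<in>carrier FR. radd S a b = radd S b a"
  "\<forall>a\<in>carrier FR. radd S \<zero>\<^bsub>FR\<^esub> a = a"
  "\<forall>a\<in>carrier FR. \<exists>b\<in>carrier FR. radd S a b = \<zero>\<^bsub>FR\<^esub>"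
  "\<forall>a\<in>carrier FR. \<forall>b\<in>carrier FR. \<forall>c\<in>carrier FR. rmul S (rmul S a b) c = rmul S a (rmul S b c)"
  "\<forall>a\<in>carrier FR. \<forall>b\<in>carrier FR. rmul S a b = rmul S b a"
  "\<forall>a\<in>carrier FR. rmul S \<one>\<^bsub>FR\<^esub> a = a"
  "\<forall>a\<in>carrier FR. a \<noteq> \<zero>\<^bsub>FR\<^esub> \<longrightarrow> (\<exists>b\<in>carrier FR. rmul S a b = \<one>\<^bsub>FR\<^esub>)"
  "\<forall>a\<in>carrier FR. \<forall>b\<in>carrier FR. \<forall>c\<in>carrier FR. rmul S a (radd S b c) = radd S (rmul S a b) (rmul S a c)"
  "\<forall>a\<in>carrier FR. \<forall>b\<in>carrier FR. rle S a b \<or> rle S b a"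
  "\<forall>a\<in>carrier FR. \<forall>b\<in>carrier FR. rle S a b \<and> rle S b a \<longrightarrow> a = b"
  "\<forall>a\<in>carrier FR. \<forall>b\<in>carrier FR. \<forall>c\<in>carrier FR. rle S a b \<and> rle S b c \<longrightarrow> rle S a c"
  "\<forall>a\<in>carrier FR. \<forall>b\<in>carrier FR. \<forall>c\<in>carrier FR. rle S a b \<longrightarrow>
     rle S (radd S a c) (radd S b c)"
  "\<forall>a\<in>carrier FR. \<forall>b\<in>carrier FR. rle S \<zero>\<^bsub>FR\<^esub> a \<and> rle S \<zero>\<^bsub>FR\<^esub> b \<longrightarrow>
     rle S \<zero>\<^bsub>FR\<^esub> (rmul S a b)"
  using ordered unfolding ordered_field_def Let_def Rset_carrier Rzero_zero Rone_one
  by - (elim conjE, assumption)+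

lemma ordered_field_FR:
  "\<zero>\<^bsub>FR\<^esub> \<in> carrier FR"
  "\<one>\<^bsub>FR\<^esub> \<in> carrier FR"
  "\<zero>\<^bsub>FR\<^esub> \<noteq> \<one>\<^bsub>FR\<^esub>"
  "\<forall>a\<in>carrier FR. \<forall>b\<in>carrier FR. \<forall>c\<in>carrier FR.
     (a \<oplus>\<^bsub>FR\<^esub> b) \<oplus>\<^bsub>FR\<^esub> c = a \<oplus>\<^bsub>FR\<^esub> (b \<oplus>\<^bsub>FR\<^esub> c)"
  "\<forall>a\<in>carrier FR. \<forall>b\<in>carrier FR. a \<oplus>\<^bsub>FR\<^esub> b = b \<oplus>\<^bsub>FR\<^esub> a"
  "\<forall>a\<in>carrier FR. \<zero>\<^bsub>FR\<^esub> \<oplus>\<^bsub>FR\<^esub> a = a"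
  "\<forall>a\<in>carrier FR. \<exists>b\<in>carrier FR. a \<oplus>\<^bsub>FR\<^esub> b = \<zero>\<^bsub>FR\<^esub>"
  "\<forall>a\<in>carrier FR. \<forall>b\<in>carrier FR. \<forall>c\<in>carrier FR.
     (a \<otimes>\<^bsub>FR\<^esub> b) \<otimes>\<^bsub>FR\<^esub> c = a \<otimes>\<^bsub>FR\<^esub> (b \<otimes>\<^bsub>FR\<^esub> c)"
  "\<forall>a\<in>carrier FR. \<forall>b\<in>carrier FR. a \<otimes>\<^bsub>FR\<^esub> b = b \<otimes>\<^bsub>FR\<^esub> a"
  "\<forall>a\<in>carrier FR. \<one>\<^bsub>FR\<^esub> \<otimes>\<^bsub>FR\<^esub> a = a"
  "\<forall>a\<in>carrier FR. a \<noteq> \<zero>\<^bsub>FR\<^esub> \<longrightarrow> (\<exists>b\<in>carrier FR. a \<otimes>\<^bsub>FR\<^esub> b = \<one>\<^bsub>FR\<^esub>)"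
  "\<forall>a\<in>carrier FR. \<forall>b\<in>carrier FR. \<forall>c\<in>carrier FR.
     a \<otimes>\<^bsub>FR\<^esub> (b \<oplus>\<^bsub>FR\<^esub> c) = (a \<otimes>\<^bsub>FR\<^esub> b) \<oplus>\<^bsub>FR\<^esub> (a \<otimes>\<^bsub>FR\<^esub> c)"
  "\<forall>a\<in>carrier FR. \<forall>b\<in>carrier FR. rle S a b \<or> rle S b a"
  "\<forall>a\<in>carrier FR. \<forall>b\<in>carrier FR. rle S a b \<and> rle S b a \<longrightarrow> a = b"
  "\<forall>a\<in>carrier FR. \<forall>b\<in>carrier FR. \<forall>c\<in>carrier FR. rle S a b \<and> rle S b c \<longrightarrow> rle S a c"
  "\<forall>a\<in>carrier FR. \<forall>b\<in>carrier FR. \<forall>c\<in>carrier FR. rle S a b \<longrightarrow>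
     rle S (a \<oplus>\<^bsub>FR\<^esub> c) (b \<oplus>\<^bsub>FR\<^esub> c)"
  "\<forall>a\<in>carrier FR. \<forall>b\<in>carrier FR. rle S \<zero>\<^bsub>FR\<^esub> a \<and> rle S \<zero>\<^bsub>FR\<^esub> b \<longrightarrow>
     rle S \<zero>\<^bsub>FR\<^esub> (a \<otimes>\<^bsub>FR\<^esub> b)"
proof -
  show "\<zero>\<^bsub>FR\<^esub> \<in> carrier FR"
    using ordered_field_axioms(1) ordered_field_axioms(1,2)
    by (simp add: FR_closed cong: ball_cong bex_cong)
  show "\<one>\<^bsub>FR\<^esub> \<in> carrier FR"
    using ordered_field_axioms(2) ordered_field_axioms(1,2)
    by (simp add: FR_closed cong: ball_cong bex_cong)
  show "\<zero>\<^bsub>FR\<^esub> \<noteq> \<one>\<^bsub>FR\<^esub>"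
    using ordered_field_axioms(3) ordered_field_axioms(1,2)
    by (simp add: FR_closed cong: ball_cong bex_cong)
  show "\<forall>a\<in>carrier FR. \<forall>b\<in>carrier FR. \<forall>c\<in>carrier FR.
     (a \<oplus>\<^bsub>FR\<^esub> b) \<oplus>\<^bsub>FR\<^esub> c = a \<oplus>\<^bsub>FR\<^esub> (b \<oplus>\<^bsub>FR\<^esub> c)"
    using ordered_field_axioms(4) ordered_field_axioms(1,2)
    by (simp add: FR_closed cong: ball_cong bex_cong)
  show "\<forall>a\<in>carrier FR. \<forall>b\<in>carrier FR. a \<oplus>\<^bsub>FR\<^esub> b = b \<oplus>\<^bsub>FR\<^esub> a"
    using ordered_field_axioms(5) ordered_field_axioms(1,2)
    by (simp add: FR_closed cong: ball_cong bex_cong)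
  show "\<forall>a\<in>carrier FR. \<zero>\<^bsub>FR\<^esub> \<oplus>\<^bsub>FR\<^esub> a = a"
    using ordered_field_axioms(6) ordered_field_axioms(1,2)
    by (simp add: FR_closed cong: ball_cong bex_cong)
  show "\<forall>a\<in>carrier FR. \<exists>b\<in>carrier FR. a \<oplus>\<^bsub>FR\<^esub> b = \<zero>\<^bsub>FR\<^esub>"
    using ordered_field_axioms(7) ordered_field_axioms(1,2)
    by (simp add: FR_closed cong: ball_cong bex_cong)
  show "\<forall>a\<in>carrier FR. \<forall>b\<in>carrier FR. \<forall>c\<in>carrier FR.
     (a \<otimes>\<^bsub>FR\<^esub> b) \<otimes>\<^bsub>FR\<^esub> c = a \<otimes>\<^bsub>FR\<^esub> (b \<otimes>\<^bsub>FR\<^esub> c)"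
    using ordered_field_axioms(8) ordered_field_axioms(1,2)
    by (simp add: FR_closed cong: ball_cong bex_cong)
  show "\<forall>a\<in>carrier FR. \<forall>b\<in>carrier FR. a \<otimes>\<^bsub>FR\<^esub> b = b \<otimes>\<^bsub>FR\<^esub> a"
    using ordered_field_axioms(9) ordered_field_axioms(1,2)
    by (simp add: FR_closed cong: ball_cong bex_cong)
  show "\<forall>a\<in>carrier FR. \<one>\<^bsub>FR\<^esub> \<otimes>\<^bsub>FR\<^esub> a = a"
    using ordered_field_axioms(10) ordered_field_axioms(1,2)
    by (simp add: FR_closed cong: ball_cong bex_cong)
  show "\<forall>a\<in>carrier FR. a \<noteq> \<zero>\<^bsub>FR\<^esub> \<longrightarrow> (\<exists>b\<in>carrier FR. a \<otimes>\<^bsub>FR\<^esub> b = \<one>\<^bsub>FR\<^esub>)"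
    using ordered_field_axioms(11) ordered_field_axioms(1,2)
    by (simp add: FR_closed cong: ball_cong bex_cong)
  show "\<forall>a\<in>carrier FR. \<forall>b\<in>carrier FR. \<forall>c\<in>carrier FR.
     a \<otimes>\<^bsub>FR\<^esub> (b \<oplus>\<^bsub>FR\<^esub> c) = (a \<otimes>\<^bsub>FR\<^esub> b) \<oplus>\<^bsub>FR\<^esub> (a \<otimes>\<^bsub>FR\<^esub> c)"
    using ordered_field_axioms(12) ordered_field_axioms(1,2)
    by (simp add: FR_closed cong: ball_cong bex_cong)
  show "\<forall>a\<in>carrier FR. \<forall>b\<in>carrier FR. rle S a b \<or> rle S b a"
    by (rule ordered_field_axioms(13))
  show "\<forall>a\<in>carrier FR. \<forall>b\<in>carrier FR. rle S a b \<and> rle S b a \<longrightarrow> a = b"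
    by (rule ordered_field_axioms(14))
  show "\<forall>a\<in>carrier FR. \<forall>b\<in>carrier FR. \<forall>c\<in>carrier FR. rle S a b \<and> rle S b c \<longrightarrow> rle S a c"
    by (rule ordered_field_axioms(15))
  show "\<forall>a\<in>carrier FR. \<forall>b\<in>carrier FR. \<forall>c\<in>carrier FR. rle S a b \<longrightarrow>
     rle S (a \<oplus>\<^bsub>FR\<^esub> c) (b \<oplus>\<^bsub>FR\<^esub> c)"
    using ordered_field_axioms(16) ordered_field_axioms(1,2)
    by (simp add: FR_closed cong: ball_cong bex_cong)
  show "\<forall>a\<in>carrier FR. \<forall>b\<in>carrier FR. rle S \<zero>\<^bsub>FR\<^esub> a \<and> rle S \<zero>\<^bsub>FR\<^esub> b \<longrightarrow>
     rle S \<zero>\<^bsub>FR\<^esub> (a \<otimes>\<^bsub>FR\<^esub> b)"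
    using ordered_field_axioms(17) ordered_field_axioms(1,2)
    by (simp add: FR_closed cong: ball_cong bex_cong)
qed

sublocale F: ordered_field_carrier FR "rle S"
proof (intro ordered_field_carrier.intro ordered_field_carrier_axioms.intro)
  note ax = ordered_field_FR
  have "abelian_group FR"
  proof (rule abelian_groupI)
    fix a assume a: "a \<in> carrier FR"
    then obtain b where "b \<in> carrier FR" "a \<oplus>\<^bsub>FR\<^esub> b = \<zero>\<^bsub>FR\<^esub>" using ax(7) by blast
    then show "\<exists>b\<in>carrier FR. b \<oplus>\<^bsub>FR\<^esub> a = \<zero>\<^bsub>FR\<^esub>" using ax(5) a by metis
  next
    fix a b c assume abc: "a \<in> carrier FR" "b \<in> carrier FR" "c \<in> carrier FR"
    show "(a \<oplus>\<^bsub>FR\<^esub> b) \<oplus>\<^bsub>FR\<^esub> c = a \<oplus>\<^bsub>FR\<^esub> (b \<oplus>\<^bsub>FR\<^esub> c)" using ax(4) abc by blast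
    show "a \<oplus>\<^bsub>FR\<^esub> b = b \<oplus>\<^bsub>FR\<^esub> a" using ax(5) abc by blast
  qed (use ax(1,6) FR_closed in simp_all)
  moreover have "comm_monoid FR"
  proof (rule comm_monoidI)
    fix a b c assume abc: "a \<in> carrier FR" "b \<in> carrier FR" "c \<in> carrier FR"
    show "(a \<otimes>\<^bsub>FR\<^esub> b) \<otimes>\<^bsub>FR\<^esub> c = a \<otimes>\<^bsub>FR\<^esub> (b \<otimes>\<^bsub>FR\<^esub> c)" using ax(8) abc by blast
    show "a \<otimes>\<^bsub>FR\<^esub> b = b \<otimes>\<^bsub>FR\<^esub> a" using ax(9) abc by blast
  qed (use ax(2,10) FR_closed in simp_all)
  ultimately have "cring FR"
  proof (rule cringI)
    fix a b c assume "a \<in> carrier FR" "b \<in> carrier FR" "c \<in> carrier FR"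
    then show "(a \<oplus>\<^bsub>FR\<^esub> b) \<otimes>\<^bsub>FR\<^esub> c = a \<otimes>\<^bsub>FR\<^esub> c \<oplus>\<^bsub>FR\<^esub> b \<otimes>\<^bsub>FR\<^esub> c"
      using ax(9,12) FR_closed by metis
  qed
  then show "field FR"
    by (rule cring.cring_fieldI2) (use ax(3,11) in auto)
qed (use ordered_field_FR(13-17) in meson)+

lemma rneg_eq [simp]:
  assumes "a \<in> carrier FR"
  shows "rneg S a = \<ominus>\<^bsub>FR\<^esub> a"
  unfolding rneg_def
proof (rule the_equality)
  show "\<ominus>\<^bsub>FR\<^esub> a \<in> elts (Rset S) \<and> radd S a (\<ominus>\<^bsub>FR\<^esub> a) = Rzero S"
    using assms by (simp add: F.r_neg)
  fix b assume "b \<in> elts (Rset S) \<and> radd S a b = Rzero S"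
  then have "b \<in> carrier FR" "b \<oplus>\<^bsub>FR\<^esub> a = \<zero>\<^bsub>FR\<^esub>" using assms by (auto simp: F.a_comm)
  then show "b = \<ominus>\<^bsub>FR\<^esub> a" using assms F.minus_equality[of b a] by simp
qed

abbreviation rplus (infixl "+\<^sub>R" 65) where "a +\<^sub>R b \<equiv> a \<oplus>\<^bsub>FR\<^esub> b"
abbreviation rtimes (infixl "*\<^sub>R" 70) where "a *\<^sub>R b \<equiv> a \<otimes>\<^bsub>FR\<^esub> b"
abbreviation rleq (infix "\<preceq>" 50) where "a \<preceq> b \<equiv> rle S a b"
abbreviation rzero (\<open>0\<^sub>R\<close>) where "0\<^sub>R \<equiv> \<zero>\<^bsub>FR\<^esub>"
abbreviation rone (\<open>1\<^sub>R\<close>) where "1\<^sub>R \<equiv> \<one>\<^bsub>FR\<^esub>"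

lemma definable_term_rplus:
  "definable_term t \<Longrightarrow> definable_term u \<Longrightarrow> definable_term (\<lambda>e. t e +\<^sub>R u e)"
  unfolding FR_add by (intro definable_sets)

lemma definable_term_rtimes:
  "definable_term t \<Longrightarrow> definable_term u \<Longrightarrow> definable_term (\<lambda>e. t e *\<^sub>R u e)"
  unfolding FR_mult by (intro definable_sets)

lemma definable_rleq: "definable_term t \<Longrightarrow> definable_term u \<Longrightarrow> definable (\<lambda>e. t e \<preceq> u e)"
  unfolding rle_def by (intro definable_sets)

lemma definable_bex_carrier:
  "definable (\<lambda>e. P (\<lambda>i. e (Suc i)) (e 0)) \<Longrightarrow> definable (\<lambda>e. \<exists>a\<in>carrier FR. P e a)"
  unfolding Rset_carrier[symmetric] by (rule definable_bex[OF definable_term_const])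

text \<open>
  Negation is expressed by multiplication with the constant \<open>-1\<close>: constants are definable at no cost,
  whereas the unary operations \<open>rneg\<close> and \<open>cneg\<close> are definite descriptions.
\<close>

definition cplus :: "'a \<Rightarrow> 'a \<Rightarrow> 'a" where
  "cplus c d = opair (pfst c +\<^sub>R pfst d) (psnd c +\<^sub>R psnd d)"

definition ctimes :: "'a \<Rightarrow> 'a \<Rightarrow> 'a" where
  "ctimes c d = opair (pfst c *\<^sub>R pfst d +\<^sub>R \<ominus>\<^bsub>FR\<^esub> 1\<^sub>R *\<^sub>R (psnd c *\<^sub>R psnd d)) (pfst c *\<^sub>R psnd d +\<^sub>R psnd c *\<^sub>R pfst d)"

definition cminus1 :: 'a where
  "cminus1 = opair (\<ominus>\<^bsub>FR\<^esub> 1\<^sub>R) 0\<^sub>R"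

definition modsq :: "'a \<Rightarrow> 'a" where
  "modsq c = pfst c *\<^sub>R pfst c +\<^sub>R psnd c *\<^sub>R psnd c"

abbreviation CC :: "'a set" where "CC \<equiv> elts (Cset S)"

lemma CC_cases:
  assumes "c \<in> CC"
  obtains a b where "c = opair a b" "a \<in> carrier FR" "b \<in> carrier FR"
  using assms unfolding Cset_def by (auto elim!: in_cartE)

lemma opair_CC [simp]: "opair a b \<in> CC \<longleftrightarrow> a \<in> carrier FR \<and> b \<in> carrier FR"
  unfolding Cset_def by simp

lemma cadd_eq: "c \<in> CC \<Longrightarrow> d \<in> CC \<Longrightarrow> cadd S c d = cplus c d"
  by (auto simp: cadd_def cplus_def elim!: CC_cases)

lemma cmul_eq: "c \<in> CC \<Longrightarrow> d \<in> CC \<Longrightarrow> cmul S c d = ctimes c d"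
  by (auto simp: cmul_def ctimes_def F.l_minus elim!: CC_cases)

lemma cneg_eq: "c \<in> CC \<Longrightarrow> cneg S c = ctimes cminus1 c"
  by (auto simp: cneg_def ctimes_def cminus1_def F.l_minus F.r_minus elim!: CC_cases)

lemma cmod2_eq: "c \<in> CC \<Longrightarrow> cmod2 S c = modsq c"
  by (auto simp: cmod2_def modsq_def elim!: CC_cases)

lemma cplus_closed [simp]: "c \<in> CC \<Longrightarrow> d \<in> CC \<Longrightarrow> cplus c d \<in> CC"
  by (auto simp: cplus_def elim!: CC_cases)

lemma ctimes_closed [simp]: "c \<in> CC \<Longrightarrow> d \<in> CC \<Longrightarrow> ctimes c d \<in> CC"
  by (auto simp: ctimes_def elim!: CC_cases)

lemma cminus1_closed [simp]: "cminus1 \<in> CC"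
  by (simp add: cminus1_def)

lemma czero_closed [simp]: "czero S \<in> CC"
  by (simp add: czero_def)

lemma modsq_closed [simp]: "c \<in> CC \<Longrightarrow> modsq c \<in> carrier FR"
  by (auto simp: modsq_def elim!: CC_cases)

lemma modsq_nonneg: "c \<in> CC \<Longrightarrow> 0\<^sub>R \<preceq> modsq c"
  by (auto simp: modsq_def elim!: CC_cases intro: F.nonneg_sumsq)

lemma modsq_cplus:
  "c \<in> CC \<Longrightarrow> d \<in> CC \<Longrightarrow> modsq (cplus c d) \<preceq> (1\<^sub>R +\<^sub>R 1\<^sub>R) *\<^sub>R (modsq c +\<^sub>R modsq d)"
  by (auto simp: modsq_def cplus_def elim!: CC_cases intro: F.modulus_bound)

lemma modsq_ctimes:
  assumes "c \<in> CC" "d \<in> CC"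
  shows "modsq (ctimes c d) = modsq c *\<^sub>R modsq d"
proof -
  obtain p q where c: "c = opair p q" "p \<in> carrier FR" "q \<in> carrier FR"
    using assms(1) by (rule CC_cases)
  obtain x y where d: "d = opair x y" "x \<in> carrier FR" "y \<in> carrier FR"
    using assms(2) by (rule CC_cases)
  note r = c(2,3) d(2,3)
  have l: "modsq (ctimes c d) = (p *\<^sub>R x +\<^sub>R \<ominus>\<^bsub>FR\<^esub> 1\<^sub>R *\<^sub>R (q *\<^sub>R y)) *\<^sub>R (p *\<^sub>R x +\<^sub>R \<ominus>\<^bsub>FR\<^esub> 1\<^sub>R *\<^sub>R (q *\<^sub>R y))
      +\<^sub>R (p *\<^sub>R y +\<^sub>R q *\<^sub>R x) *\<^sub>R (p *\<^sub>R y +\<^sub>R q *\<^sub>R x)"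
    and e: "modsq c *\<^sub>R modsq d = (p *\<^sub>R p +\<^sub>R q *\<^sub>R q) *\<^sub>R (x *\<^sub>R x +\<^sub>R y *\<^sub>R y)"
    by (simp_all add: modsq_def ctimes_def c d)
  show ?thesis unfolding l e using r by algebra
qed

lemma modsq_cminus1: "modsq cminus1 = 1\<^sub>R"
  by (simp add: modsq_def cminus1_def F.l_minus F.r_minus)

lemma modsq_eq_zero:
  assumes "c \<in> CC" "modsq c = 0\<^sub>R"
  shows "c = czero S"
proof -
  obtain a b where c: "c = opair a b" "a \<in> carrier FR" "b \<in> carrier FR"
    using assms(1) by (rule CC_cases)
  have "a *\<^sub>R a +\<^sub>R b *\<^sub>R b = 0\<^sub>R" using assms(2) unfolding modsq_def c pfst_opair psnd_opair .
  then have "a = 0\<^sub>R" "b = 0\<^sub>R" using F.sumsq_eq_zero c(2,3) by blast+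
  then show ?thesis by (simp add: c czero_def)
qed

lemma modsq_czero: "modsq (czero S) = 0\<^sub>R"
  by (simp add: modsq_def czero_def)

text \<open>
  Undoes the elimination step \<open>w + c u\<close>.
\<close>

lemma cplus_ctimes_cancel:
  assumes "w \<in> CC" "c \<in> CC" "u \<in> CC"
  shows "cplus (cplus w (ctimes c u)) (ctimes (ctimes cminus1 c) u) = w"
proof -
  obtain p q where c: "c = opair p q" "p \<in> carrier FR" "q \<in> carrier FR"
    using assms(2) by (rule CC_cases)
  obtain x y where u: "u = opair x y" "x \<in> carrier FR" "y \<in> carrier FR"
    using assms(3) by (rule CC_cases)
  obtain m n where w: "w = opair m n" "m \<in> carrier FR" "n \<in> carrier FR"
    using assms(1) by (rule CC_cases)
  note r = c(2,3) u(2,3) w(2,3) and * = c(1) u(1) w(1)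
  show ?thesis
    unfolding * cplus_def ctimes_def cminus1_def pfst_opair psnd_opair opair_eq_iff
    using r by (intro conjI; algebra)
qed

lemma cplus_diff_cancel:
  assumes "w \<in> CC" "u \<in> CC"
  shows "cplus (cplus w (ctimes cminus1 u)) u = w"
proof -
  obtain x y where u: "u = opair x y" "x \<in> carrier FR" "y \<in> carrier FR"
    using assms(2) by (rule CC_cases)
  obtain m n where w: "w = opair m n" "m \<in> carrier FR" "n \<in> carrier FR"
    using assms(1) by (rule CC_cases)
  note r = u(2,3) w(2,3) and * = u(1) w(1)
  show ?thesis
    unfolding * cplus_def ctimes_def cminus1_def pfst_opair psnd_opair opair_eq_iff
    using r by (intro conjI; algebra)
qed

lemma cplus_zero: "cplus (czero S) (czero S) = czero S"
  by (simp add: cplus_def czero_def)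

lemma ctimes_zero: "c \<in> CC \<Longrightarrow> ctimes c (czero S) = czero S"
  by (auto simp: ctimes_def czero_def elim!: CC_cases)

lemma zero_ctimes: "c \<in> CC \<Longrightarrow> ctimes (czero S) c = czero S"
  by (auto simp: ctimes_def czero_def elim!: CC_cases)

lemma complex_elimination:
  assumes "w \<in> CC" "u \<in> CC" "u \<noteq> czero S"
  obtains c where "c \<in> CC" "cplus w (ctimes c u) = czero S"
proof -
  obtain p q where u: "u = opair p q" "p \<in> carrier FR" "q \<in> carrier FR"
    using assms(2) by (rule CC_cases)
  obtain m n where w: "w = opair m n" "m \<in> carrier FR" "n \<in> carrier FR"
    using assms(1) by (rule CC_cases)
  note r = u(2,3) w(2,3) and * = u(1) w(1)
  have "modsq u \<noteq> 0\<^sub>R" using modsq_eq_zero assms by blast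
  then obtain i where i: "i \<in> carrier FR" "(p *\<^sub>R p +\<^sub>R q *\<^sub>R q) *\<^sub>R i = 1\<^sub>R"
    using F.inverse_pos[of "modsq u"] modsq_nonneg[OF assms(2)] assms(2) by (auto simp: modsq_def *)
  \<comment> \<open>The solution \<open>c = - w u\<^sup>* / |u|\<^sup>2\<close>, where \<open>u\<^sup>*\<close> is the conjugate, in coordinates \<open>c = (a, b)\<close>.\<close>
  define a where "a = \<ominus>\<^bsub>FR\<^esub> 1\<^sub>R *\<^sub>R ((m *\<^sub>R p +\<^sub>R n *\<^sub>R q) *\<^sub>R i)"
  define b where "b = (m *\<^sub>R q +\<^sub>R \<ominus>\<^bsub>FR\<^esub> 1\<^sub>R *\<^sub>R (n *\<^sub>R p)) *\<^sub>R i"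
  have ab: "a \<in> carrier FR" "b \<in> carrier FR" unfolding a_def b_def using r i by auto
  have "m +\<^sub>R (a *\<^sub>R p +\<^sub>R \<ominus>\<^bsub>FR\<^esub> 1\<^sub>R *\<^sub>R (b *\<^sub>R q)) = m +\<^sub>R \<ominus>\<^bsub>FR\<^esub> 1\<^sub>R *\<^sub>R (m *\<^sub>R ((p *\<^sub>R p +\<^sub>R q *\<^sub>R q) *\<^sub>R i))"
    unfolding a_def b_def using r i(1) by algebra
  also have "\<dots> = 0\<^sub>R" using r by (simp add: i F.l_minus F.r_neg)
  finally have 1: "m +\<^sub>R (a *\<^sub>R p +\<^sub>R \<ominus>\<^bsub>FR\<^esub> 1\<^sub>R *\<^sub>R (b *\<^sub>R q)) = 0\<^sub>R" .
  have "n +\<^sub>R (a *\<^sub>R q +\<^sub>R b *\<^sub>R p) = n +\<^sub>R \<ominus>\<^bsub>FR\<^esub> 1\<^sub>R *\<^sub>R (n *\<^sub>R ((p *\<^sub>R p +\<^sub>R q *\<^sub>R q) *\<^sub>R i))"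
    unfolding a_def b_def using r i(1) by algebra
  also have "\<dots> = 0\<^sub>R" using r by (simp add: i F.l_minus F.r_neg)
  finally have 2: "n +\<^sub>R (a *\<^sub>R q +\<^sub>R b *\<^sub>R p) = 0\<^sub>R" .
  show ?thesis
    by (rule that[of "opair a b"]) (use ab 1 2 in \<open>simp_all add: * cplus_def ctimes_def czero_def\<close>)
qed

lemma definable_term_cplus:
  "definable_term t \<Longrightarrow> definable_term u \<Longrightarrow> definable_term (\<lambda>e. cplus (t e) (u e))"
  unfolding cplus_def by (intro definable_sets definable_term_rplus)

lemma definable_term_ctimes:
  "definable_term t \<Longrightarrow> definable_term u \<Longrightarrow> definable_term (\<lambda>e. ctimes (t e) (u e))"
  unfolding ctimes_def by (intro definable_sets definable_term_rplus definable_term_rtimes)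

lemma definable_term_modsq: "definable_term t \<Longrightarrow> definable_term (\<lambda>e. modsq (t e))"
  unfolding modsq_def by (intro definable_sets definable_term_rplus definable_term_rtimes)

lemmas definable_analysis = definable_bex_carrier definable_sets definable_term_rplus
  definable_term_rtimes definable_rleq definable_term_cplus definable_term_ctimes
  definable_term_modsq

section \<open>Sums over finite sets and square-summable functions\<close>

abbreviation is_vec :: "'a \<Rightarrow> bool" where "is_vec \<eta> \<equiv> func \<eta> X (Cset S)"

lemma vec_val [simp]: "is_vec \<eta> \<Longrightarrow> x \<in> elts X \<Longrightarrow> ap \<eta> x \<in> CC"
  by (rule ap_type)

definition is_sumfun :: "'a \<Rightarrow> 'a \<Rightarrow> bool" where
  "is_sumfun \<eta> h \<longleftrightarrow> func h (Fin X) (Rset S) \<and> ap h empty = 0\<^sub>R \<and>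
     (\<forall>F\<in>elts (Fin X). \<forall>x\<in>elts X. x \<notin> elts F \<longrightarrow> ap h (adjoin x F) = ap h F +\<^sub>R modsq (ap \<eta> x))"

text \<open>
  The approximations from which the sum function is built by recursion on finite sets: the sums over
  all subsets of one finite set \<open>G\<close>.
\<close>

definition is_sumfun_on :: "'a \<Rightarrow> 'a \<Rightarrow> 'a \<Rightarrow> bool" where
  "is_sumfun_on \<eta> G h \<longleftrightarrow> func h (power_set G) (Rset S) \<and> ap h empty = 0\<^sub>R \<and>
     (\<forall>F\<in>elts (power_set G). \<forall>x\<in>elts G. x \<notin> elts F \<longrightarrow> ap h (adjoin x F) = ap h F +\<^sub>R modsq (ap \<eta> x))"

text \<open>
  When \<open>x\<close> is adjoined to \<open>G\<close>, the sum over a set \<open>F\<close> that contains \<open>x\<close> is the old sum over \<open>F\<close> without \<open>x\<close>,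
  plus the term of \<open>x\<close>. The recursion equation survives since addition is commutative.
\<close>

lemma is_sumfun_on_exists:
  assumes v: "is_vec \<eta>" and G: "G \<in> elts (Fin X)"
  shows "\<exists>h. is_sumfun_on \<eta> G h"
  using G
proof (induction rule: Fin_induct)
  case definable
  show ?case unfolding is_sumfun_on_def by (intro definable_analysis)
next
  case empty
  obtain h where h: "func h (power_set empty) (Rset S)" "\<And>a. a \<in> elts (power_set empty) \<Longrightarrow> ap h a = 0\<^sub>R"
    by (rule func_exists_term[where A = "power_set empty" and B = "Rset S" and t = "\<lambda>_. 0\<^sub>R"])
       (rule definable_term_const, simp, blast)
  then have "is_sumfun_on \<eta> empty h" unfolding is_sumfun_on_def by simp
  then show ?case by blast
next
  case (adjoin G x)
  then obtain h where h: "func h (power_set G) (Rset S)" "ap h empty = 0\<^sub>R"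
    and rec: "\<And>F y. elts F \<subseteq> elts G \<Longrightarrow> y \<in> elts G \<Longrightarrow> y \<notin> elts F \<Longrightarrow>
      ap h (adjoin y F) = ap h F +\<^sub>R modsq (ap \<eta> y)"
    unfolding is_sumfun_on_def by auto
  have hc: "ap h F \<in> carrier FR" if "elts F \<subseteq> elts G" for F
    using ap_type[OF h(1), of F] that by simp
  have mx: "modsq (ap \<eta> y) \<in> carrier FR" if "y \<in> elts (adjoin x G)" for y
    using that v adjoin(1,2) by auto
  define Q where "Q F r \<longleftrightarrow> (x \<in> elts F \<and> r = ap h (remove x F) +\<^sub>R modsq (ap \<eta> x)) \<or>
    (x \<notin> elts F \<and> r = ap h F)" for F r
  obtain k where k: "func k (power_set (adjoin x G)) (Rset S)"
    and kQ: "\<And>F. F \<in> elts (power_set (adjoin x G)) \<Longrightarrow> Q F (ap k F)"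
  proof (rule func_exists[where A = "power_set (adjoin x G)" and B = "Rset S" and Q = Q])
    show "definable (\<lambda>e. Q (e 0) (e (Suc 0)))" unfolding Q_def by (intro definable_analysis definable_term_remove)
    fix F assume "F \<in> elts (power_set (adjoin x G))"
    then have "elts (remove x F) \<subseteq> elts G" "x \<notin> elts F \<longrightarrow> elts F \<subseteq> elts G" by auto
    then show "\<exists>!r. r \<in> elts (Rset S) \<and> Q F r"
      unfolding Q_def using hc mx by (cases "x \<in> elts F") auto
  qed (rule that)
  have k1: "ap k F = ap h (remove x F) +\<^sub>R modsq (ap \<eta> x)"
    if "elts F \<subseteq> elts (adjoin x G)" "x \<in> elts F" for F
    using kQ[of F] that unfolding Q_def by simp
  have k2: "ap k F = ap h F" if "elts F \<subseteq> elts (adjoin x G)" "x \<notin> elts F" for F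
    using kQ[of F] that unfolding Q_def by simp
  have "is_sumfun_on \<eta> (adjoin x G) k"
    unfolding is_sumfun_on_def
  proof (intro conjI ballI impI)
    show "ap k empty = 0\<^sub>R" using k2[of empty] h(2) by simp
    fix F y assume F: "F \<in> elts (power_set (adjoin x G))" and y: "y \<in> elts (adjoin x G)" "y \<notin> elts F"
    show "ap k (adjoin y F) = ap k F +\<^sub>R modsq (ap \<eta> y)"
    proof (cases "y = x")
      case True
      then have "remove x (adjoin y F) = F" using y by (intro extI) auto
      then show ?thesis using k1[of "adjoin y F"] k2[of F] F y True by simp
    next
      case yx: False
      show ?thesis
      proof (cases "x \<in> elts F")
        case True
        have e: "remove x (adjoin y F) = adjoin y (remove x F)" using yx by (intro extI) auto
        have s: "elts (remove x F) \<subseteq> elts G" using F by auto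
        have "ap k (adjoin y F) = ap h (adjoin y (remove x F)) +\<^sub>R modsq (ap \<eta> x)"
          using k1[of "adjoin y F"] F y True e by simp
        also have "ap h (adjoin y (remove x F)) = ap h (remove x F) +\<^sub>R modsq (ap \<eta> y)"
          using rec[OF s, of y] y yx by simp
        also have "ap h (remove x F) +\<^sub>R modsq (ap \<eta> y) +\<^sub>R modsq (ap \<eta> x) = ap h (remove x F) +\<^sub>R modsq (ap \<eta> x) +\<^sub>R modsq (ap \<eta> y)"
          using hc[OF s] mx[of x] mx[OF y(1)] by (simp add: F.a_ac)
        also have "ap h (remove x F) +\<^sub>R modsq (ap \<eta> x) = ap k F" using k1[of F] F True by simp
        finally show ?thesis .
      next
        case False
        then have "elts F \<subseteq> elts G" using F by auto
        then show ?thesis using k2[of "adjoin y F"] k2[of F] rec[of F y] F y yx False by simp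
      qed
    qed
  qed (rule k)
  then show ?case by blast
qed

lemma is_sumfun_on_unique:
  assumes "is_sumfun_on \<eta> G h" "is_sumfun_on \<eta> G' h'" and F: "F \<in> elts (Fin X)"
    and "elts F \<subseteq> elts G" "elts F \<subseteq> elts G'"
  shows "ap h F = ap h' F"
proof -
  have "elts F \<subseteq> elts G \<and> elts F \<subseteq> elts G' \<longrightarrow> ap h F = ap h' F"
    using F
  proof (induction rule: Fin_induct)
    case definable
    show ?case by (intro definable_analysis)
  qed (use assms(1,2) in \<open>auto simp: is_sumfun_on_def\<close>)
  then show ?thesis using assms by blast
qed

text \<open>
  The approximations agree on common arguments, so they can be glued without a choice among them.
\<close>

lemma is_sumfun_exists:
  assumes v: "is_vec \<eta>"
  shows "\<exists>!h. is_sumfun \<eta> h"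
proof -
  obtain h where h: "func h (Fin X) (Rset S)"
    and hQ: "\<And>F. F \<in> elts (Fin X) \<Longrightarrow> \<exists>k. is_sumfun_on \<eta> F k \<and> ap h F = ap k F"
  proof (rule func_exists[where A = "Fin X" and B = "Rset S" and
        Q = "\<lambda>F r. \<exists>k. is_sumfun_on \<eta> F k \<and> r = ap k F"])
    show "definable (\<lambda>e. \<exists>k. is_sumfun_on \<eta> (e 0) k \<and> e (Suc 0) = ap k (e 0))"
      unfolding is_sumfun_on_def by (intro definable_analysis)
    fix F assume F: "F \<in> elts (Fin X)"
    obtain k where k: "is_sumfun_on \<eta> F k" using is_sumfun_on_exists[OF v F] by blast
    have "func k (power_set F) (Rset S)" using k unfolding is_sumfun_on_def by blast
    then have t: "ap k F \<in> elts (Rset S)" by (rule ap_type) simp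
    show "\<exists>!r. r \<in> elts (Rset S) \<and> (\<exists>k. is_sumfun_on \<eta> F k \<and> r = ap k F)"
    proof (rule ex1I[of _ "ap k F"])
      fix r assume "r \<in> elts (Rset S) \<and> (\<exists>k. is_sumfun_on \<eta> F k \<and> r = ap k F)"
      then obtain k' where "is_sumfun_on \<eta> F k'" "r = ap k' F" by blast
      then show "r = ap k F" using is_sumfun_on_unique[OF _ k F] by simp
    qed (use k t in blast)
  qed (rule that)
  have hk: "ap h F = ap k F" if k: "is_sumfun_on \<eta> G k" and FX: "F \<in> elts (Fin X)" and FG: "elts F \<subseteq> elts G" for F G k
  proof -
    obtain k' where "is_sumfun_on \<eta> F k'" "ap h F = ap k' F" using hQ[OF FX] by blast
    then show ?thesis using is_sumfun_on_unique[OF _ k FX] FG by simp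
  qed
  have hs: "is_sumfun \<eta> h"
    unfolding is_sumfun_def
  proof (intro conjI ballI impI)
    have e: "empty \<in> elts (Fin X)" using finite_empty by simp
    obtain k where k: "is_sumfun_on \<eta> empty k" using is_sumfun_on_exists[OF v e] by blast
    then show "ap h empty = 0\<^sub>R" using hk[OF k e] by (simp add: is_sumfun_on_def)
    fix F x assume F: "F \<in> elts (Fin X)" and x: "x \<in> elts X" "x \<notin> elts F"
    have Fx: "adjoin x F \<in> elts (Fin X)" using F x finite_adjoin by simp
    obtain k where k: "is_sumfun_on \<eta> (adjoin x F) k" using is_sumfun_on_exists[OF v Fx] by blast
    have "ap k (adjoin x F) = ap k F +\<^sub>R modsq (ap \<eta> x)"
      using k x unfolding is_sumfun_on_def by auto
    then show "ap h (adjoin x F) = ap h F +\<^sub>R modsq (ap \<eta> x)"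
      using hk[OF k Fx] hk[OF k F] subset_insertI[of "elts F" x] by simp
  qed (rule h)
  have "k = h" if k: "is_sumfun \<eta> k" for k
  proof (rule func_ext)
    show "func k (Fin X) (Rset S)" using k unfolding is_sumfun_def by blast
    fix F assume "F \<in> elts (Fin X)"
    then show "ap k F = ap h F"
    proof (induction rule: Fin_induct)
      case definable
      show ?case by (intro definable_analysis)
    qed (use k hs in \<open>auto simp: is_sumfun_def\<close>)
  qed (rule h)
  with hs show ?thesis by blast
qed

definition sumfun :: "'a \<Rightarrow> 'a" where "sumfun \<eta> = (THE h. is_sumfun \<eta> h)"

abbreviation psum :: "'a \<Rightarrow> 'a \<Rightarrow> 'a" where "psum \<eta> F \<equiv> ap (sumfun \<eta>) F"

lemma is_sumfun_sumfun: "is_vec \<eta> \<Longrightarrow> is_sumfun \<eta> (sumfun \<eta>)"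
  unfolding sumfun_def by (rule theI', rule is_sumfun_exists)

lemma is_sumfun_iff: "is_vec \<eta> \<Longrightarrow> is_sumfun \<eta> h \<longleftrightarrow> h = sumfun \<eta>"
  using is_sumfun_exists is_sumfun_sumfun by blast

lemma finsums_eq:
  assumes v: "is_vec \<eta>"
  shows "finsums S X (\<lambda>x. cmod2 S (app \<eta> x)) = sumfun \<eta>"
proof -
  have "func h (Fin X) (Rset S) \<and> app h empty = Rzero S \<and>
     (\<forall>F\<in>elts (Fin X). \<forall>x\<in>elts X - elts F.
        app h (adjoin x F) = radd S (app h F) (cmod2 S (app \<eta> x))) \<longleftrightarrow> is_sumfun \<eta> h" for h
  proof (cases "func h (Fin X) (Rset S)")
    case True
    have a: "app h F = ap h F" "ap h F \<in> carrier FR" if "F \<in> elts (Fin X)" for F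
      using app_eq_ap[OF True that] ap_type[OF True that] by simp_all
    have m: "cmod2 S (app \<eta> x) = modsq (ap \<eta> x)" if "x \<in> elts X" for x
      using app_eq_ap[OF v that] cmod2_eq v that by simp
    have "adjoin x F \<in> elts (Fin X)" if "x \<in> elts X" "F \<in> elts (Fin X)" for x F
      using that finite_adjoin by simp
    moreover have "empty \<in> elts (Fin X)" using finite_empty by simp
    ultimately show ?thesis
      unfolding is_sumfun_def using True a m v by (simp del: elts_Fin add: Ball_def) blast
  qed (simp add: is_sumfun_def)
  then show ?thesis unfolding finsums_def sumfun_def by simp
qed

lemma psum_type [simp]: "is_vec \<eta> \<Longrightarrow> F \<in> elts (Fin X) \<Longrightarrow> psum \<eta> F \<in> carrier FR"
  using is_sumfun_sumfun[of \<eta>] ap_type[of "sumfun \<eta>" "Fin X" "Rset S" F] unfolding is_sumfun_def by simp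

lemma psum_empty: "is_vec \<eta> \<Longrightarrow> psum \<eta> empty = 0\<^sub>R"
  using is_sumfun_sumfun unfolding is_sumfun_def by blast

lemma psum_adjoin: "is_vec \<eta> \<Longrightarrow> F \<in> elts (Fin X) \<Longrightarrow> x \<in> elts X \<Longrightarrow> x \<notin> elts F \<Longrightarrow>
    psum \<eta> (adjoin x F) = psum \<eta> F +\<^sub>R modsq (ap \<eta> x)"
  using is_sumfun_sumfun unfolding is_sumfun_def by blast

lemma empty_Fin: "empty \<in> elts (Fin X)"
  using finite_empty by simp

text \<open>
  A single comparison serves all closure properties of \<open>l\<^sup>2(X)\<close>: sums and differences with \<open>a = 2\<close>,
  multiples by \<open>c\<close> with \<open>a = |c|\<^sup>2\<close>, and the zero function with \<open>a = 0\<close>.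
\<close>

lemma psum_comparison:
  assumes v: "is_vec \<xi>" "is_vec \<eta>" "is_vec \<zeta>" and a: "a \<in> carrier FR"
    and le: "\<And>x. x \<in> elts X \<Longrightarrow> modsq (ap \<xi> x) \<preceq> a *\<^sub>R (modsq (ap \<eta> x) +\<^sub>R modsq (ap \<zeta> x))"
    and F: "F \<in> elts (Fin X)"
  shows "psum \<xi> F \<preceq> a *\<^sub>R (psum \<eta> F +\<^sub>R psum \<zeta> F)"
  using F
proof (induction rule: Fin_induct)
  case definable
  show ?case by (intro definable_analysis)
next
  case empty
  show ?case using psum_empty v a F.le_refl by simp
next
  case (adjoin F x)
  have c: "modsq (ap \<xi> x) \<in> carrier FR" "modsq (ap \<eta> x) \<in> carrier FR" "modsq (ap \<zeta> x) \<in> carrier FR"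
    "psum \<xi> F \<in> carrier FR" "psum \<eta> F \<in> carrier FR" "psum \<zeta> F \<in> carrier FR"
    using v adjoin by (auto simp del: elts_Fin)
  have "psum \<xi> F +\<^sub>R modsq (ap \<xi> x) \<preceq> a *\<^sub>R (psum \<eta> F +\<^sub>R psum \<zeta> F) +\<^sub>R a *\<^sub>R (modsq (ap \<eta> x) +\<^sub>R modsq (ap \<zeta> x))"
    using c a adjoin(4) le[OF adjoin(2)] by (intro F.add_mono) auto
  also have "a *\<^sub>R (psum \<eta> F +\<^sub>R psum \<zeta> F) +\<^sub>R a *\<^sub>R (modsq (ap \<eta> x) +\<^sub>R modsq (ap \<zeta> x))
     = a *\<^sub>R ((psum \<eta> F +\<^sub>R modsq (ap \<eta> x)) +\<^sub>R (psum \<zeta> F +\<^sub>R modsq (ap \<zeta> x)))"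
    using c a by algebra
  finally show ?case using psum_adjoin v adjoin by simp
qed

lemma elts_partial_sums:
  assumes v: "is_vec \<eta>"
  shows "elts (partial_sums S X \<eta>) = {psum \<eta> F |F. F \<in> elts (Fin X)}"
proof -
  have "func (sumfun \<eta>) (Fin X) (Rset S)" using is_sumfun_sumfun[OF v] unfolding is_sumfun_def by blast
  then show ?thesis unfolding partial_sums_def finsums_eq[OF v] by (rule elts_image) simp
qed

text \<open>
  For \<open>\<eta>\<close> in \<open>l\<^sup>2(X)\<close> this says that the squared norm is at most \<open>b\<close>. Quantifying over the sum function
  instead of naming it keeps the notion definable.
\<close>

definition sums_le :: "'a \<Rightarrow> 'a \<Rightarrow> bool" where
  "sums_le \<eta> b \<longleftrightarrow> (\<forall>h. is_sumfun \<eta> h \<longrightarrow> (\<forall>F\<in>elts (Fin X). ap h F \<preceq> b))"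

lemma sums_le_iff: "is_vec \<eta> \<Longrightarrow> sums_le \<eta> b \<longleftrightarrow> (\<forall>F\<in>elts (Fin X). psum \<eta> F \<preceq> b)"
  unfolding sums_le_def using is_sumfun_iff by simp

lemma definable_sums_le:
  "definable_term t \<Longrightarrow> definable_term u \<Longrightarrow> definable (\<lambda>e. sums_le (t e) (u e))"
proof (rule definable_subst2[where K = sums_le])
  show "definable (\<lambda>e. sums_le (e 0) (e (Suc 0)))" unfolding sums_le_def is_sumfun_def by (intro definable_analysis)
qed

lemma elts_l2: "elts (l2 S X) = {\<eta>. is_vec \<eta> \<and> (\<exists>b\<in>carrier FR. sums_le \<eta> b)}"
proof -
  have "(is_vec \<eta> \<and> (\<exists>b\<in>elts (Rset S). \<forall>a\<in>elts (partial_sums S X \<eta>). rle S a b)) \<longleftrightarrow>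
    (is_vec \<eta> \<and> (\<exists>b\<in>carrier FR. sums_le \<eta> b))" for \<eta>
  proof (cases "is_vec \<eta>")
    case True
    have "(\<forall>a\<in>elts (partial_sums S X \<eta>). a \<preceq> b) \<longleftrightarrow> sums_le \<eta> b" for b
      unfolding elts_partial_sums[OF True] sums_le_iff[OF True] by blast
    then show ?thesis by simp
  qed simp
  then show ?thesis
    unfolding l2_def
  proof (simp, intro elts_Collect)
    show "definable (\<lambda>e. is_vec (e 0) \<and> (\<exists>b\<in>carrier FR. sums_le (e 0) b))"
      by (intro definable_analysis definable_sums_le)
    fix \<eta> assume "is_vec \<eta> \<and> (\<exists>b\<in>carrier FR. sums_le \<eta> b)"
    then show "\<eta> \<in> elts (power_set (cart X (Cset S)))" unfolding func_def by simp
  qed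
qed

abbreviation L :: "'a set" where "L \<equiv> elts (l2 S X)"

lemma L_vec: "\<eta> \<in> L \<Longrightarrow> is_vec \<eta>"
  by (simp add: elts_l2)

lemma L_comparison:
  assumes v: "is_vec \<xi>" "\<eta> \<in> L" "\<zeta> \<in> L" and a: "a \<in> carrier FR" "0\<^sub>R \<preceq> a"
    and le: "\<And>x. x \<in> elts X \<Longrightarrow> modsq (ap \<xi> x) \<preceq> a *\<^sub>R (modsq (ap \<eta> x) +\<^sub>R modsq (ap \<zeta> x))"
  shows "\<xi> \<in> L"
proof -
  obtain b c where b: "b \<in> carrier FR" "sums_le \<eta> b" and c: "c \<in> carrier FR" "sums_le \<zeta> c"
    using v by (auto simp: elts_l2)
  have vv: "is_vec \<eta>" "is_vec \<zeta>" using v L_vec by auto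
  have "psum \<xi> F \<preceq> a *\<^sub>R (b +\<^sub>R c)" if F: "F \<in> elts (Fin X)" for F
  proof -
    have s: "psum \<xi> F \<preceq> a *\<^sub>R (psum \<eta> F +\<^sub>R psum \<zeta> F)" using psum_comparison v vv a le F by simp
    have t: "psum \<xi> F \<in> carrier FR" "psum \<eta> F \<in> carrier FR" "psum \<zeta> F \<in> carrier FR"
      using v vv F by (simp_all del: elts_Fin)
    have "psum \<eta> F +\<^sub>R psum \<zeta> F \<preceq> b +\<^sub>R c"
      using b c vv F t by (intro F.add_mono) (auto simp: sums_le_iff)
    then have "a *\<^sub>R (psum \<eta> F +\<^sub>R psum \<zeta> F) \<preceq> a *\<^sub>R (b +\<^sub>R c)"
      using t a b c by (intro F.mult_mono_left) auto
    then show ?thesis using s t a b c F.le_trans[of "psum \<xi> F" "a *\<^sub>R (psum \<eta> F +\<^sub>R psum \<zeta> F)"] by simp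
  qed
  then have "sums_le \<xi> (a *\<^sub>R (b +\<^sub>R c))" using v by (simp add: sums_le_iff)
  then show ?thesis using v a b c by (auto simp: elts_l2)
qed

section \<open>The norm\<close>

lemma normsq_lub:
  assumes "\<eta> \<in> L"
  shows "normsq S X \<eta> \<in> carrier FR"
    and "\<And>F. F \<in> elts (Fin X) \<Longrightarrow> psum \<eta> F \<preceq> normsq S X \<eta>"
    and "\<And>b. b \<in> carrier FR \<Longrightarrow> sums_le \<eta> b \<Longrightarrow> normsq S X \<eta> \<preceq> b"
proof -
  have v: "is_vec \<eta>" using assms L_vec by blast
  obtain b where b: "b \<in> carrier FR" "sums_le \<eta> b" using assms by (auto simp: elts_l2)
  let ?A = "partial_sums S X \<eta>"
  have A: "elts ?A = {psum \<eta> F |F. F \<in> elts (Fin X)}" by (rule elts_partial_sums[OF v])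
  have bnd: "(\<forall>a\<in>elts ?A. a \<preceq> c) \<longleftrightarrow> sums_le \<eta> c" for c
    unfolding A sums_le_iff[OF v] by blast
  have "elts ?A \<subseteq> elts (Rset S)" unfolding A Rset_carrier using psum_type[OF v] by blast
  moreover have "elts ?A \<noteq> {}" unfolding A using empty_Fin by blast
  moreover have "\<exists>b\<in>elts (Rset S). \<forall>a\<in>elts ?A. rle S a b" using b bnd by auto
  ultimately obtain s where s: "is_lub S ?A s"
    using complete unfolding complete_ordered_field_def by blast
  have u: "is_lub S ?A r \<Longrightarrow> r = s" for r
    using s F.le_antisym[of r s] unfolding is_lub_def by simp
  have "normsq S X \<eta> = s" unfolding normsq_def using s u by (rule the_equality)
  then have "is_lub S ?A (normsq S X \<eta>)" using s by simp
  then have n: "normsq S X \<eta> \<in> carrier FR" "sums_le \<eta> (normsq S X \<eta>)"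
    "\<And>b. b \<in> carrier FR \<Longrightarrow> sums_le \<eta> b \<Longrightarrow> normsq S X \<eta> \<preceq> b"
    unfolding is_lub_def bnd by simp_all
  show "normsq S X \<eta> \<in> carrier FR" by (rule n)
  show "psum \<eta> F \<preceq> normsq S X \<eta>" if "F \<in> elts (Fin X)" for F
    using n(2) that unfolding sums_le_iff[OF v] by blast
  show "normsq S X \<eta> \<preceq> b" if "b \<in> carrier FR" "sums_le \<eta> b" for b
    using n(3) that by blast
qed

lemma sums_le_nonneg: "\<eta> \<in> L \<Longrightarrow> sums_le \<eta> b \<Longrightarrow> 0\<^sub>R \<preceq> b"
  using sums_le_iff[of \<eta> b] psum_empty[of \<eta>] empty_Fin L_vec by metis

lemma normsq_nonneg: "\<eta> \<in> L \<Longrightarrow> 0\<^sub>R \<preceq> normsq S X \<eta>"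
  using normsq_lub(2)[OF _ empty_Fin] psum_empty L_vec by metis

lemma square_root_exists:
  assumes a: "a \<in> carrier FR" "0\<^sub>R \<preceq> a"
  shows "\<exists>s. s \<in> carrier FR \<and> 0\<^sub>R \<preceq> s \<and> s *\<^sub>R s = a"
proof -
  have "definable (\<lambda>e. 0\<^sub>R \<preceq> e 0 \<and> e 0 *\<^sub>R e 0 \<preceq> a)" by (intro definable_analysis)
  then obtain A where A: "elts A = {r \<in> elts (Rset S). 0\<^sub>R \<preceq> r \<and> r *\<^sub>R r \<preceq> a}"
    using definable_separation[of "\<lambda>r. 0\<^sub>R \<preceq> r \<and> r *\<^sub>R r \<preceq> a"] by blast
  have ub: "r \<preceq> 1\<^sub>R +\<^sub>R a" if r: "r \<in> carrier FR" "0\<^sub>R \<preceq> r" "r *\<^sub>R r \<preceq> a" for r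
    using F.sq_le_imp_le[of r "1\<^sub>R +\<^sub>R a"] F.le_trans[OF _ _ _ r(3) F.le_one_add_square[OF a]]
      F.one_add_pos[OF a] r a by simp
  have "0\<^sub>R \<in> elts A" using a F.le_refl by (simp add: A)
  then have "elts A \<noteq> {}" by blast
  moreover have "elts A \<subseteq> elts (Rset S)" by (auto simp: A)
  moreover have "\<exists>b\<in>elts (Rset S). \<forall>r\<in>elts A. rle S r b"
    by (rule bexI[of _ "1\<^sub>R +\<^sub>R a"]) (use ub a in \<open>auto simp: A\<close>)
  ultimately obtain s where "is_lub S A s"
    using complete unfolding complete_ordered_field_def by blast
  then have s: "s \<in> carrier FR"
    and u: "\<And>r. r \<in> carrier FR \<Longrightarrow> 0\<^sub>R \<preceq> r \<Longrightarrow> r *\<^sub>R r \<preceq> a \<Longrightarrow> r \<preceq> s"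
    and l: "\<And>b. b \<in> carrier FR \<Longrightarrow>
      (\<And>r. r \<in> carrier FR \<Longrightarrow> 0\<^sub>R \<preceq> r \<Longrightarrow> r *\<^sub>R r \<preceq> a \<Longrightarrow> r \<preceq> b) \<Longrightarrow> s \<preceq> b"
    unfolding is_lub_def by (simp_all add: A)
  show ?thesis using F.square_root_supremum[OF a s u l] s by blast
qed

lemma l2norm_props:
  assumes "\<eta> \<in> L"
  shows "l2norm S X \<eta> \<in> carrier FR" "0\<^sub>R \<preceq> l2norm S X \<eta>"
    "l2norm S X \<eta> *\<^sub>R l2norm S X \<eta> = normsq S X \<eta>"
proof -
  obtain s where s: "s \<in> carrier FR" "0\<^sub>R \<preceq> s" "s *\<^sub>R s = normsq S X \<eta>"
    using square_root_exists normsq_lub(1) normsq_nonneg assms by blast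
  have "l2norm S X \<eta> = s"
    unfolding l2norm_def
  proof (rule the_equality)
    fix r assume "r \<in> elts (Rset S) \<and> rle S (Rzero S) r \<and> rmul S r r = normsq S X \<eta>"
    then have "r \<in> carrier FR" "0\<^sub>R \<preceq> r" "r *\<^sub>R r = s *\<^sub>R s" using s by auto
    then show "r = s" using F.sqrt_unique s by blast
  qed (use s in simp)
  then show "l2norm S X \<eta> \<in> carrier FR" "0\<^sub>R \<preceq> l2norm S X \<eta>"
    "l2norm S X \<eta> *\<^sub>R l2norm S X \<eta> = normsq S X \<eta>"
    using s by simp_all
qed

lemma l2norm_bound:
  assumes "\<eta> \<in> L" "b \<in> carrier FR" "sums_le \<eta> b"
  shows "l2norm S X \<eta> \<preceq> 1\<^sub>R +\<^sub>R b"
proof -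
  note n = l2norm_props[OF assms(1)]
  have b: "0\<^sub>R \<preceq> b" using sums_le_nonneg assms by blast
  have "normsq S X \<eta> \<preceq> b" using normsq_lub(3) assms by blast
  then have "l2norm S X \<eta> *\<^sub>R l2norm S X \<eta> \<preceq> (1\<^sub>R +\<^sub>R b) *\<^sub>R (1\<^sub>R +\<^sub>R b)"
    using n F.le_trans[OF _ _ _ _ F.le_one_add_square[OF assms(2) b]] assms normsq_lub(1) by simp
  then show ?thesis using F.sq_le_imp_le n F.one_add_pos[OF assms(2) b] assms by simp
qed

lemma singleton_sum:
  assumes v: "is_vec \<eta>" and x: "x \<in> elts X"
  shows "adjoin x empty \<in> elts (Fin X)" "psum \<eta> (adjoin x empty) = modsq (ap \<eta> x)"
proof -
  show "adjoin x empty \<in> elts (Fin X)" using x finite_adjoin[OF finite_empty] by simp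
  show "psum \<eta> (adjoin x empty) = modsq (ap \<eta> x)"
    using psum_adjoin[OF v empty_Fin x] psum_empty[OF v] v x by simp
qed

lemma value_bound:
  assumes xi: "\<xi> \<in> L" and e: "e \<in> carrier FR" "0\<^sub>R \<preceq> e" and lt: "rless S (l2norm S X \<xi>) e"
    and x: "x \<in> elts X"
  shows "modsq (ap \<xi> x) \<preceq> e *\<^sub>R e"
proof -
  note n = l2norm_props[OF xi] and v = L_vec[OF xi]
  have le: "l2norm S X \<xi> \<preceq> e" using lt unfolding rless_def by blast
  have "l2norm S X \<xi> *\<^sub>R l2norm S X \<xi> \<preceq> l2norm S X \<xi> *\<^sub>R e"
    using n e le by (intro F.mult_mono_left)
  moreover have "e *\<^sub>R l2norm S X \<xi> \<preceq> e *\<^sub>R e" using n e le by (intro F.mult_mono_left)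
  ultimately have "normsq S X \<xi> \<preceq> e *\<^sub>R e"
    using n e F.le_trans[of "normsq S X \<xi>" "e *\<^sub>R l2norm S X \<xi>" "e *\<^sub>R e"] normsq_lub(1)[OF xi]
    by (simp add: F.m_comm)
  moreover have "modsq (ap \<xi> x) \<preceq> normsq S X \<xi>"
    using normsq_lub(2)[OF xi] singleton_sum[OF v x] by metis
  ultimately show ?thesis
    using F.le_trans[of "modsq (ap \<xi> x)" "normsq S X \<xi>"] normsq_lub(1)[OF xi] v x e by simp
qed

text \<open>
  Some finite sum exceeds the squared norm minus \<open>d\<close>, so no further term can exceed \<open>d\<close>.
\<close>

lemma tail_small:
  assumes z: "\<zeta> \<in> L" and d: "d \<in> carrier FR" "0\<^sub>R \<preceq> d" "d \<noteq> 0\<^sub>R"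
  shows "\<exists>F\<in>elts (Fin X). \<forall>x\<in>elts X. x \<notin> elts F \<longrightarrow> modsq (ap \<zeta> x) \<preceq> d"
proof -
  note v = L_vec[OF z] and n = normsq_lub(1,2)[OF z]
  let ?s = "normsq S X \<zeta>"
  have "\<not> sums_le \<zeta> (?s \<ominus>\<^bsub>FR\<^esub> d)"
  proof
    assume "sums_le \<zeta> (?s \<ominus>\<^bsub>FR\<^esub> d)"
    then have "?s \<preceq> ?s \<ominus>\<^bsub>FR\<^esub> d" using normsq_lub(3)[OF z] n d by simp
    then have "0\<^sub>R \<preceq> ?s \<ominus>\<^bsub>FR\<^esub> d \<ominus>\<^bsub>FR\<^esub> ?s" using F.le_iff_diff n(1) d by simp
    moreover have "?s \<ominus>\<^bsub>FR\<^esub> d \<ominus>\<^bsub>FR\<^esub> ?s = 0\<^sub>R \<ominus>\<^bsub>FR\<^esub> d"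
      using n(1) d(1) by (simp add: F.minus_eq F.a_assoc F.a_comm[of "\<ominus>\<^bsub>FR\<^esub> d"] F.r_neg2)
    ultimately have "d \<preceq> 0\<^sub>R" using F.le_iff_diff[of d "0\<^sub>R"] d by simp
    then show False using d F.le_antisym by simp
  qed
  then obtain F where F: "F \<in> elts (Fin X)" "\<not> psum \<zeta> F \<preceq> ?s \<ominus>\<^bsub>FR\<^esub> d"
    unfolding sums_le_iff[OF v] by blast
  have "modsq (ap \<zeta> x) \<preceq> d" if x: "x \<in> elts X" "x \<notin> elts F" for x
  proof (rule ccontr)
    assume "\<not> modsq (ap \<zeta> x) \<preceq> d"
    then have "d \<preceq> modsq (ap \<zeta> x)" using F.le_total[of d "modsq (ap \<zeta> x)"] d x v by auto
    then have "psum \<zeta> F +\<^sub>R d \<preceq> psum \<zeta> F +\<^sub>R modsq (ap \<zeta> x)"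
      using psum_type[OF v F(1)] d x v F.le_refl by (intro F.add_mono) auto
    also have "psum \<zeta> F +\<^sub>R modsq (ap \<zeta> x) = psum \<zeta> (adjoin x F)" using psum_adjoin[OF v F(1) x] by simp
    finally have "psum \<zeta> F +\<^sub>R d \<preceq> psum \<zeta> (adjoin x F)" .
    moreover have Fx: "adjoin x F \<in> elts (Fin X)" using F(1) x finite_adjoin by simp
    ultimately have "psum \<zeta> F +\<^sub>R d \<preceq> ?s"
      using F.le_trans[OF _ _ _ _ n(2)[OF Fx]] psum_type[OF v F(1)] psum_type[OF v Fx] d n(1) by simp
    then have "0\<^sub>R \<preceq> ?s \<ominus>\<^bsub>FR\<^esub> (psum \<zeta> F +\<^sub>R d)"
      using F.le_iff_diff psum_type[OF v F(1)] d n(1) by simp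
    moreover have "?s \<ominus>\<^bsub>FR\<^esub> (psum \<zeta> F +\<^sub>R d) = ?s \<ominus>\<^bsub>FR\<^esub> d \<ominus>\<^bsub>FR\<^esub> psum \<zeta> F"
      using psum_type[OF v F(1)] d(1) n(1) by algebra
    ultimately have "psum \<zeta> F \<preceq> ?s \<ominus>\<^bsub>FR\<^esub> d"
      using F.le_iff_diff psum_type[OF v F(1)] d n(1) by simp
    then show False using F(2) by blast
  qed
  then show ?thesis using F(1) by blast
qed

lemma tails_small:
  assumes "finite_set N" and sub: "elts N \<subseteq> L" and d: "d \<in> carrier FR" "0\<^sub>R \<preceq> d" "d \<noteq> 0\<^sub>R"
  shows "\<exists>F\<in>elts (Fin X). \<forall>\<zeta>\<in>elts N. \<forall>x\<in>elts X. x \<notin> elts F \<longrightarrow> modsq (ap \<zeta> x) \<preceq> d"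
proof -
  have "elts N \<subseteq> L \<longrightarrow>
    (\<exists>F\<in>elts (Fin X). \<forall>\<zeta>\<in>elts N. \<forall>x\<in>elts X. x \<notin> elts F \<longrightarrow> modsq (ap \<zeta> x) \<preceq> d)"
    using assms(1)
  proof (induction rule: finite_set_induct)
    case definable
    show ?case by (intro definable_analysis)
  next
    case empty
    show ?case using empty_Fin by (simp del: elts_Fin) blast
  next
    case (adjoin N \<zeta>)
    show ?case
    proof
      assume s: "elts (adjoin \<zeta> N) \<subseteq> L"
      then obtain F where F: "F \<in> elts (Fin X)"
        "\<forall>\<xi>\<in>elts N. \<forall>x\<in>elts X. x \<notin> elts F \<longrightarrow> modsq (ap \<xi> x) \<preceq> d"
        using adjoin(3) by auto
      obtain G where G: "G \<in> elts (Fin X)" "\<forall>x\<in>elts X. x \<notin> elts G \<longrightarrow> modsq (ap \<zeta> x) \<preceq> d"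
        using tail_small[OF _ d, of \<zeta>] s by auto
      have "pair_union F G \<in> elts (Fin X)" using F(1) G(1) finite_pair_union by simp
      then show "\<exists>F\<in>elts (Fin X). \<forall>\<xi>\<in>elts (adjoin \<zeta> N). \<forall>x\<in>elts X. x \<notin> elts F \<longrightarrow> modsq (ap \<xi> x) \<preceq> d"
        by (rule bexI[rotated]) (use F(2) G(2) in simp)
    qed
  qed
  then show ?thesis using sub by blast
qed

section \<open>Vector operations and subspaces\<close>

lemma lam_vec:
  assumes "definable_term (\<lambda>e. t (e 0))" "\<And>x. x \<in> elts X \<Longrightarrow> t x \<in> CC" "\<And>x. x \<in> elts X \<Longrightarrow> u x = t x"
  shows "is_vec (lam X u)" "\<And>x. x \<in> elts X \<Longrightarrow> ap (lam X u) x = t x"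
proof -
  obtain f where f: "is_vec f" "\<And>x. x \<in> elts X \<Longrightarrow> ap f x = t x"
    by (rule func_exists_term[OF assms(1,2)]) blast+
  then have "lam X u = f" using assms(3) by (intro lam_eq) auto
  then show "is_vec (lam X u)" "\<And>x. x \<in> elts X \<Longrightarrow> ap (lam X u) x = t x" using f by auto
qed

lemma vadd_vec:
  assumes "is_vec \<eta>" "is_vec \<zeta>"
  shows "is_vec (vadd S X \<eta> \<zeta>)" "\<And>x. x \<in> elts X \<Longrightarrow> ap (vadd S X \<eta> \<zeta>) x = cplus (ap \<eta> x) (ap \<zeta> x)"
proof -
  have "definable_term (\<lambda>e. cplus (ap \<eta> (e 0)) (ap \<zeta> (e 0)))" by (intro definable_analysis)
  note * = lam_vec[where t = "\<lambda>x. cplus (ap \<eta> x) (ap \<zeta> x)", OF this]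
  show "is_vec (vadd S X \<eta> \<zeta>)" "\<And>x. x \<in> elts X \<Longrightarrow> ap (vadd S X \<eta> \<zeta>) x = cplus (ap \<eta> x) (ap \<zeta> x)"
    unfolding vadd_def using assms
    by (auto intro!: * simp: cadd_eq app_eq_ap[OF assms(1)] app_eq_ap[OF assms(2)])
qed

lemma vscale_vec:
  assumes "is_vec \<eta>" "c \<in> CC"
  shows "is_vec (vscale S X c \<eta>)" "\<And>x. x \<in> elts X \<Longrightarrow> ap (vscale S X c \<eta>) x = ctimes c (ap \<eta> x)"
proof -
  have "definable_term (\<lambda>e. ctimes c (ap \<eta> (e 0)))" by (intro definable_analysis)
  note * = lam_vec[where t = "\<lambda>x. ctimes c (ap \<eta> x)", OF this]
  show "is_vec (vscale S X c \<eta>)" "\<And>x. x \<in> elts X \<Longrightarrow> ap (vscale S X c \<eta>) x = ctimes c (ap \<eta> x)"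
    unfolding vscale_def using assms
    by (auto intro!: * simp: cmul_eq app_eq_ap[OF assms(1)])
qed

lemma vdiff_vec:
  assumes "is_vec \<eta>" "is_vec \<zeta>"
  shows "is_vec (vdiff S X \<eta> \<zeta>)"
    "\<And>x. x \<in> elts X \<Longrightarrow> ap (vdiff S X \<eta> \<zeta>) x = cplus (ap \<eta> x) (ctimes cminus1 (ap \<zeta> x))"
proof -
  have "definable_term (\<lambda>e. cplus (ap \<eta> (e 0)) (ctimes cminus1 (ap \<zeta> (e 0))))" by (intro definable_analysis)
  note * = lam_vec[where t = "\<lambda>x. cplus (ap \<eta> x) (ctimes cminus1 (ap \<zeta> x))", OF this]
  show "is_vec (vdiff S X \<eta> \<zeta>)"
    "\<And>x. x \<in> elts X \<Longrightarrow> ap (vdiff S X \<eta> \<zeta>) x = cplus (ap \<eta> x) (ctimes cminus1 (ap \<zeta> x))"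
    unfolding vdiff_def using assms
    by (auto intro!: * simp: cadd_eq cneg_eq app_eq_ap[OF assms(1)] app_eq_ap[OF assms(2)])
qed

lemma vzero_vec: "is_vec (vzero S X)" "\<And>x. x \<in> elts X \<Longrightarrow> ap (vzero S X) x = czero S"
  unfolding vzero_def using lam_vec[where t = "\<lambda>_. czero S", OF definable_term_const] by simp_all

lemma two_nonneg: "1\<^sub>R +\<^sub>R 1\<^sub>R \<in> carrier FR" "0\<^sub>R \<preceq> 1\<^sub>R +\<^sub>R 1\<^sub>R"
  using F.nonneg_add F.nonneg_one by simp_all

lemma vadd_L: "\<eta> \<in> L \<Longrightarrow> \<zeta> \<in> L \<Longrightarrow> vadd S X \<eta> \<zeta> \<in> L"
  using L_comparison[of "vadd S X \<eta> \<zeta>" \<eta> \<zeta> "1\<^sub>R +\<^sub>R 1\<^sub>R"] vadd_vec[of \<eta> \<zeta>] L_vec two_nonneg modsq_cplus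
  by simp

lemma vscale_L:
  assumes c: "c \<in> CC" and eta: "\<eta> \<in> L"
  shows "vscale S X c \<eta> \<in> L"
proof (rule L_comparison[of _ \<eta> \<eta> "modsq c"])
  note v = L_vec[OF eta]
  fix x assume x: "x \<in> elts X"
  have "modsq (ap \<eta> x) \<preceq> modsq (ap \<eta> x) +\<^sub>R modsq (ap \<eta> x)"
    using v x modsq_nonneg by (intro F.le_add_nonneg) auto
  then have "modsq c *\<^sub>R modsq (ap \<eta> x) \<preceq> modsq c *\<^sub>R (modsq (ap \<eta> x) +\<^sub>R modsq (ap \<eta> x))"
    using v x c modsq_nonneg by (intro F.mult_mono_left) auto
  then show "modsq (ap (vscale S X c \<eta>) x) \<preceq> modsq c *\<^sub>R (modsq (ap \<eta> x) +\<^sub>R modsq (ap \<eta> x))"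
    using vscale_vec[OF v c] v x c modsq_ctimes by simp
qed (use vscale_vec L_vec eta c modsq_nonneg in auto)

lemma modsq_difference:
  assumes "w \<in> CC" "u \<in> CC"
  shows "modsq (cplus w (ctimes cminus1 u)) \<preceq> (1\<^sub>R +\<^sub>R 1\<^sub>R) *\<^sub>R (modsq w +\<^sub>R modsq u)"
  using modsq_cplus[of w "ctimes cminus1 u"] modsq_ctimes[of cminus1 u] modsq_cminus1 assms by simp

lemma vdiff_L: "\<eta> \<in> L \<Longrightarrow> \<zeta> \<in> L \<Longrightarrow> vdiff S X \<eta> \<zeta> \<in> L"
  using L_comparison[of "vdiff S X \<eta> \<zeta>" \<eta> \<zeta> "1\<^sub>R +\<^sub>R 1\<^sub>R"] vdiff_vec[of \<eta> \<zeta>] L_vec two_nonneg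
    modsq_difference
  by simp

lemma vzero_L: "vzero S X \<in> L"
proof -
  note v = vzero_vec(1)
  have "psum (vzero S X) F \<preceq> 0\<^sub>R" if F: "F \<in> elts (Fin X)" for F
    using psum_comparison[OF v v v, of "0\<^sub>R" F] F vzero_vec(2) modsq_czero F.le_refl[of "0\<^sub>R"] psum_type[OF v F]
    by simp
  then have "sums_le (vzero S X) 0\<^sub>R" unfolding sums_le_iff[OF v] by blast
  then show ?thesis using v by (auto simp: elts_l2)
qed

text \<open>
  Sums and multiples of vectors are characterised by their values. This avoids the terms \<open>vadd\<close> and
  \<open>vscale\<close>, and makes the notion of a subspace definable.
\<close>

lemma subspace_pointwise: "subspace S X W \<longleftrightarrow> elts W \<subseteq> L \<and> vzero S X \<in> elts W \<and>
    (\<forall>\<eta>\<in>elts W. \<forall>\<zeta>\<in>elts W. \<forall>\<xi>\<in>L.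
       (\<forall>x\<in>elts X. ap \<xi> x = cplus (ap \<eta> x) (ap \<zeta> x)) \<longrightarrow> \<xi> \<in> elts W) \<and>
    (\<forall>c\<in>CC. \<forall>\<eta>\<in>elts W. \<forall>\<xi>\<in>L. (\<forall>x\<in>elts X. ap \<xi> x = ctimes c (ap \<eta> x)) \<longrightarrow> \<xi> \<in> elts W)"
proof (cases "elts W \<subseteq> L")
  case True
  have a: "(\<forall>\<xi>\<in>L. (\<forall>x\<in>elts X. ap \<xi> x = cplus (ap \<eta> x) (ap \<zeta> x)) \<longrightarrow> \<xi> \<in> elts W) \<longleftrightarrow>
    vadd S X \<eta> \<zeta> \<in> elts W" if "\<eta> \<in> elts W" "\<zeta> \<in> elts W" for \<eta> \<zeta>
  proof -
    have L: "\<eta> \<in> L" "\<zeta> \<in> L" using that True by auto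
    note v = vadd_vec[OF L[THEN L_vec]]
    have "\<xi> = vadd S X \<eta> \<zeta>" if "\<xi> \<in> L" "\<forall>x\<in>elts X. ap \<xi> x = cplus (ap \<eta> x) (ap \<zeta> x)" for \<xi>
      using that v by (intro func_ext[OF L_vec v(1)]) auto
    then show ?thesis using vadd_L[OF L] v(2) by blast
  qed
  have s: "(\<forall>\<xi>\<in>L. (\<forall>x\<in>elts X. ap \<xi> x = ctimes c (ap \<eta> x)) \<longrightarrow> \<xi> \<in> elts W) \<longleftrightarrow>
    vscale S X c \<eta> \<in> elts W" if "\<eta> \<in> elts W" "c \<in> CC" for \<eta> c
  proof -
    have L: "\<eta> \<in> L" using that True by auto
    note v = vscale_vec[OF L_vec[OF L] that(2)]
    have "\<xi> = vscale S X c \<eta>" if "\<xi> \<in> L" "\<forall>x\<in>elts X. ap \<xi> x = ctimes c (ap \<eta> x)" for \<xi>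
      using that v by (intro func_ext[OF L_vec v(1)]) auto
    then show ?thesis using vscale_L[OF that(2) L] v(2) by blast
  qed
  show ?thesis unfolding subspace_def using True a s by (simp cong: ball_cong)
qed (simp add: subspace_def)

lemma definable_subspace: "definable_term t \<Longrightarrow> definable (\<lambda>e. subspace S X (t e))"
proof (rule definable_subst1[where K = "subspace S X"])
  show "definable (\<lambda>e. subspace S X (e 0))" unfolding subspace_pointwise by (intro definable_analysis)
qed

lemma subspaceD:
  assumes "subspace S X W"
  shows "elts W \<subseteq> L" "vzero S X \<in> elts W"
    "\<And>\<eta> \<zeta>. \<eta> \<in> elts W \<Longrightarrow> \<zeta> \<in> elts W \<Longrightarrow> vadd S X \<eta> \<zeta> \<in> elts W"
    "\<And>c \<eta>. c \<in> CC \<Longrightarrow> \<eta> \<in> elts W \<Longrightarrow> vscale S X c \<eta> \<in> elts W"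
  using assms unfolding subspace_def by blast+

text \<open>
  Induction on the support \<open>F\<close>. For the step to \<open>adjoin x F\<close> let \<open>W'\<close> consist of the elements of \<open>W\<close> that
  vanish at \<open>x\<close>; it has finitely many generators by the induction hypothesis. Either \<open>W'\<close> is all of \<open>W\<close>,
  or one further generator \<open>w0\<close> with a nonzero value at \<open>x\<close> suffices, because a suitable multiple of
  \<open>w0\<close> moves any element of \<open>W\<close> into \<open>W'\<close>. Generation is expressed through all subspaces \<open>Y\<close> that contain \<open>B\<close>,
  as in the definition of the span.
\<close>

lemma finitely_generated:
  assumes "F \<in> elts (Fin X)"
    and "subspace S X W" "\<And>w x. w \<in> elts W \<Longrightarrow> x \<in> elts X \<Longrightarrow> x \<notin> elts F \<Longrightarrow> ap w x = czero S"
  shows "\<exists>B. finite_set B \<and> elts B \<subseteq> elts W \<and>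
    (\<forall>Y. subspace S X Y \<and> elts B \<subseteq> elts Y \<longrightarrow> elts W \<subseteq> elts Y)"
proof -
  have "\<forall>W. subspace S X W \<and> (\<forall>w\<in>elts W. \<forall>x\<in>elts X. x \<notin> elts F \<longrightarrow> ap w x = czero S) \<longrightarrow>
    (\<exists>B. finite_set B \<and> elts B \<subseteq> elts W \<and>
      (\<forall>Y. subspace S X Y \<and> elts B \<subseteq> elts Y \<longrightarrow> elts W \<subseteq> elts Y))"
    using assms(1)
  proof (induction rule: Fin_induct)
    case definable
    show ?case by (intro definable_analysis definable_subspace)
  next
    case empty
    show ?case
    proof (intro allI impI, elim conjE)
      fix W assume W: "subspace S X W"
        and z: "\<forall>w\<in>elts W. \<forall>x\<in>elts X. x \<notin> elts empty \<longrightarrow> ap w x = czero S"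
      have "w = vzero S X" if w: "w \<in> elts W" for w
      proof (rule func_ext[OF _ vzero_vec(1)])
        show "is_vec w" using subspaceD(1)[OF W] w L_vec by blast
        show "ap w x = ap (vzero S X) x" if "x \<in> elts X" for x
          using z w that vzero_vec(2) by simp
      qed
      then have "elts W \<subseteq> elts Y" if "subspace S X Y" for Y
        using subspaceD(2)[OF that] by auto
      then show "\<exists>B. finite_set B \<and> elts B \<subseteq> elts W \<and>
          (\<forall>Y. subspace S X Y \<and> elts B \<subseteq> elts Y \<longrightarrow> elts W \<subseteq> elts Y)"
        by (intro exI[of _ empty]) (simp add: finite_empty)
    qed
  next
    case (adjoin F x)
    show ?case
    proof (intro allI impI, elim conjE)
      fix W assume W: "subspace S X W"
        and z: "\<forall>w\<in>elts W. \<forall>y\<in>elts X. y \<notin> elts (adjoin x F) \<longrightarrow> ap w y = czero S"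
      note vec = L_vec[OF subsetD[OF subspaceD(1)[OF W]]]
      have "definable (\<lambda>e. ap (e 0) x = czero S)" by (intro definable_analysis)
      then obtain W' where W': "elts W' = {w \<in> elts W. ap w x = czero S}"
        using definable_separation[of "\<lambda>w. ap w x = czero S"] by blast
      have sub': "subspace S X W'"
        unfolding subspace_def
      proof (intro conjI ballI)
        show "elts W' \<subseteq> L" using subspaceD(1)[OF W] W' by auto
        show "vzero S X \<in> elts W'" using subspaceD(2)[OF W] W' vzero_vec(2) adjoin(2) by simp
        show "vadd S X \<eta> \<zeta> \<in> elts W'" if "\<eta> \<in> elts W'" "\<zeta> \<in> elts W'" for \<eta> \<zeta>
          using that subspaceD(3)[OF W] vadd_vec(2)[OF vec vec adjoin(2)] cplus_zero by (simp add: W')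
        show "vscale S X c \<eta> \<in> elts W'" if "c \<in> CC" "\<eta> \<in> elts W'" for c \<eta>
          using that subspaceD(4)[OF W] vscale_vec(2)[OF vec _ adjoin(2)] ctimes_zero by (simp add: W')
      qed
      have supp': "\<forall>w\<in>elts W'. \<forall>y\<in>elts X. y \<notin> elts F \<longrightarrow> ap w y = czero S"
      proof (intro ballI impI)
        fix w y assume "w \<in> elts W'" "y \<in> elts X" "y \<notin> elts F"
        then show "ap w y = czero S" using z by (cases "y = x") (auto simp: W')
      qed
      obtain B where B: "finite_set B" "elts B \<subseteq> elts W'"
        "\<And>Y. subspace S X Y \<Longrightarrow> elts B \<subseteq> elts Y \<Longrightarrow> elts W' \<subseteq> elts Y"
        using adjoin(4) sub' supp' by blast
      show "\<exists>B. finite_set B \<and> elts B \<subseteq> elts W \<and>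
          (\<forall>Y. subspace S X Y \<and> elts B \<subseteq> elts Y \<longrightarrow> elts W \<subseteq> elts Y)"
      proof (cases "\<forall>w\<in>elts W. ap w x = czero S")
        case True
        then have "elts W' = elts W" using W' by auto
        then show ?thesis using B by metis
      next
        case False
        then obtain w0 where w0: "w0 \<in> elts W" "ap w0 x \<noteq> czero S" by blast
        have "elts W \<subseteq> elts Y" if Y: "subspace S X Y" and BY: "elts (adjoin w0 B) \<subseteq> elts Y" for Y
        proof
          fix w assume w: "w \<in> elts W"
          obtain c where c: "c \<in> CC" "cplus (ap w x) (ctimes c (ap w0 x)) = czero S"
            using complex_elimination[of "ap w x" "ap w0 x"] vec[OF w] vec[OF w0(1)] adjoin(2) w0(2)
            by auto
          let ?w = "vadd S X w (vscale S X c w0)"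
          note vs = vscale_vec[OF vec[OF w0(1)] c(1)]
          note va = vadd_vec[OF vec[OF w] vs(1)]
          have c': "ctimes cminus1 c \<in> CC" using c(1) by simp
          note vs' = vscale_vec[OF vec[OF w0(1)] c']
          have "?w \<in> elts W'"
            using subspaceD(3,4)[OF W] w w0(1) c va(2)[OF adjoin(2)] vs(2)[OF adjoin(2)]
            by (simp add: W')
          then have "?w \<in> elts Y" using B(3)[OF Y] BY by auto
          moreover have "vscale S X (ctimes cminus1 c) w0 \<in> elts Y"
            using subspaceD(4)[OF Y c'] BY by auto
          ultimately have "vadd S X ?w (vscale S X (ctimes cminus1 c) w0) \<in> elts Y"
            using subspaceD(3)[OF Y] by blast
          moreover have "vadd S X ?w (vscale S X (ctimes cminus1 c) w0) = w"
          proof (rule func_ext[OF vadd_vec(1)[OF va(1) vs'(1)] vec[OF w]])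
            fix y assume y: "y \<in> elts X"
            show "ap (vadd S X ?w (vscale S X (ctimes cminus1 c) w0)) y = ap w y"
              using vadd_vec(2)[OF va(1) vs'(1) y] va(2)[OF y] vs(2)[OF y] vs'(2)[OF y]
                cplus_ctimes_cancel[of "ap w y" c "ap w0 y"] vec[OF w] vec[OF w0(1)] c(1) y by simp
          qed
          ultimately show "w \<in> elts Y" by simp
        qed
        moreover have "finite_set (adjoin w0 B)" using B(1) finite_adjoin by blast
        moreover have "elts (adjoin w0 B) \<subseteq> elts W" using w0(1) B(2) W' by auto
        ultimately show ?thesis by blast
      qed
    qed
  qed
  then show ?thesis using assms(2,3) by blast
qed

section \<open>Compact operators\<close>

text \<open>
  The set \<open>G\<^sub>t\<close> of points at which the image of a ball is large. The number \<open>t\<close> bounds the squared norm of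
  \<open>\<eta>\<close> and the inverse of the squared value at the same time; one parameter instead of two makes
  the family linearly ordered by inclusion.
\<close>

definition large :: "'a \<Rightarrow> 'a \<Rightarrow> 'a \<Rightarrow> bool" where
  "large T t z \<longleftrightarrow> z \<in> elts X \<and> (\<exists>\<eta>\<in>L. sums_le \<eta> t \<and> 1\<^sub>R \<preceq> t *\<^sub>R modsq (ap (ap T \<eta>) z))"

text \<open>
  A net of mesh \<open>e\<close> for the image of the ball consists of finitely many functions, each of squared
  modulus at most \<open>e\<close> off a finite set. At a point outside of all these finite sets a large value of
  \<open>T \<eta>\<close> would be too far from the net, by the choice of \<open>e\<close> in \<open>small_radius\<close>.
\<close>

lemma large_finite:
  assumes T: "compact_operator S X T" and t: "t \<in> carrier FR" "0\<^sub>R \<preceq> t"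
  shows "\<exists>F\<in>elts (Fin X). \<forall>z. large T t z \<longrightarrow> z \<in> elts F"
proof -
  have fT: "func T (l2 S X) (l2 S X)"
    using T unfolding compact_operator_def linear_operator_def by blast
  obtain e where e: "e \<in> carrier FR" "0\<^sub>R \<preceq> e" "e \<noteq> 0\<^sub>R"
    and small: "\<And>c d. c \<in> carrier FR \<Longrightarrow> d \<in> carrier FR \<Longrightarrow> c \<preceq> e *\<^sub>R e \<Longrightarrow> d \<preceq> e \<Longrightarrow>
       \<not> 1\<^sub>R \<preceq> t *\<^sub>R ((1\<^sub>R +\<^sub>R 1\<^sub>R) *\<^sub>R (c +\<^sub>R d))"
    using F.small_radius[OF t] by blast
  have "definable (\<lambda>e. sums_le (e 0) t)" by (intro definable_sums_le definable_analysis)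
  then obtain A where A: "elts A = {\<eta> \<in> L. sums_le \<eta> t}"
    using definable_separation[of "\<lambda>\<eta>. sums_le \<eta> t"] by blast
  have "\<forall>\<eta>\<in>elts A. rle S (l2norm S X \<eta>) (1\<^sub>R +\<^sub>R t)"
    using l2norm_bound t by (auto simp: A)
  then have "bounded S X A" unfolding bounded_def using t by (intro bexI[of _ "1\<^sub>R +\<^sub>R t"]) auto
  moreover have AL: "elts A \<subseteq> L" using A by auto
  ultimately have "totally_bounded S X (image T A)"
    using T unfolding compact_operator_def by blast
  moreover have "e \<in> elts (Rset S)" "rless S (Rzero S) e" using e by (auto simp: rless_def)
  ultimately obtain N where N: "finite_set N" "elts N \<subseteq> L"
    and net: "\<And>\<eta>. \<eta> \<in> elts (image T A) \<Longrightarrow>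
      \<exists>\<zeta>\<in>elts N. rless S (l2norm S X (vdiff S X \<eta> \<zeta>)) e"
    unfolding totally_bounded_def by blast
  obtain F where F: "F \<in> elts (Fin X)"
    "\<forall>\<zeta>\<in>elts N. \<forall>x\<in>elts X. x \<notin> elts F \<longrightarrow> modsq (ap \<zeta> x) \<preceq> e"
    using tails_small[OF N e] by blast
  have "z \<in> elts F" if lz: "large T t z" for z
  proof (rule ccontr)
    assume zF: "z \<notin> elts F"
    obtain \<eta> where z: "z \<in> elts X" and \<eta>: "\<eta> \<in> L" "sums_le \<eta> t"
      and one: "1\<^sub>R \<preceq> t *\<^sub>R modsq (ap (ap T \<eta>) z)"
      using lz unfolding large_def by blast
    have "ap T \<eta> \<in> elts (image T A)" using elts_image[OF fT AL] A \<eta> by auto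
    then obtain \<zeta> where \<zeta>: "\<zeta> \<in> elts N" "rless S (l2norm S X (vdiff S X (ap T \<eta>) \<zeta>)) e"
      using net by blast
    have L: "ap T \<eta> \<in> L" "\<zeta> \<in> L" using ap_type[OF fT \<eta>(1)] \<zeta>(1) N by auto
    note v = L_vec[OF L(1)] L_vec[OF L(2)]
    let ?d = "vdiff S X (ap T \<eta>) \<zeta>"
    have vd: "is_vec ?d" "ap ?d z = cplus (ap (ap T \<eta>) z) (ctimes cminus1 (ap \<zeta> z))"
      using vdiff_vec[OF v] z by auto
    have c: "ap (ap T \<eta>) z \<in> CC" "ap \<zeta> z \<in> CC" "ap ?d z \<in> CC" using v vd z by auto
    have d1: "modsq (ap ?d z) \<preceq> e *\<^sub>R e"
      by (rule value_bound[OF vdiff_L[OF L] e(1,2) \<zeta>(2) z])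
    have d2: "modsq (ap \<zeta> z) \<preceq> e" using F(2) \<zeta>(1) z zF by blast
    have "modsq (cplus (ap ?d z) (ap \<zeta> z)) \<preceq> (1\<^sub>R +\<^sub>R 1\<^sub>R) *\<^sub>R (modsq (ap ?d z) +\<^sub>R modsq (ap \<zeta> z))"
      using modsq_cplus c by blast
    moreover have "cplus (ap ?d z) (ap \<zeta> z) = ap (ap T \<eta>) z"
      unfolding vd(2) using cplus_diff_cancel c by blast
    ultimately have "t *\<^sub>R modsq (ap (ap T \<eta>) z) \<preceq> t *\<^sub>R ((1\<^sub>R +\<^sub>R 1\<^sub>R) *\<^sub>R (modsq (ap ?d z) +\<^sub>R modsq (ap \<zeta> z)))"
      using t c by (intro F.mult_mono_left) auto
    then have "1\<^sub>R \<preceq> t *\<^sub>R ((1\<^sub>R +\<^sub>R 1\<^sub>R) *\<^sub>R (modsq (ap ?d z) +\<^sub>R modsq (ap \<zeta> z)))"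
      using one F.le_trans[OF _ _ _ one] t c by simp
    then show False using small[OF _ _ d1 d2] c by simp
  qed
  then show ?thesis using F(1) by blast
qed

text \<open>
  The family of all \<open>G\<^sub>t\<close> is a chain of finite sets and covers the supports of all \<open>T \<eta>\<close>.
\<close>

lemma range_finite_support:
  assumes X: "Cohen_finite X" and T: "compact_operator S X T"
  shows "\<exists>G\<in>elts (Fin X). \<forall>\<eta>\<in>L. \<forall>z\<in>elts X. z \<notin> elts G \<longrightarrow> ap (ap T \<eta>) z = czero S"
proof -
  have fT: "func T (l2 S X) (l2 S X)"
    using T unfolding compact_operator_def linear_operator_def by blast
  have DG: "definable (\<lambda>e. \<exists>t\<in>carrier FR. 0\<^sub>R \<preceq> t \<and> (\<forall>z. z \<in> elts (e 0) \<longleftrightarrow> large T t z))"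
    unfolding large_def by (intro definable_analysis definable_sums_le)
  obtain \<G> where \<G>: "elts \<G> = {G \<in> elts (Fin X).
      \<exists>t\<in>carrier FR. 0\<^sub>R \<preceq> t \<and> (\<forall>z. z \<in> elts G \<longleftrightarrow> large T t z)}"
    using definable_separation[of "\<lambda>G. \<exists>t\<in>carrier FR. 0\<^sub>R \<preceq> t \<and> (\<forall>z. z \<in> elts G \<longleftrightarrow> large T t z)", OF DG]
    by blast
  have cT: "modsq (ap (ap T \<eta>) z) \<in> carrier FR" "0\<^sub>R \<preceq> modsq (ap (ap T \<eta>) z)"
    if "\<eta> \<in> L" "z \<in> elts X" for \<eta> z
    using L_vec[OF ap_type[OF fT that(1)]] that(2) modsq_nonneg by auto
  have sums_le_mono: "sums_le \<eta> u" if "\<eta> \<in> L" "sums_le \<eta> t" "t \<preceq> u" "t \<in> carrier FR" "u \<in> carrier FR" for \<eta> t u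
    using that F.le_trans[of _ t u] psum_type[OF L_vec] unfolding sums_le_iff[OF L_vec[OF that(1)]] by blast
  have mono: "large T u z"
    if lz: "large T t z" and tu: "t \<preceq> u" "t \<in> carrier FR" "u \<in> carrier FR" for t u z
  proof -
    obtain \<eta> where z: "z \<in> elts X" and \<eta>: "\<eta> \<in> L" "sums_le \<eta> t"
      and one: "1\<^sub>R \<preceq> t *\<^sub>R modsq (ap (ap T \<eta>) z)"
      using lz unfolding large_def by blast
    have "modsq (ap (ap T \<eta>) z) *\<^sub>R t \<preceq> modsq (ap (ap T \<eta>) z) *\<^sub>R u"
      using cT \<eta> z tu by (intro F.mult_mono_left) auto
    then have "1\<^sub>R \<preceq> u *\<^sub>R modsq (ap (ap T \<eta>) z)"
      using F.le_trans[OF _ _ _ one] cT[OF \<eta>(1) z] tu by (simp add: F.m_comm)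
    then show ?thesis unfolding large_def using z \<eta>(1) sums_le_mono[OF \<eta> tu] by blast
  qed
  have "finite_set (big_union \<G>)"
  proof (rule chain_union_finite[OF X])
    show "elts \<G> \<subseteq> elts (Fin X)" by (auto simp: \<G>)
    fix A B assume "A \<in> elts \<G>" "B \<in> elts \<G>"
    then obtain t u where t: "t \<in> carrier FR" "\<And>z. z \<in> elts A \<longleftrightarrow> large T t z"
      and u: "u \<in> carrier FR" "\<And>z. z \<in> elts B \<longleftrightarrow> large T u z"
      unfolding \<G> by blast
    then show "elts A \<subseteq> elts B \<or> elts B \<subseteq> elts A"
      using F.le_total[OF t(1) u(1)] mono[of t _ u] mono[of u _ t] by blast
  qed
  moreover have "elts (big_union \<G>) \<subseteq> elts X" by (auto simp: \<G>)
  ultimately have "big_union \<G> \<in> elts (Fin X)" by simp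
  moreover have "ap (ap T \<eta>) z = czero S" if \<eta>: "\<eta> \<in> L" and z: "z \<in> elts X" "z \<notin> elts (big_union \<G>)" for \<eta> z
  proof (rule ccontr)
    let ?m = "modsq (ap (ap T \<eta>) z)"
    assume "ap (ap T \<eta>) z \<noteq> czero S"
    then have "?m \<noteq> 0\<^sub>R" using modsq_eq_zero L_vec[OF ap_type[OF fT \<eta>]] z(1) by auto
    then obtain i where i: "i \<in> carrier FR" "0\<^sub>R \<preceq> i" "?m *\<^sub>R i = 1\<^sub>R"
      using F.inverse_pos cT[OF \<eta> z(1)] by blast
    obtain b where b: "b \<in> carrier FR" "sums_le \<eta> b" using \<eta> by (auto simp: elts_l2)
    have b0: "0\<^sub>R \<preceq> b" using sums_le_nonneg \<eta> b by blast
    \<comment> \<open>With \<open>b\<close> a bound for the squared norm of \<open>\<eta>\<close> and \<open>i\<close> the inverse of the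
      squared value at \<open>z\<close>, the point \<open>z\<close> lies in \<open>G\<^sub>t\<close>.\<close>
    define t where "t = b +\<^sub>R i"
    have t: "t \<in> carrier FR" "0\<^sub>R \<preceq> t" "b \<preceq> t"
      unfolding t_def using b b0 i F.nonneg_add F.le_add_nonneg by auto
    have "t *\<^sub>R ?m = 1\<^sub>R +\<^sub>R b *\<^sub>R ?m"
      unfolding t_def using b i cT[OF \<eta> z(1)] by (simp add: F.l_distr F.m_comm F.a_comm)
    moreover have "1\<^sub>R \<preceq> 1\<^sub>R +\<^sub>R b *\<^sub>R ?m"
      using b b0 cT[OF \<eta> z(1)] F.nonneg_mult by (intro F.le_add_nonneg) auto
    ultimately have lz: "large T t z"
      unfolding large_def using z(1) \<eta> sums_le_mono[OF \<eta> b(2) t(3) b(1) t(1)] by auto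
    obtain F where F: "F \<in> elts (Fin X)" "\<forall>z. large T t z \<longrightarrow> z \<in> elts F"
      using large_finite[OF T t(1,2)] by blast
    have "definable (\<lambda>e. large T t (e 0))" unfolding large_def by (intro definable_analysis definable_sums_le)
    then obtain G where G: "elts G = {z \<in> elts F. large T t z}"
      using definable_separation[of "large T t"] by blast
    have "G \<in> elts (Fin X)" using F(1) G finite_subset[of F G] by auto
    moreover have "\<forall>z. z \<in> elts G \<longleftrightarrow> large T t z" using G F(2) by auto
    ultimately have "G \<in> elts \<G>" unfolding \<G> using t by blast
    then have "z \<in> elts (big_union \<G>)" using lz G F(2) by auto
    then show False using z(2) by blast
  qed
  ultimately show ?thesis by blast
qed

theorem compact_finite_rank:
  assumes X: "Cohen_finite X" and T: "compact_operator S X T"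
  shows "finite_rank S X T"
proof -
  have lin: "linear_operator S X T" using T unfolding compact_operator_def by blast
  then have fT: "func T (l2 S X) (l2 S X)" unfolding linear_operator_def by blast
  have add: "ap T (vadd S X \<eta> \<zeta>) = vadd S X (ap T \<eta>) (ap T \<zeta>)" if "\<eta> \<in> L" "\<zeta> \<in> L" for \<eta> \<zeta>
    using lin that vadd_L app_eq_ap[OF fT] unfolding linear_operator_def by auto
  have scale: "ap T (vscale S X c \<eta>) = vscale S X c (ap T \<eta>)" if "c \<in> CC" "\<eta> \<in> L" for c \<eta>
    using lin that vscale_L app_eq_ap[OF fT] unfolding linear_operator_def by auto
  define W where "W = image T (l2 S X)"
  have W: "elts W = {ap T \<eta> |\<eta>. \<eta> \<in> L}" unfolding W_def using elts_image[OF fT] by blast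
  have sub: "subspace S X W"
    unfolding subspace_def
  proof (intro conjI ballI)
    show WL: "elts W \<subseteq> L" using W ap_type[OF fT] by auto
    show "vadd S X \<eta> \<zeta> \<in> elts W" if w: "\<eta> \<in> elts W" "\<zeta> \<in> elts W" for \<eta> \<zeta>
    proof -
      obtain a b where ab: "\<eta> = ap T a" "a \<in> L" "\<zeta> = ap T b" "b \<in> L"
        using w unfolding W by blast
      then have "vadd S X \<eta> \<zeta> = ap T (vadd S X a b)" using add by simp
      then show ?thesis using W vadd_L[OF ab(2,4)] by blast
    qed
    show sc: "vscale S X c \<eta> \<in> elts W" if c: "c \<in> CC" and w: "\<eta> \<in> elts W" for c \<eta>
    proof -
      obtain a where a: "\<eta> = ap T a" "a \<in> L" using w unfolding W by blast
      then have "vscale S X c \<eta> = ap T (vscale S X c a)" using scale c by simp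
      then show ?thesis using W vscale_L[OF c a(2)] by blast
    qed
    have v: "ap T (vzero S X) \<in> elts W" using W vzero_L by blast
    have "vscale S X (czero S) (ap T (vzero S X)) = vzero S X"
    proof (rule func_ext[OF vscale_vec(1) vzero_vec(1)])
      show vec: "is_vec (ap T (vzero S X))" using v WL L_vec by blast
      fix x assume "x \<in> elts X"
      then show "ap (vscale S X (czero S) (ap T (vzero S X))) x = ap (vzero S X) x"
        using vscale_vec(2)[OF vec] vzero_vec(2) vec zero_ctimes by simp
    qed simp
    then show "vzero S X \<in> elts W" using sc[OF czero_closed v] by simp
  qed
  obtain G where G: "G \<in> elts (Fin X)"
    "\<forall>\<eta>\<in>L. \<forall>z\<in>elts X. z \<notin> elts G \<longrightarrow> ap (ap T \<eta>) z = czero S"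
    using range_finite_support[OF X T] by blast
  have "ap w z = czero S" if "w \<in> elts W" "z \<in> elts X" "z \<notin> elts G" for w z
    using that G(2) W by auto
  then obtain B where B: "finite_set B" "elts B \<subseteq> elts W"
    "\<And>Y. subspace S X Y \<Longrightarrow> elts B \<subseteq> elts Y \<Longrightarrow> elts W \<subseteq> elts Y"
    using finitely_generated[OF G(1) sub] by blast
  \<comment> \<open>The range is the least subspace that contains \<open>B\<close>; in particular the span is a set of the model.\<close>
  have "{\<eta>. \<forall>Y. subspace S X Y \<and> elts B \<subseteq> elts Y \<longrightarrow> \<eta> \<in> elts Y} = elts W"
    using B(2,3) sub by blast
  then have "span S X B = W" unfolding span_def by simp
  then show ?thesis
    unfolding finite_rank_def
    by (intro exI[of _ B] conjI) (use B(1,2) subspaceD(1)[OF sub] W_def in auto)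
qed

end

theorem mainTheorem5:
  fixes mem :: "'a \<Rightarrow> 'a \<Rightarrow> bool"
    and S :: "'a reals"
    and X T :: 'a
  assumes "ZF_model mem"
    and "membership.complete_ordered_field mem S"
    and "\<not> membership.finite_set mem X"
    and "membership.Cohen_finite mem X"
    and "membership.compact_operator mem S X T"
  shows "membership.finite_rank mem S X T"
proof -
  interpret ZF_l2 mem S X
    by (intro ZF_l2.intro ZF_l2_axioms.intro assms(1,2))
  show ?thesis using assms(4,5) by (rule compact_finite_rank)
qed

end
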